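(* Fix an integer $r\ge 1$. Suppose that $\Phi_r(t)\to\infty$ as $t\to\infty$ and that at least one of the following two conditions holds: (i) for every $\theta>0$, $\displaystyle \frac{\Phi_r(t_0+h)}{\Phi_r(t_0)}\to 1$ as $t_0\to\infty$, where $h=\dfrac{t_0}{r\Phi_r(t_0)}\,\theta$; (ii) $\displaystyle \frac{\Phi_{r+1}(t)}{\Phi_r^2(t)}\to 0$ as $t\to\infty$. Let $f(t_0)=\dfrac{t_0}{r\Phi_r(t_0)}$ and $\widehat{B}_r(\theta)=B_r((t_0,t_0+f(t_0)\theta])$ for $\theta\ge 0$. Then, as $t_0\to\infty$, the process $(\widehat{B}_r(\theta),\,\theta\ge 0)$ converges in distribution to a Poisson process of unit rate.
   Context: Setting (Poissonised infinite occupancy scheme). Let $p_1\ge p_2\ge\cdots>0$ with $\sum_{j\ge1}p_j=1$. Balls are thrown at the epochs of a unit rate Poisson process $P=(P(t),t\ge0)$, and each ball independently falls in box $j$ with probability $p_j$. Let $P_j(t)$ be the number of balls in box $j$ at time $t$; thus the $P_j$, $j\ge1$, are independent Poisson processes on $[0,\infty)$ with rates $p_j$, and $P=\sum_j P_j$. Let $\beta_{jr}=\inf\{t\ge0: P_j(t)=r\}$ be the time when box $j$ receives its $r$th ball, and let $B_r=\sum_{j\ge1}\delta_{\beta_{jr}}$ be the point process of $r$-record times, where $\delta_t$ is the unit mass at $t$. For $r\ge1$ let $\Phi_r(t)=\mathbb{E}\,|\{j:P_j(t)=r\}|=\sum_{j\ge1}e^{-tp_j}\frac{(tp_j)^r}{r!}$.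 Convergence in distribution: a point process on $\mathbb{R}_+=[0,\infty)$ is identified with its cumulative counting process; convergence in distribution means weak convergence in the space $M_p(\mathbb{R}_+)$ of locally finite point measures on $\mathbb{R}_+$ with the vague topology, equivalently weak convergence of the counting processes in the Skorokhod space $D(\mathbb{R}_+)$ with the $J_1$-topology. *)

theory Defs
  imports "HOL-Probability.Probability"
begin

definition borel_of :: "'s topology \<Rightarrow> 's measure" where
  "borel_of S = sigma (topspace S) {U. openin S U}"

definition converges_in_distribution ::
  "'s topology \<Rightarrow> 'i filter \<Rightarrow> 'a measure \<Rightarrow> ('i \<Rightarrow> 'a \<Rightarrow> 's) \<Rightarrow> 'b measure \<Rightarrow> ('b \<Rightarrow> 's) \<Rightarrow> bool" where
  "converges_in_distribution S F M Y M' Z \<longleftrightarrow>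
     (\<forall>\<^sub>F i in F. Y i \<in> M \<rightarrow>\<^sub>M borel_of S) \<and>
     Z \<in> M' \<rightarrow>\<^sub>M borel_of S \<and>
     (\<forall>g :: 's \<Rightarrow> real. continuous_map S euclideanreal g \<and> bounded (g ` topspace S) \<longrightarrow>
        ((\<lambda>i. \<integral>\<omega>. g (Y i \<omega>) \<partial>M) \<longlongrightarrow> (\<integral>\<omega>. g (Z \<omega>) \<partial>M')) F)"

abbreviation borel_nonneg :: "real measure" where
  "borel_nonneg \<equiv> restrict_space borel {0..}"

text \<open>The sum of the unit masses at the points \<open>x i\<close>, \<open>i \<in> I\<close> (with multiplicities),
  obtained as the image of the counting measure on \<open>I\<close>.\<close>

definition dirac_sum :: "'i set \<Rightarrow> ('i \<Rightarrow> real) \<Rightarrow> real measure" where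
  "dirac_sum I x = distr (count_space I) borel_nonneg x"

lemma emeasure_dirac_sum:
  assumes "\<And>i. i \<in> I \<Longrightarrow> 0 \<le> x i" and "A \<in> sets borel_nonneg"
  shows "emeasure (dirac_sum I x) A = emeasure (count_space I) {i \<in> I. x i \<in> A}"
proof -
  have "x \<in> count_space I \<rightarrow>\<^sub>M borel_nonneg"
    using assms(1) by (auto simp: space_restrict_space)
  then show ?thesis
    using assms(2) by (auto simp: dirac_sum_def emeasure_distr intro!: arg_cong2[where f = emeasure])
qed

definition point_measures :: "real measure set" where
  "point_measures =
     {\<mu>. (\<exists>(I :: nat set) x. x ` I \<subseteq> {0..} \<and> \<mu> = dirac_sum I x) \<and>
          (\<forall>K. compact K \<and> K \<subseteq> {0..} \<longrightarrow> emeasure \<mu> K < \<infinity>)}"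

text \<open>Continuous functions with compact support in the half-line; their values on the negative
  reals are irrelevant.\<close>

definition test_functions :: "(real \<Rightarrow> real) set" where
  "test_functions = {f. continuous_on {0..} f \<and> (\<exists>a. \<forall>x>a. f x = 0)}"

definition vague_topology :: "real measure topology" where
  "vague_topology =
     topology_generated_by
       {{\<mu> \<in> point_measures. (\<integral>x. f x \<partial>\<mu>) \<in> U} | f U. f \<in> test_functions \<and> open U}"

lemma topspace_vague_topology [simp]: "topspace vague_topology = point_measures"
proof -
  have "(\<lambda>x. 0) \<in> test_functions"
    by (auto simp: test_functions_def)
  then show ?thesis
    unfolding vague_topology_def topology_generated_by_topspace by auto
qed

text \<open>The measure on the half-line whose cumulative function is \<open>c\<close>, that is, the measure giving
  mass \<open>c t\<close> to \<open>{0..t}\<close> for every \<open>t \<ge> 0\<close>. This identifies a counting process with a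
  point process.\<close>

definition measure_of_counting :: "(real \<Rightarrow> real) \<Rightarrow> real measure" where
  "measure_of_counting c = restrict_space (interval_measure (\<lambda>t. if t < 0 then 0 else c t)) {0..}"

definition poisson_process :: "'a measure \<Rightarrow> real \<Rightarrow> (real \<Rightarrow> 'a \<Rightarrow> nat) \<Rightarrow> bool" where
  "poisson_process M rate N \<longleftrightarrow>
     prob_space M \<and> 0 < rate \<and>
     (\<forall>t\<ge>0. N t \<in> M \<rightarrow>\<^sub>M count_space UNIV) \<and>
     (\<forall>\<omega>\<in>space M. N 0 \<omega> = 0 \<and> mono_on {0..} (\<lambda>t. N t \<omega>) \<and>
        (\<forall>t\<ge>0. continuous (at_right t) (\<lambda>s. N s \<omega>))) \<and>
     (\<forall>(t :: nat \<Rightarrow> real) n. 0 \<le> t 0 \<and> (\<forall>i<n. t i < t (Suc i)) \<longrightarrow>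
        prob_space.indep_vars M (\<lambda>_. count_space UNIV)
          (\<lambda>i \<omega>. N (t (Suc i)) \<omega> - N (t i) \<omega>) {..<n}) \<and>
     (\<forall>s t. 0 \<le> s \<and> s < t \<longrightarrow>
        distr M (count_space UNIV) (\<lambda>\<omega>. N t \<omega> - N s \<omega>) =
        measure_pmf (poisson_pmf (rate * (t - s))))"

text \<open>Boxes are numbered from 0. Balls are numbered from 0 in order of arrival: \<open>P t\<close> is the
  number of balls thrown by time \<open>t\<close>, and \<open>X k\<close> is the box in which ball \<open>k\<close> falls.\<close>

definition occupancy_scheme ::
  "'a measure \<Rightarrow> (nat \<Rightarrow> real) \<Rightarrow> (real \<Rightarrow> 'a \<Rightarrow> nat) \<Rightarrow> (nat \<Rightarrow> 'a \<Rightarrow> nat) \<Rightarrow> bool" where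
  "occupancy_scheme M p P X \<longleftrightarrow>
     prob_space M \<and>
     antimono p \<and> (\<forall>j. 0 < p j) \<and> p sums 1 \<and>
     poisson_process M 1 P \<and>
     prob_space.indep_vars M (\<lambda>_. count_space UNIV) X UNIV \<and>
     (\<forall>k j. measure M {\<omega> \<in> space M. X k \<omega> = j} = p j) \<and>
     prob_space.indep_var M
       (PiM {0..} (\<lambda>_. count_space UNIV)) (\<lambda>\<omega>. \<lambda>t\<in>{0..}. P t \<omega>)
       (PiM UNIV (\<lambda>_. count_space UNIV)) (\<lambda>\<omega> k. X k \<omega>)"

definition box_count ::
  "(real \<Rightarrow> 'a \<Rightarrow> nat) \<Rightarrow> (nat \<Rightarrow> 'a \<Rightarrow> nat) \<Rightarrow> nat \<Rightarrow> real \<Rightarrow> 'a \<Rightarrow> nat" where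
  "box_count P X j t \<omega> = card {k. k < P t \<omega> \<and> X k \<omega> = j}"

text \<open>The infimum of the empty set is \<open>\<infinity>\<close>; boxes with infinite record time contribute no point.\<close>

definition record_time ::
  "(real \<Rightarrow> 'a \<Rightarrow> nat) \<Rightarrow> (nat \<Rightarrow> 'a \<Rightarrow> nat) \<Rightarrow> nat \<Rightarrow> nat \<Rightarrow> 'a \<Rightarrow> ereal" where
  "record_time P X j r \<omega> = Inf {ereal t | t. 0 \<le> t \<and> box_count P X j t \<omega> = r}"

definition record_process ::
  "(real \<Rightarrow> 'a \<Rightarrow> nat) \<Rightarrow> (nat \<Rightarrow> 'a \<Rightarrow> nat) \<Rightarrow> nat \<Rightarrow> 'a \<Rightarrow> real measure" where
  "record_process P X r \<omega> =
     dirac_sum {j. record_time P X j r \<omega> < \<infinity>} (\<lambda>j. real_of_ereal (record_time P X j r \<omega>))"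

definition Phi ::
  "'a measure \<Rightarrow> (real \<Rightarrow> 'a \<Rightarrow> nat) \<Rightarrow> (nat \<Rightarrow> 'a \<Rightarrow> nat) \<Rightarrow> nat \<Rightarrow> real \<Rightarrow> real" where
  "Phi M P X r t = (\<integral>\<omega>. real (card {j. box_count P X j t \<omega> = r}) \<partial>M)"

definition time_scale ::
  "'a measure \<Rightarrow> (real \<Rightarrow> 'a \<Rightarrow> nat) \<Rightarrow> (nat \<Rightarrow> 'a \<Rightarrow> nat) \<Rightarrow> nat \<Rightarrow> real \<Rightarrow> real" where
  "time_scale M P X r t0 = t0 / (real r * Phi M P X r t0)"

definition scaled_record_count ::
  "'a measure \<Rightarrow> (real \<Rightarrow> 'a \<Rightarrow> nat) \<Rightarrow> (nat \<Rightarrow> 'a \<Rightarrow> nat) \<Rightarrow> nat \<Rightarrow> real \<Rightarrow> real \<Rightarrow> 'a \<Rightarrow> real" where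
  "scaled_record_count M P X r t0 \<theta> \<omega> =
     measure (record_process P X r \<omega>) {t0<..t0 + time_scale M P X r t0 * \<theta>}"

end

theory Submission
  imports Defs
begin

text \<open>
  The reason for the limit is that the record process superposes independent points, one for each box,
  none of which matters on its own. If the boxes are independent of all arrival epochs, then by Poisson
  thinning the \<open>r\<close>-th ball of box \<open>j\<close> arrives after an Erlang time with density at most \<open>r / s\<close>,
  independently for different boxes, and the densities of all boxes add up to
  \<open>(r / s) \<phi>\<^sub>r(s)\<close>, where \<open>\<phi>\<^sub>r(s) = (\<Sum>j. (p j * s)^r / r! * exp (- p j * s))\<close>. In the time unit
  \<open>h = t0 / (r \<Phi>\<^sub>r(t0))\<close> the intensity at \<open>s = t0 + h \<theta>\<close> is \<open>(t0 / s) (\<phi>\<^sub>r(s) / \<Phi>\<^sub>r(t0))\<close>. Under (i) it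
  converges to 1, and it is locally bounded because \<open>\<phi>\<^sub>r(s) / s^r\<close> decreases (\<open>phi_growth\<close>), so its integrals
  converge as well (\<open>record_intensity_limit\<close>). Condition (ii) implies (i): since
  \<open>exp (- p s) \<ge> exp (- p t0) (1 - p (s - t0))\<close>, the sum \<open>\<phi>\<^sub>r\<close> cannot fall faster than \<open>\<phi>\<^sub>r\<^sub>+\<^sub>1\<close> allows
  (\<open>phi_decay\<close>, \<open>Phi_ratio_of_next_small\<close>).

  Convergence in distribution is read off from Laplace functionals
  (\<open>converges_in_distribution_Laplace\<close>). The Laplace functional of the record process at \<open>f\<close> is a product
  \<open>\<Prod>j. (1 - q j)\<close> with \<open>max q \<rightarrow> 0\<close> and \<open>\<Sum>j. q j\<close> tending to the integral of \<open>1 - exp (- f)\<close>; so it tends to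
  the exponential of minus this integral, which is the Laplace functional of the Poisson process
  (\<open>poisson_process_Laplace\<close>). That Laplace functionals suffice follows from two facts. The vague topology
  is induced by countably many integrals \<open>\<mu> \<mapsto> \<integral> e\<^sub>i d\<mu>\<close>, so \<open>\<mu> \<mapsto> (exp (- \<integral> e\<^sub>i d\<mu>))\<^sub>i\<close> sends it into the
  compact Hilbert cube; and there, by the Stone-Weierstrass theorem, expectations of continuous functions are
  governed by monomials, which are Laplace functionals again. A bounded continuous function of the measure
  is reached from there as an increasing limit of Lipschitz functions on sequences
  (\<open>vague_expectation_lower_limit\<close>).

  One point needs care. In the definition of the occupancy scheme the time index of the first of the two
  independent families runs over the natural numbers: the boxes \<open>X\<close> are independent of
  \<open>P 0, P 1, P 2, \<dots>\<close>, while the arrival epochs inside a unit interval may depend on them. The joint law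
  of the box contents is therefore determined at natural times, that is, the law of the record times
  rounded up to integers. This is enough for the limit, because \<open>\<Phi>\<^sub>r(t) / t \<rightarrow> 0\<close> makes \<open>h\<close> tend to
  infinity (\<open>time_scale_at_top\<close>), and rounding displaces a rescaled point by at most \<open>1 / h\<close>. Likewise
  \<open>\<Phi>\<^sub>r(t) = \<phi>\<^sub>r(t)\<close> holds at natural \<open>t\<close> and up to an error of 2 in general (\<open>Phi_close_phi\<close>).
\<close>

section \<open>The vague topology is induced by countably many evaluations\<close>

definition cutoff :: "nat \<Rightarrow> real \<Rightarrow> real" where
  "cutoff m x = max 0 (min 1 (real m + 1 - x))"

text \<open>Monomials of all degrees times cutoffs at all levels; the index encodes the pair of level and degree.
  Only non-negative functions are used, so that the exponentials below stay in the unit interval.\<close>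

definition probe :: "nat \<Rightarrow> real \<Rightarrow> real" where
  "probe i x = x ^ snd (prod_decode i) * cutoff (fst (prod_decode i)) x"

text \<open>The exponential maps the half-line onto a bounded interval and turns a product of coordinates into a Laplace
  functional.\<close>

definition cube_code :: "real measure \<Rightarrow> nat \<Rightarrow> real" where
  "cube_code \<mu> i = exp (- (\<integral>x. probe i x \<partial>\<mu>))"

lemma probe_in_test_functions: "probe i \<in> test_functions"
proof -
  have "continuous_on {0..} (probe i)"
    unfolding probe_def cutoff_def by (intro continuous_intros)
  moreover have "probe i x = 0" if "x > real (fst (prod_decode i)) + 1" for x
    using that by (simp add: probe_def cutoff_def)
  ultimately show ?thesis
    unfolding test_functions_def by blast
qed

lemma probe_nonneg: "0 \<le> x \<Longrightarrow> 0 \<le> probe i x"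
  by (simp add: probe_def cutoff_def)

lemma sets_point_measures:
  assumes "\<mu> \<in> point_measures"
  shows "sets \<mu> = sets borel_nonneg" "space \<mu> = {0..}"
  using assms by (auto simp: point_measures_def dirac_sum_def space_restrict_space)

lemma test_function_measurable:
  assumes "f \<in> test_functions"
  shows "f \<in> borel_measurable borel_nonneg"
  using assms by (auto simp: test_functions_def intro: borel_measurable_continuous_on_restrict)

lemma continuous_on_compact_abs_bounded:
  fixes f :: "'a::topological_space \<Rightarrow> real"
  assumes "compact S" "continuous_on S f"
  obtains C where "\<And>x. x \<in> S \<Longrightarrow> \<bar>f x\<bar> \<le> C"
proof -
  have "bounded (f ` S)"
    by (rule compact_imp_bounded[OF compact_continuous_image[OF assms(2,1)]])
  then show ?thesis
    using that by (fastforce simp: bounded_iff)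
qed

lemma test_function_bounded:
  assumes "f \<in> test_functions"
  obtains a C where "0 \<le> a" "\<And>x. x > a \<Longrightarrow> f x = 0" "\<And>x. 0 \<le> x \<Longrightarrow> \<bar>f x\<bar> \<le> C"
proof -
  from assms obtain a where c: "continuous_on {0..} f" and a: "\<And>x. x > a \<Longrightarrow> f x = 0"
    by (auto simp: test_functions_def)
  obtain C where C: "\<And>x. x \<in> {0..max 0 a} \<Longrightarrow> \<bar>f x\<bar> \<le> C"
    by (rule continuous_on_compact_abs_bounded[OF compact_Icc continuous_on_subset[OF c], of 0 "max 0 a"]) auto
  have "C \<ge> 0" using C[of 0] by auto
  then have "\<bar>f x\<bar> \<le> C" if "0 \<le> x" for x
    using C[of x] a[of x] that by (cases "x > max 0 a") auto
  then show ?thesis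
    using that[of "max 0 a"] a by auto
qed

lemma test_function_integrable:
  assumes \<mu>: "\<mu> \<in> point_measures" and f: "f \<in> test_functions"
  shows "integrable \<mu> f"
proof -
  obtain a C where aC: "0 \<le> a" "\<And>x. x > a \<Longrightarrow> f x = 0" "\<And>x. 0 \<le> x \<Longrightarrow> \<bar>f x\<bar> \<le> C"
    using test_function_bounded[OF f] by blast
  note [simp, measurable_cong] = sets_point_measures(1)[OF \<mu>]
  note sp = sets_point_measures(2)[OF \<mu>]
  have 1: "{0..a} \<in> sets \<mu>"
    by (auto simp: sets_restrict_space)
  have 2: "emeasure \<mu> {0..a} < \<infinity>"
    using \<mu> by (auto simp: point_measures_def)
  have 3: "f \<in> borel_measurable \<mu>"
    using test_function_measurable[OF f] by (simp cong: measurable_cong_sets)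
  show ?thesis
    by (rule integrableI_bounded_set[OF 1 3 2, of C]) (use aC sp in auto)
qed

text \<open>Uniform approximation relative to the cutoff is what controls the integral of the error,
  since the mass of a vaguely convergent sequence is bounded on compact sets only.\<close>

lemma test_function_approx:
  assumes f: "f \<in> test_functions"
  obtains m where "\<And>\<delta>. 0 < \<delta> \<Longrightarrow> \<exists>a d. \<forall>x\<ge>0.
    \<bar>f x - (\<Sum>k\<le>d. a k * probe (prod_encode (m, k)) x)\<bar> \<le> \<delta> * probe (prod_encode (m, 0)) x"
proof -
  obtain a where c: "continuous_on {0..} f" and a: "\<And>x. x > a \<Longrightarrow> f x = 0"
    using f by (auto simp: test_functions_def)
  obtain m :: nat where m: "a \<le> real m"
    using real_arch_simple by blast
  have "\<exists>b d. \<forall>x\<ge>0. \<bar>f x - (\<Sum>k\<le>d. b k * probe (prod_encode (m, k)) x)\<bar>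
      \<le> \<delta> * probe (prod_encode (m, 0)) x" if \<delta>: "0 < \<delta>" for \<delta> :: real
  proof -
    have "continuous_on {0..real m + 1} f"
      using c by (rule continuous_on_subset) auto
    then obtain g where g: "real_polynomial_function g"
      "\<And>x. x \<in> {0..real m + 1} \<Longrightarrow> \<bar>f x - g x\<bar> < \<delta>"
      using Stone_Weierstrass_real_polynomial_function[of "{0..real m + 1}" f \<delta>] \<delta> by auto
    then obtain b d where gb: "g = (\<lambda>x. \<Sum>k\<le>d. b k * x ^ k)"
      by (auto simp: real_polynomial_function_iff_sum)
    have "\<bar>f x - (\<Sum>k\<le>d. b k * probe (prod_encode (m, k)) x)\<bar> \<le> \<delta> * probe (prod_encode (m, 0)) x"
      if x: "0 \<le> x" for x
    proof -
      have eq: "(\<Sum>k\<le>d. b k * probe (prod_encode (m, k)) x) = g x * cutoff m x"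
        by (simp add: gb probe_def sum_distrib_right mult.assoc)
      have eq0: "probe (prod_encode (m, 0)) x = cutoff m x"
        by (simp add: probe_def)
      have "\<bar>f x - g x * cutoff m x\<bar> \<le> \<delta> * cutoff m x"
      proof (cases "x \<le> real m + 1")
        case False
        then show ?thesis using a[of x] m by (simp add: cutoff_def)
      next
        case True
        have fc: "f x = f x * cutoff m x"
          using a[of x] m by (cases "x \<le> real m") (auto simp: cutoff_def)
        have "\<bar>f x - g x * cutoff m x\<bar> = \<bar>f x - g x\<bar> * cutoff m x"
          by (subst fc) (simp add: left_diff_distrib[symmetric] abs_mult cutoff_def)
        also have "\<dots> \<le> \<delta> * cutoff m x"
          using g(2)[of x] x True by (intro mult_right_mono) (auto simp: cutoff_def)
        finally show ?thesis .
      qed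
      then show ?thesis by (simp add: eq eq0)
    qed
    then show ?thesis by blast
  qed
  then show ?thesis using that by blast
qed

text \<open>On a neighbourhood given by finitely many coordinates the integrals of the probes of degree at most \<open>d\<close>
  hardly vary, hence neither does that of an approximating polynomial; the probe of degree 0 bounds the mass
  seen by the approximation error, uniformly on the neighbourhood.\<close>

lemma integral_nhds_cube_code:
  assumes \<mu>0: "\<mu>0 \<in> point_measures" and f: "f \<in> test_functions" and \<epsilon>: "0 < \<epsilon>"
  obtains V where "open V" "cube_code \<mu>0 \<in> V"
    "\<And>\<mu>. \<mu> \<in> point_measures \<Longrightarrow> cube_code \<mu> \<in> V \<Longrightarrow> \<bar>(\<integral>x. f x \<partial>\<mu>) - (\<integral>x. f x \<partial>\<mu>0)\<bar> < \<epsilon>"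
proof -
  obtain m where m: "\<And>\<delta>. 0 < \<delta> \<Longrightarrow> \<exists>a d. \<forall>x\<ge>0.
    \<bar>f x - (\<Sum>k\<le>d. a k * probe (prod_encode (m, k)) x)\<bar> \<le> \<delta> * probe (prod_encode (m, 0)) x"
    using test_function_approx[OF f] by blast
  define e where "e k = probe (prod_encode (m, k))" for k
  define c where "c k = (\<integral>x. e k x \<partial>\<mu>0)" for k
  have e_test: "e k \<in> test_functions" for k
    unfolding e_def by (rule probe_in_test_functions)
  have c0: "0 \<le> c 0"
    unfolding c_def by (rule integral_nonneg_AE)
      (auto simp: e_def sets_point_measures[OF \<mu>0] intro!: AE_I2 probe_nonneg)
  define \<delta> where "\<delta> = \<epsilon> / (3 * (c 0 + 1))"
  have \<delta>: "0 < \<delta>" using \<epsilon> c0 by (simp add: \<delta>_def)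
  obtain a d where ad: "\<And>x. 0 \<le> x \<Longrightarrow> \<bar>f x - (\<Sum>k\<le>d. a k * e k x)\<bar> \<le> \<delta> * e 0 x"
    using m[OF \<delta>] unfolding e_def by blast
  define \<eta> where "\<eta> = min 1 (\<epsilon> / (3 * ((\<Sum>k\<le>d. \<bar>a k\<bar>) + 1)))"
  have S: "0 \<le> (\<Sum>k\<le>d. \<bar>a k\<bar>)" by (simp add: sum_nonneg)
  have \<eta>: "0 < \<eta>" "\<eta> \<le> 1" "\<eta> \<le> \<epsilon> / (3 * ((\<Sum>k\<le>d. \<bar>a k\<bar>) + 1))"
    using \<epsilon> S by (auto simp: \<eta>_def intro!: divide_pos_pos mult_pos_pos add_nonneg_pos)
  have third: "\<epsilon> / (3 * (u + 1)) * (u + 1) = \<epsilon> / 3" if "0 \<le> u" for u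
    using that by (simp add: field_simps)
  have \<eta>S: "\<eta> * (\<Sum>k\<le>d. \<bar>a k\<bar>) < \<epsilon> / 3"
  proof -
    have "\<eta> * (\<Sum>k\<le>d. \<bar>a k\<bar>) < \<eta> * ((\<Sum>k\<le>d. \<bar>a k\<bar>) + 1)"
      using \<eta> by simp
    also have "\<dots> \<le> \<epsilon> / (3 * ((\<Sum>k\<le>d. \<bar>a k\<bar>) + 1)) * ((\<Sum>k\<le>d. \<bar>a k\<bar>) + 1)"
      using \<eta>(3) S by (intro mult_right_mono) auto
    also have "\<epsilon> / (3 * ((\<Sum>k\<le>d. \<bar>a k\<bar>) + 1)) * ((\<Sum>k\<le>d. \<bar>a k\<bar>) + 1) = \<epsilon> / 3"
      by (rule third[OF S])
    finally show ?thesis .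
  qed
  \<comment> \<open>Neighbourhoods in the infinite product restrict only finitely many coordinates.\<close>
  define V where "V = (\<Inter>k\<in>{..d}. (\<lambda>v :: nat \<Rightarrow> real. v (prod_encode (m, k))) -` {exp (- c k - \<eta>)<..<exp (- c k + \<eta>)})"
  have "open V"
    unfolding V_def
    by (intro open_INT finite_atMost ballI open_vimage continuous_on_product_coordinates) auto
  moreover have code: "cube_code \<mu> (prod_encode (m, k)) = exp (- (\<integral>x. e k x \<partial>\<mu>))" for \<mu> k
    by (simp add: cube_code_def e_def)
  have "cube_code \<mu>0 \<in> V"
    using \<eta> by (auto simp: V_def code c_def)
  moreover have "\<bar>(\<integral>x. f x \<partial>\<mu>) - (\<integral>x. f x \<partial>\<mu>0)\<bar> < \<epsilon>"
    if \<mu>: "\<mu> \<in> point_measures" and V: "cube_code \<mu> \<in> V" for \<mu>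
  proof -
    define b where "b k = (\<integral>x. e k x \<partial>\<mu>)" for k
    have bc: "\<bar>b k - c k\<bar> < \<eta>" if "k \<le> d" for k
      using V that by (force simp: V_def code b_def abs_less_iff)
    have app: "\<bar>(\<integral>x. f x \<partial>\<nu>) - (\<Sum>k\<le>d. a k * (\<integral>x. e k x \<partial>\<nu>))\<bar> \<le> \<delta> * (\<integral>x. e 0 x \<partial>\<nu>)"
      if \<nu>: "\<nu> \<in> point_measures" for \<nu>
    proof -
      have ie: "integrable \<nu> (e k)" for k
        by (rule test_function_integrable[OF \<nu> e_test])
      have if': "integrable \<nu> f"
        by (rule test_function_integrable[OF \<nu> f])
      have "(\<integral>x. f x \<partial>\<nu>) - (\<Sum>k\<le>d. a k * (\<integral>x. e k x \<partial>\<nu>)) = (\<integral>x. f x - (\<Sum>k\<le>d. a k * e k x) \<partial>\<nu>)"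
        using ie if' by simp
      also have "\<bar>\<dots>\<bar> \<le> (\<integral>x. \<delta> * e 0 x \<partial>\<nu>)"
        using ie if' ad sets_point_measures(2)[OF \<nu>]
        by (intro integral_abs_bound[THEN order_trans] integral_mono) auto
      finally show ?thesis using ie by simp
    qed
    have "\<bar>(\<Sum>k\<le>d. a k * b k) - (\<Sum>k\<le>d. a k * c k)\<bar> \<le> (\<Sum>k\<le>d. \<bar>a k\<bar> * \<eta>)"
      unfolding sum_subtractf[symmetric] right_diff_distrib[symmetric]
      by (intro order_trans[OF sum_abs] sum_mono) (auto simp: abs_mult intro!: mult_left_mono less_imp_le[OF bc])
    then have 1: "\<bar>(\<Sum>k\<le>d. a k * b k) - (\<Sum>k\<le>d. a k * c k)\<bar> < \<epsilon> / 3"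
      using \<eta>S unfolding sum_distrib_right[symmetric] by (simp add: mult.commute)
    have "\<delta> * b 0 \<le> \<delta> * (c 0 + 1)"
      using bc[of 0] \<eta> \<delta> by (intro mult_left_mono) auto
    moreover have "\<delta> * c 0 \<le> \<delta> * (c 0 + 1)"
      using \<delta> by simp
    moreover have "\<delta> * (c 0 + 1) = \<epsilon> / 3"
      using c0 by (simp add: \<delta>_def field_simps)
    ultimately show ?thesis
      using 1 app[OF \<mu>] app[OF \<mu>0] unfolding b_def[symmetric] c_def[symmetric] by linarith
  qed
  ultimately show ?thesis using that by blast
qed

text \<open>An arbitrary union of vaguely open sets is thereby a single open set of a second countable space. Measurability
  for the Borel sets of the vague topology rests on this.\<close>

lemma vague_open_cube_code:
  assumes "openin vague_topology U"
  obtains V where "open V" "U = {\<mu> \<in> point_measures. cube_code \<mu> \<in> V}"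
proof -
  have "generate_topology_on {{\<mu> \<in> point_measures. (\<integral>x. f x \<partial>\<mu>) \<in> U} | f U. f \<in> test_functions \<and> open U} U"
    using assms unfolding vague_topology_def by (rule openin_topology_generated_by)
  then have "\<exists>V. open V \<and> U = {\<mu> \<in> point_measures. cube_code \<mu> \<in> V}"
  proof induction
    case Empty
    show ?case by (intro exI[of _ "{}"]) auto
  next
    case (Int A B)
    then obtain V W where "open V" "A = {\<mu> \<in> point_measures. cube_code \<mu> \<in> V}"
      "open W" "B = {\<mu> \<in> point_measures. cube_code \<mu> \<in> W}" by blast
    then show ?case by (intro exI[of _ "V \<inter> W"]) auto
  next
    case (UN K)
    then have "\<forall>k\<in>K. \<exists>V. open V \<and> k = {\<mu> \<in> point_measures. cube_code \<mu> \<in> V}"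
      by blast
    then obtain V where "\<forall>k\<in>K. open (V k) \<and> k = {\<mu> \<in> point_measures. cube_code \<mu> \<in> V k}"
      by (rule bchoice[THEN exE])
    note V = bspec[OF this]
    have mem: "x \<in> k \<longleftrightarrow> x \<in> point_measures \<and> cube_code x \<in> V k" if "k \<in> K" for x k
      using arg_cong[OF conjunct2[OF V[OF that]], of "\<lambda>S. x \<in> S"] by simp
    have "\<Union>K = {\<mu> \<in> point_measures. cube_code \<mu> \<in> (\<Union>k\<in>K. V k)}"
      by (rule set_eqI) (simp add: Union_iff mem cong: bex_cong)
    moreover have "open (\<Union>k\<in>K. V k)"
      by (intro open_UN ballI conjunct1[OF V])
    ultimately show ?case by blast
  next
    case (Basis A)
    then obtain f O' where f: "f \<in> test_functions" and O': "open O'"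
      and A: "A = {\<mu> \<in> point_measures. (\<integral>x. f x \<partial>\<mu>) \<in> O'}" by blast
    have "\<exists>V. open V \<and> cube_code \<mu>0 \<in> V \<and> (\<forall>\<mu>\<in>point_measures. cube_code \<mu> \<in> V \<longrightarrow> \<mu> \<in> A)"
      if \<mu>0: "\<mu>0 \<in> A" for \<mu>0
    proof -
      obtain \<epsilon> where \<epsilon>: "0 < \<epsilon>" "ball (\<integral>x. f x \<partial>\<mu>0) \<epsilon> \<subseteq> O'"
        using \<mu>0 A O' by (auto elim: openE)
      obtain V where V: "open V" "cube_code \<mu>0 \<in> V"
        "\<And>\<mu>. \<mu> \<in> point_measures \<Longrightarrow> cube_code \<mu> \<in> V \<Longrightarrow> \<bar>(\<integral>x. f x \<partial>\<mu>) - (\<integral>x. f x \<partial>\<mu>0)\<bar> < \<epsilon>"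
        using integral_nhds_cube_code[OF _ f \<epsilon>(1), of \<mu>0] \<mu>0 A by blast
      have "(\<integral>x. f x \<partial>\<mu>) \<in> ball (\<integral>x. f x \<partial>\<mu>0) \<epsilon>"
        if "\<mu> \<in> point_measures" "cube_code \<mu> \<in> V" for \<mu>
        using V(3)[OF that] by (simp add: dist_real_def abs_minus_commute)
      then show ?thesis using V \<epsilon> A by blast
    qed
    then obtain V where V: "\<And>\<mu>0. \<mu>0 \<in> A \<Longrightarrow> open (V \<mu>0) \<and> cube_code \<mu>0 \<in> V \<mu>0 \<and>
      (\<forall>\<mu>\<in>point_measures. cube_code \<mu> \<in> V \<mu>0 \<longrightarrow> \<mu> \<in> A)" by metis
    have "A = {\<mu> \<in> point_measures. cube_code \<mu> \<in> (\<Union>\<mu>0\<in>A. V \<mu>0)}"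
      using V A by fastforce
    then show ?case using V by (intro exI[of _ "\<Union>\<mu>0\<in>A. V \<mu>0"]) auto
  qed
  then show ?thesis using that by blast
qed

lemma measurable_vague:
  assumes PM: "\<And>\<omega>. \<omega> \<in> space M \<Longrightarrow> Y \<omega> \<in> point_measures"
    and m: "\<And>f. f \<in> test_functions \<Longrightarrow> (\<And>x. 0 \<le> x \<Longrightarrow> 0 \<le> f x) \<Longrightarrow> (\<lambda>\<omega>. \<integral>x. f x \<partial>Y \<omega>) \<in> borel_measurable M"
  shows "Y \<in> M \<rightarrow>\<^sub>M borel_of vague_topology"
    and "(\<lambda>\<omega>. cube_code (Y \<omega>)) \<in> borel_measurable M"
proof -
  show m': "(\<lambda>\<omega>. cube_code (Y \<omega>)) \<in> borel_measurable M"
  proof (rule measurable_coordinatewise_then_product)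
    fix i
    note [measurable] = m[OF probe_in_test_functions probe_nonneg, of i]
    show "(\<lambda>\<omega>. cube_code (Y \<omega>) i) \<in> borel_measurable M"
      unfolding cube_code_def by measurable
  qed
  show "Y \<in> M \<rightarrow>\<^sub>M borel_of vague_topology"
    unfolding borel_of_def
  proof (rule measurable_measure_of)
    show "{U. openin vague_topology U} \<subseteq> Pow (topspace vague_topology)"
      using openin_subset[of vague_topology] by auto
    show "Y \<in> space M \<rightarrow> topspace vague_topology"
      using PM by auto
    fix U assume "U \<in> {U. openin vague_topology U}"
    then obtain V where V: "open V" "U = {\<mu> \<in> point_measures. cube_code \<mu> \<in> V}"
      using vague_open_cube_code by blast
    have "Y -` U \<inter> space M = (\<lambda>\<omega>. cube_code (Y \<omega>)) -` V \<inter> space M"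
      using PM V(2) by auto
    also have "\<dots> \<in> sets M"
      using m' V(1) by (intro measurable_sets[of _ _ borel]) auto
    finally show "Y -` U \<inter> space M \<in> sets M" .
  qed
qed

section \<open>Laplace functionals determine convergence in distribution\<close>

text \<open>The products are built by one coordinate at a time, so that an induction over the algebra can absorb each new
  coordinate into a monomial factor.\<close>

inductive_set coord_algebra :: "((nat \<Rightarrow> real) \<Rightarrow> real) set" where
  const: "(\<lambda>v. c) \<in> coord_algebra"
| add: "F \<in> coord_algebra \<Longrightarrow> G \<in> coord_algebra \<Longrightarrow> (\<lambda>v. F v + G v) \<in> coord_algebra"
| coord: "F \<in> coord_algebra \<Longrightarrow> (\<lambda>v. v k * F v) \<in> coord_algebra"

lemma coord_algebra_scale: "G \<in> coord_algebra \<Longrightarrow> (\<lambda>v. c * G v) \<in> coord_algebra"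
proof (induction rule: coord_algebra.induct)
  case (add F G)
  then show ?case using coord_algebra.add by (simp add: distrib_left)
next
  case (coord F k)
  then show ?case using coord_algebra.coord[OF coord(2), of k] by (simp add: mult.left_commute)
qed (rule coord_algebra.const)

lemma coord_algebra_mult:
  "F \<in> coord_algebra \<Longrightarrow> G \<in> coord_algebra \<Longrightarrow> (\<lambda>v. F v * G v) \<in> coord_algebra"
proof (induction rule: coord_algebra.induct)
  case (const c)
  then show ?case by (rule coord_algebra_scale)
next
  case (add F1 F2)
  then show ?case using coord_algebra.add by (simp add: distrib_right)
next
  case (coord F k)
  then show ?case using coord_algebra.coord[OF coord(2), of k] by (simp add: mult.assoc)
qed

lemma coord_algebra_continuous: "F \<in> coord_algebra \<Longrightarrow> continuous_on S F"
  by (induction rule: coord_algebra.induct)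
    (auto intro!: continuous_intros continuous_on_subset[OF continuous_on_product_coordinates])

definition unit_cube :: "(nat \<Rightarrow> real) set" where
  "unit_cube = (\<Pi>\<^sub>E i\<in>UNIV. {0..1})"

lemma compact_unit_cube: "compact unit_cube"
proof -
  have "compactin (product_topology (\<lambda>i::nat. euclidean) UNIV) unit_cube"
    unfolding unit_cube_def by (subst compactin_PiE) auto
  then show ?thesis
    by (simp add: euclidean_product_topology)
qed

interpretation cube: function_ring_on coord_algebra unit_cube
proof
  show "compact unit_cube" by (rule compact_unit_cube)
  fix x y :: "nat \<Rightarrow> real" assume "x \<noteq> y"
  then obtain k where "x k \<noteq> y k" by auto
  then show "\<exists>f\<in>coord_algebra. f x \<noteq> f y"
    using coord_algebra.coord[OF coord_algebra.const[of 1], of k] by (intro bexI[of _ "\<lambda>v. v k * 1"]) auto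
qed (auto intro: coord_algebra_continuous coord_algebra.intros coord_algebra_mult)

lemma (in prob_space) integrable_on_cube:
  assumes "continuous_on UNIV G" "U \<in> borel_measurable M" "\<And>\<omega>. \<omega> \<in> space M \<Longrightarrow> U \<omega> \<in> unit_cube"
  shows "integrable M (\<lambda>\<omega>. G (U \<omega>) :: real)"
proof -
  obtain C where "\<And>v. v \<in> unit_cube \<Longrightarrow> \<bar>G v\<bar> \<le> C"
    by (rule continuous_on_compact_abs_bounded[OF compact_unit_cube continuous_on_subset[OF assms(1)]]) auto
  then show ?thesis
    using assms(3) borel_measurable_continuous_on[OF assms(1,2)]
    by (intro integrable_const_bound[of _ C]) auto
qed

lemma (in prob_space) expectation_cube_close:
  fixes H G :: "(nat \<Rightarrow> real) \<Rightarrow> real"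
  assumes "continuous_on UNIV H" "continuous_on UNIV G"
    and close: "\<And>v. v \<in> unit_cube \<Longrightarrow> \<bar>H v - G v\<bar> < e"
    and U: "U \<in> borel_measurable M" "\<And>\<omega>. \<omega> \<in> space M \<Longrightarrow> U \<omega> \<in> unit_cube"
  shows "\<bar>expectation (\<lambda>\<omega>. H (U \<omega>)) - expectation (\<lambda>\<omega>. G (U \<omega>))\<bar> \<le> e"
proof -
  have i: "integrable M (\<lambda>\<omega>. H (U \<omega>))" "integrable M (\<lambda>\<omega>. G (U \<omega>))"
    using integrable_on_cube[OF assms(1) U] integrable_on_cube[OF assms(2) U] by auto
  have "\<bar>\<integral>\<omega>. H (U \<omega>) - G (U \<omega>) \<partial>M\<bar> \<le> (\<integral>\<omega>. e \<partial>M)"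
    using i close U(2)
    by (intro integral_abs_bound[THEN order_trans] integral_mono) (auto intro: less_imp_le)
  then show ?thesis using i by (simp add: prob_space)
qed

text \<open>Stone-Weierstrass on the cube: monomials span a dense algebra.\<close>

lemma tendsto_expectation_cube:
  fixes V :: "'i \<Rightarrow> 'a \<Rightarrow> nat \<Rightarrow> real" and W :: "'b \<Rightarrow> nat \<Rightarrow> real" and H :: "(nat \<Rightarrow> real) \<Rightarrow> real"
  assumes M: "prob_space M" and M': "prob_space M'"
    and V: "\<forall>\<^sub>F i in F. V i \<in> borel_measurable M \<and> (\<forall>\<omega>\<in>space M. V i \<omega> \<in> unit_cube)"
    and W: "W \<in> borel_measurable M'" "\<And>\<omega>. \<omega> \<in> space M' \<Longrightarrow> W \<omega> \<in> unit_cube"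
    and mon: "\<And>ks. ((\<lambda>i. \<integral>\<omega>. prod_list (map (V i \<omega>) ks) \<partial>M) \<longlongrightarrow> (\<integral>\<omega>. prod_list (map (W \<omega>) ks) \<partial>M')) F"
    and H: "continuous_on UNIV H"
  shows "((\<lambda>i. \<integral>\<omega>. H (V i \<omega>) \<partial>M) \<longlongrightarrow> (\<integral>\<omega>. H (W \<omega>) \<partial>M')) F"
proof -
  interpret M: prob_space M by fact
  interpret M': prob_space M' by fact
  define m where "m ks v = prod_list (map v ks)" for ks and v :: "nat \<Rightarrow> real"
  have m_alg: "m ks \<in> coord_algebra" for ks
  proof (induction ks)
    case Nil
    then show ?case using coord_algebra.const[of 1] by (simp add: m_def)
  next
    case (Cons k ks)
    then show ?case using coord_algebra.coord[OF Cons.IH, of k] by (simp add: m_def)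
  qed
  have alg: "((\<lambda>i. \<integral>\<omega>. m ks (V i \<omega>) * G (V i \<omega>) \<partial>M) \<longlongrightarrow> (\<integral>\<omega>. m ks (W \<omega>) * G (W \<omega>) \<partial>M')) F"
    if "G \<in> coord_algebra" for G ks
    using that
  proof (induction arbitrary: ks rule: coord_algebra.induct)
    case (const c)
    then show ?case using tendsto_mult_right[OF mon[of ks], of c] by (simp add: m_def)
  next
    case (add G1 G2)
    have "((\<lambda>i. (\<integral>\<omega>. m ks (V i \<omega>) * G1 (V i \<omega>) \<partial>M) + (\<integral>\<omega>. m ks (V i \<omega>) * G2 (V i \<omega>) \<partial>M)) \<longlongrightarrow>
       (\<integral>\<omega>. m ks (W \<omega>) * G1 (W \<omega>) \<partial>M') + (\<integral>\<omega>. m ks (W \<omega>) * G2 (W \<omega>) \<partial>M')) F"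
      by (intro tendsto_add add.IH)
    also have "(\<integral>\<omega>. m ks (W \<omega>) * G1 (W \<omega>) \<partial>M') + (\<integral>\<omega>. m ks (W \<omega>) * G2 (W \<omega>) \<partial>M')
        = (\<integral>\<omega>. m ks (W \<omega>) * (G1 (W \<omega>) + G2 (W \<omega>)) \<partial>M')"
      unfolding distrib_left
      by (rule Bochner_Integration.integral_add[symmetric])
        (intro M'.integrable_on_cube[OF coord_algebra_continuous W] coord_algebra_mult m_alg add.hyps; assumption)+
    finally show ?case
    proof (rule Lim_transform_eventually)
      show "\<forall>\<^sub>F i in F. (\<integral>\<omega>. m ks (V i \<omega>) * G1 (V i \<omega>) \<partial>M) + (\<integral>\<omega>. m ks (V i \<omega>) * G2 (V i \<omega>) \<partial>M)
        = (\<integral>\<omega>. m ks (V i \<omega>) * (G1 (V i \<omega>) + G2 (V i \<omega>)) \<partial>M)"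
        using V
      proof eventually_elim
        case (elim i)
        show ?case
          unfolding distrib_left
          by (rule Bochner_Integration.integral_add[symmetric])
            (use elim in \<open>intro M.integrable_on_cube[OF coord_algebra_continuous] coord_algebra_mult m_alg add.hyps; blast\<close>)+
      qed
    qed
  next
    case (coord G k)
    show ?case using coord.IH[of "k # ks"] by (simp add: m_def mult_ac)
  qed
  show ?thesis
  proof (rule tendstoI)
    fix \<epsilon> :: real assume \<epsilon>: "0 < \<epsilon>"
    obtain G where G: "G \<in> coord_algebra" "\<And>v. v \<in> unit_cube \<Longrightarrow> \<bar>H v - G v\<bar> < \<epsilon> / 3"
      using cube.Stone_Weierstrass_basic[OF continuous_on_subset[OF H], of "\<epsilon> / 3"] \<epsilon> by auto
    have "((\<lambda>i. \<integral>\<omega>. G (V i \<omega>) \<partial>M) \<longlongrightarrow> (\<integral>\<omega>. G (W \<omega>) \<partial>M')) F"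
      using alg[OF G(1), of "[]"] by (simp add: m_def)
    then have "\<forall>\<^sub>F i in F. dist (\<integral>\<omega>. G (V i \<omega>) \<partial>M) (\<integral>\<omega>. G (W \<omega>) \<partial>M') < \<epsilon> / 3"
      using \<epsilon> by (intro tendstoD) auto
    with V show "\<forall>\<^sub>F i in F. dist (\<integral>\<omega>. H (V i \<omega>) \<partial>M) (\<integral>\<omega>. H (W \<omega>) \<partial>M') < \<epsilon>"
    proof eventually_elim
      case (elim i)
      have "\<bar>(\<integral>\<omega>. H (V i \<omega>) \<partial>M) - (\<integral>\<omega>. G (V i \<omega>) \<partial>M)\<bar> \<le> \<epsilon> / 3"
        using elim G by (intro M.expectation_cube_close H coord_algebra_continuous) auto
      moreover have "\<bar>(\<integral>\<omega>. H (W \<omega>) \<partial>M') - (\<integral>\<omega>. G (W \<omega>) \<partial>M')\<bar> \<le> \<epsilon> / 3"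
        using W G by (intro M'.expectation_cube_close H coord_algebra_continuous) auto
      ultimately show ?case
        using elim \<epsilon> unfolding dist_real_def by linarith
    qed
  qed
qed


text \<open>A continuous function \<open>g\<close> of the measure corresponds to a function on the image of \<open>cube_code\<close>, which need not
  be closed in the cube. The functions \<open>v \<mapsto> inf\<^sub>\<mu> (g \<mu> + n dist (cube_code \<mu>) v)\<close> are Lipschitz on all
  sequences and increase to \<open>g\<close> at the points of the image; each of them gives a lower bound for the limit.\<close>

lemma vague_expectation_lower_limit:
  fixes Y :: "'i \<Rightarrow> 'a \<Rightarrow> real measure" and Z :: "'b \<Rightarrow> real measure"
  assumes M: "prob_space M" and M': "prob_space M'"
    and Y: "\<forall>\<^sub>F i in F. (\<forall>\<omega>\<in>space M. Y i \<omega> \<in> point_measures) \<and>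
      Y i \<in> M \<rightarrow>\<^sub>M borel_of vague_topology \<and> (\<lambda>\<omega>. cube_code (Y i \<omega>)) \<in> borel_measurable M"
    and Z: "\<And>\<omega>. \<omega> \<in> space M' \<Longrightarrow> Z \<omega> \<in> point_measures"
      "Z \<in> M' \<rightarrow>\<^sub>M borel_of vague_topology" "(\<lambda>\<omega>. cube_code (Z \<omega>)) \<in> borel_measurable M'"
    and lim: "\<And>H :: (nat \<Rightarrow> real) \<Rightarrow> real. continuous_on UNIV H \<Longrightarrow>
      ((\<lambda>i. \<integral>\<omega>. H (cube_code (Y i \<omega>)) \<partial>M) \<longlongrightarrow> (\<integral>\<omega>. H (cube_code (Z \<omega>)) \<partial>M')) F"
    and g: "continuous_map vague_topology euclideanreal g" "\<And>\<mu>. \<mu> \<in> point_measures \<Longrightarrow> \<bar>g \<mu>\<bar> \<le> C"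
    and \<epsilon>: "0 < \<epsilon>"
  shows "\<forall>\<^sub>F i in F. (\<integral>\<omega>. g (Z \<omega>) \<partial>M') - \<epsilon> < (\<integral>\<omega>. g (Y i \<omega>) \<partial>M)"
proof -
  interpret M: prob_space M by fact
  interpret M': prob_space M' by fact
  define G where "G n v = (INF \<mu>\<in>point_measures. g \<mu> + real n * dist (cube_code \<mu>) v)" for n v
  have ne: "point_measures \<noteq> {}"
    using Z(1) M'.not_empty by auto
  have bdd: "bdd_below ((\<lambda>\<mu>. g \<mu> + real n * dist (cube_code \<mu>) v) ` point_measures)" for n v
  proof (rule bdd_belowI2)
    fix \<mu> assume "\<mu> \<in> point_measures"
    from g(2)[OF this] show "- C \<le> g \<mu> + real n * dist (cube_code \<mu>) v"
      by (intro add_increasing2) auto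
  qed
  have G_le: "G n v \<le> g \<mu> + real n * dist (cube_code \<mu>) v" if "\<mu> \<in> point_measures" for n v \<mu>
    unfolding G_def by (rule cINF_lower[OF bdd that])
  have G_code: "G n (cube_code \<mu>) \<le> g \<mu>" if "\<mu> \<in> point_measures" for n \<mu>
    using G_le[OF that, of n "cube_code \<mu>"] by simp
  have G_ge: "- C \<le> G n v" for n v
    unfolding G_def
  proof (rule cINF_greatest[OF ne])
    fix \<mu> assume "\<mu> \<in> point_measures"
    from g(2)[OF this] show "- C \<le> g \<mu> + real n * dist (cube_code \<mu>) v"
      by (intro add_increasing2) auto
  qed
  have G_lip: "G n v \<le> G n w + real n * dist v w" for n v w
  proof -
    have "G n v - real n * dist v w \<le> G n w"
      unfolding G_def[of n w]
    proof (rule cINF_greatest[OF ne])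
      fix \<mu> assume \<mu>: "\<mu> \<in> point_measures"
      have "real n * dist (cube_code \<mu>) v \<le> real n * (dist (cube_code \<mu>) w + dist v w)"
        by (intro mult_left_mono) (auto intro: dist_triangle2)
      then show "G n v - real n * dist v w \<le> g \<mu> + real n * dist (cube_code \<mu>) w"
        using G_le[OF \<mu>, of n v] by (simp add: distrib_left)
    qed
    then show ?thesis by simp
  qed
  have G_cont: "continuous_on UNIV (G n)" for n
  proof (rule lipschitz_on_continuous_on, rule lipschitz_onI)
    fix v w
    show "dist (G n v) (G n w) \<le> real n * dist v w"
      using G_lip[of n v w] G_lip[of n w v] by (simp add: dist_real_def dist_commute abs_le_iff)
  qed simp
  have G_lim: "(\<lambda>n. G n (cube_code \<mu>)) \<longlonglongrightarrow> g \<mu>" if \<mu>: "\<mu> \<in> point_measures" for \<mu>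
  proof (rule LIMSEQ_I)
    fix e :: real assume e: "0 < e"
    have "openin vague_topology {\<nu> \<in> topspace vague_topology. g \<nu> \<in> {g \<mu> - e/2<..}}"
      using g(1) by (intro openin_continuous_map_preimage) auto
    then obtain V where V: "open V"
      "{\<nu> \<in> topspace vague_topology. g \<nu> \<in> {g \<mu> - e/2<..}} = {\<nu> \<in> point_measures. cube_code \<nu> \<in> V}"
      by (rule vague_open_cube_code)
    have "\<mu> \<in> {\<nu> \<in> topspace vague_topology. g \<nu> \<in> {g \<mu> - e/2<..}}"
      using \<mu> e by simp
    then have "cube_code \<mu> \<in> V" unfolding V(2) by simp
    then obtain d where d: "0 < d" "ball (cube_code \<mu>) d \<subseteq> V"
      using V(1) by (auto elim: openE)
    obtain N where N: "g \<mu> + C \<le> real N * d"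
      using reals_Archimedean3[OF d(1)] by (meson less_imp_le)
    have lower: "g \<mu> - e/2 \<le> G n (cube_code \<mu>)" if n: "N \<le> n" for n
      unfolding G_def
    proof (rule cINF_greatest[OF ne])
      fix \<nu> assume \<nu>: "\<nu> \<in> point_measures"
      show "g \<mu> - e/2 \<le> g \<nu> + real n * dist (cube_code \<nu>) (cube_code \<mu>)"
      proof (cases "dist (cube_code \<nu>) (cube_code \<mu>) < d")
        case True
        then have "cube_code \<nu> \<in> V" using d(2) by (auto simp: dist_commute)
        then have "\<nu> \<in> {\<nu> \<in> topspace vague_topology. g \<nu> \<in> {g \<mu> - e/2<..}}"
          unfolding V(2) using \<nu> by simp
        then have "g \<mu> - e/2 < g \<nu>" by simp
        then show ?thesis by (intro add_increasing2) auto
      next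
        case False
        then have "real N * d \<le> real n * dist (cube_code \<nu>) (cube_code \<mu>)"
          using n d by (intro mult_mono) auto
        then show ?thesis using N g(2)[OF \<nu>] e by linarith
      qed
    qed
    have "norm (G n (cube_code \<mu>) - g \<mu>) < e" if "N \<le> n" for n
      using G_code[OF \<mu>, of n] e lower[OF that] unfolding real_norm_def abs_less_iff by linarith
    then show "\<exists>N. \<forall>n\<ge>N. norm (G n (cube_code \<mu>) - g \<mu>) < e"
      by blast
  qed
  have G_abs: "\<bar>G n (cube_code \<mu>)\<bar> \<le> C" if "\<mu> \<in> point_measures" for n \<mu>
    using G_ge[of n "cube_code \<mu>"] G_code[OF that, of n] g(2)[OF that] by (smt (verit, best))
  have gm: "g \<in> borel_of vague_topology \<rightarrow>\<^sub>M borel"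
  proof (rule borel_measurableI)
    fix S :: "real set" assume "open S"
    then have "openin vague_topology {\<nu> \<in> topspace vague_topology. g \<nu> \<in> S}"
      using g(1) by (intro openin_continuous_map_preimage) auto
    also have "{\<nu> \<in> topspace vague_topology. g \<nu> \<in> S} = g -` S \<inter> space (borel_of vague_topology)"
      by (auto simp: borel_of_def space_measure_of_conv)
    finally show "g -` S \<inter> space (borel_of vague_topology) \<in> sets (borel_of vague_topology)"
      using openin_subset[of vague_topology] by (auto simp: borel_of_def intro!: in_measure_of)
  qed
  have "(\<lambda>n. \<integral>\<omega>. G n (cube_code (Z \<omega>)) \<partial>M') \<longlonglongrightarrow> (\<integral>\<omega>. g (Z \<omega>) \<partial>M')"
    using G_lim[OF Z(1)] G_abs[OF Z(1)] measurable_compose[OF Z(2) gm]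
      borel_measurable_continuous_on[OF G_cont Z(3)]
    by (intro integral_dominated_convergence[where w = "\<lambda>_. C"]) auto
  then have "\<forall>\<^sub>F n in sequentially. (\<integral>\<omega>. g (Z \<omega>) \<partial>M') - \<epsilon> < (\<integral>\<omega>. G n (cube_code (Z \<omega>)) \<partial>M')"
    using \<epsilon> by (intro order_tendstoD) auto
  then obtain n where n: "(\<integral>\<omega>. g (Z \<omega>) \<partial>M') - \<epsilon> < (\<integral>\<omega>. G n (cube_code (Z \<omega>)) \<partial>M')"
    by (auto simp: eventually_sequentially)
  from order_tendstoD(1)[OF lim[OF G_cont] n] Y
  show ?thesis
  proof eventually_elim
    case (elim i)
    note elim(1)
    also have "(\<integral>\<omega>. G n (cube_code (Y i \<omega>)) \<partial>M) \<le> (\<integral>\<omega>. g (Y i \<omega>) \<partial>M)"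
    proof (rule integral_mono)
      show "integrable M (\<lambda>\<omega>. G n (cube_code (Y i \<omega>)))"
        using elim(2) G_abs borel_measurable_continuous_on[OF G_cont, of "\<lambda>\<omega>. cube_code (Y i \<omega>)" M]
        by (intro M.integrable_const_bound[of _ C]) auto
      show "integrable M (\<lambda>\<omega>. g (Y i \<omega>))"
        using elim(2) g(2) measurable_compose[OF _ gm, of "Y i" M]
        by (intro M.integrable_const_bound[of _ C]) auto
    qed (use elim(2) G_code in auto)
    finally show ?case .
  qed
qed

text \<open>A monomial in the coordinates of \<open>cube_code \<mu>\<close> equals \<open>exp (- \<integral> s d\<mu>)\<close> for a finite sum \<open>s\<close> of probes, which is
  again a test function. The upper limit follows from the lower one applied to \<open>- g\<close>.\<close>

lemma converges_in_distribution_Laplace: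
  assumes M: "prob_space M" and M': "prob_space M'"
    and Y: "\<forall>\<^sub>F i in F. (\<forall>\<omega>\<in>space M. Y i \<omega> \<in> point_measures) \<and>
      (\<forall>f\<in>test_functions. (\<forall>x\<ge>0. 0 \<le> f x) \<longrightarrow> (\<lambda>\<omega>. \<integral>x. f x \<partial>Y i \<omega>) \<in> borel_measurable M)"
    and Z: "\<And>\<omega>. \<omega> \<in> space M' \<Longrightarrow> Z \<omega> \<in> point_measures"
      "\<And>f. f \<in> test_functions \<Longrightarrow> (\<And>x. 0 \<le> x \<Longrightarrow> 0 \<le> f x) \<Longrightarrow> (\<lambda>\<omega>. \<integral>x. f x \<partial>Z \<omega>) \<in> borel_measurable M'"
    and lim: "\<And>f. f \<in> test_functions \<Longrightarrow> (\<And>x. 0 \<le> x \<Longrightarrow> 0 \<le> f x) \<Longrightarrow>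
      ((\<lambda>i. \<integral>\<omega>. exp (- (\<integral>x. f x \<partial>Y i \<omega>)) \<partial>M) \<longlongrightarrow> (\<integral>\<omega>. exp (- (\<integral>x. f x \<partial>Z \<omega>)) \<partial>M')) F"
  shows "converges_in_distribution vague_topology F M Y M' Z"
proof -
  have Y': "\<forall>\<^sub>F i in F. (\<forall>\<omega>\<in>space M. Y i \<omega> \<in> point_measures) \<and>
      Y i \<in> M \<rightarrow>\<^sub>M borel_of vague_topology \<and> (\<lambda>\<omega>. cube_code (Y i \<omega>)) \<in> borel_measurable M"
    using Y by eventually_elim (auto intro!: measurable_vague)
  have Z': "Z \<in> M' \<rightarrow>\<^sub>M borel_of vague_topology" "(\<lambda>\<omega>. cube_code (Z \<omega>)) \<in> borel_measurable M'"
    using measurable_vague[of M' Z] Z by blast+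
  have cube: "cube_code \<mu> \<in> unit_cube" if "\<mu> \<in> point_measures" for \<mu>
    using sets_point_measures(2)[OF that]
    by (auto simp: unit_cube_def cube_code_def intro!: integral_nonneg_AE AE_I2 probe_nonneg)
  define s where "s ks x = sum_list (map (\<lambda>k. probe k x) ks)" for ks x
  have s_test: "s ks \<in> test_functions" "\<And>x. 0 \<le> x \<Longrightarrow> 0 \<le> s ks x" for ks
  proof (induction ks)
    case Nil
    { case 1 show ?case by (auto simp: test_functions_def s_def) }
    { case 2 show ?case by (auto simp: s_def) }
  next
    case (Cons k ks)
    { case 1
      from Cons(1) probe_in_test_functions[of k] obtain a b
        where c: "continuous_on {0..} (s ks)" "continuous_on {0..} (probe k)"
          and "\<forall>x>a. s ks x = 0" "\<forall>x>b. probe k x = 0"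
        unfolding test_functions_def by blast
      then have "\<exists>a. \<forall>x>a. probe k x + s ks x = 0"
        by (intro exI[of _ "max a b"]) simp
      moreover have "continuous_on {0..} (\<lambda>x. probe k x + s ks x)"
        by (intro continuous_intros c)
      moreover have "s (k # ks) = (\<lambda>x. probe k x + s ks x)" by (auto simp: s_def)
      ultimately show ?case unfolding test_functions_def by auto }
    { case (2 x) then show ?case using Cons(2)[of x] probe_nonneg[of x k] by (simp add: s_def) }
  qed
  have monomial: "prod_list (map (cube_code \<mu>) ks) = exp (- (\<integral>x. s ks x \<partial>\<mu>))"
    if \<mu>: "\<mu> \<in> point_measures" for \<mu> ks
  proof (induction ks)
    case (Cons k ks)
    have "(\<integral>x. s (k # ks) x \<partial>\<mu>) = (\<integral>x. probe k x + s ks x \<partial>\<mu>)"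
      by (simp add: s_def)
    also have "\<dots> = (\<integral>x. probe k x \<partial>\<mu>) + (\<integral>x. s ks x \<partial>\<mu>)"
      by (intro Bochner_Integration.integral_add test_function_integrable[OF \<mu>] probe_in_test_functions s_test)
    finally show ?case using Cons by (simp add: cube_code_def exp_add[symmetric])
  qed (simp add: s_def)
  have cube_lim: "((\<lambda>i. \<integral>\<omega>. H (cube_code (Y i \<omega>)) \<partial>M) \<longlongrightarrow> (\<integral>\<omega>. H (cube_code (Z \<omega>)) \<partial>M')) F"
    if H: "continuous_on UNIV H" for H :: "(nat \<Rightarrow> real) \<Rightarrow> real"
  proof (rule tendsto_expectation_cube[OF M M' _ Z'(2) _ _ H])
    show "\<forall>\<^sub>F i in F. (\<lambda>\<omega>. cube_code (Y i \<omega>)) \<in> borel_measurable M \<and> (\<forall>\<omega>\<in>space M. cube_code (Y i \<omega>) \<in> unit_cube)"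
      using Y' by eventually_elim (auto intro: cube)
    show "cube_code (Z \<omega>) \<in> unit_cube" if "\<omega> \<in> space M'" for \<omega>
      using Z(1)[OF that] by (rule cube)
    fix ks
    have "((\<lambda>i. \<integral>\<omega>. exp (- (\<integral>x. s ks x \<partial>Y i \<omega>)) \<partial>M) \<longlongrightarrow> (\<integral>\<omega>. exp (- (\<integral>x. s ks x \<partial>Z \<omega>)) \<partial>M')) F"
      by (rule lim[OF s_test])
    also have "(\<integral>\<omega>. exp (- (\<integral>x. s ks x \<partial>Z \<omega>)) \<partial>M') = (\<integral>\<omega>. prod_list (map (cube_code (Z \<omega>)) ks) \<partial>M')"
      by (intro Bochner_Integration.integral_cong) (auto simp: monomial Z(1))
    finally show "((\<lambda>i. \<integral>\<omega>. prod_list (map (cube_code (Y i \<omega>)) ks) \<partial>M) \<longlongrightarrow>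
        (\<integral>\<omega>. prod_list (map (cube_code (Z \<omega>)) ks) \<partial>M')) F"
    proof (rule Lim_transform_eventually)
      show "\<forall>\<^sub>F i in F. (\<integral>\<omega>. exp (- (\<integral>x. s ks x \<partial>Y i \<omega>)) \<partial>M) = (\<integral>\<omega>. prod_list (map (cube_code (Y i \<omega>)) ks) \<partial>M)"
        using Y' by eventually_elim (intro Bochner_Integration.integral_cong, auto simp: monomial)
    qed
  qed
  have "((\<lambda>i. \<integral>\<omega>. g (Y i \<omega>) \<partial>M) \<longlongrightarrow> (\<integral>\<omega>. g (Z \<omega>) \<partial>M')) F"
    if g: "continuous_map vague_topology euclideanreal g" and b: "bounded (g ` topspace vague_topology)" for g
  proof -
    from b obtain C where C: "\<And>\<mu>. \<mu> \<in> point_measures \<Longrightarrow> \<bar>g \<mu>\<bar> \<le> C"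
      by (auto simp: bounded_iff)
    have g': "continuous_map vague_topology euclideanreal (\<lambda>\<mu>. - g \<mu>)"
      using g by (intro continuous_map_minus)
    have low: "\<forall>\<^sub>F i in F. (\<integral>\<omega>. h (Z \<omega>) \<partial>M') - \<epsilon> < (\<integral>\<omega>. h (Y i \<omega>) \<partial>M)"
      if "continuous_map vague_topology euclideanreal h" "\<And>\<mu>. \<mu> \<in> point_measures \<Longrightarrow> \<bar>h \<mu>\<bar> \<le> C" "0 < \<epsilon>"
      for h \<epsilon>
      by (rule vague_expectation_lower_limit[OF M M' Y' _ Z' _ that(1) _ that(3)])
        (use Z(1) that(2) cube_lim in auto)
    show ?thesis
    proof (rule tendstoI)
      fix \<epsilon> :: real assume \<epsilon>: "0 < \<epsilon>"
      have "\<forall>\<^sub>F i in F. - (\<integral>\<omega>. g (Z \<omega>) \<partial>M') - \<epsilon> < - (\<integral>\<omega>. g (Y i \<omega>) \<partial>M)"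
        using low[OF g' _ \<epsilon>] C by simp
      moreover have "\<forall>\<^sub>F i in F. (\<integral>\<omega>. g (Z \<omega>) \<partial>M') - \<epsilon> < (\<integral>\<omega>. g (Y i \<omega>) \<partial>M)"
        using low[OF g _ \<epsilon>] C by simp
      ultimately
      show "\<forall>\<^sub>F i in F. dist (\<integral>\<omega>. g (Y i \<omega>) \<partial>M) (\<integral>\<omega>. g (Z \<omega>) \<partial>M') < \<epsilon>"
        by eventually_elim (simp add: dist_real_def abs_less_iff)
    qed
  qed
  then show ?thesis
    using Y' Z' unfolding converges_in_distribution_def by (auto elim: eventually_mono)
qed

section \<open>Counting functions as point measures\<close>

text \<open>Both measures give the mass \<open>c b - c a\<close> to \<open>{a<..b}\<close>.\<close>

lemma measure_of_counting_eq_dirac_sum: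
  fixes I :: "'i set"
  assumes x0: "\<And>i. i \<in> I \<Longrightarrow> 0 \<le> x i"
    and fin: "\<And>t. finite {i \<in> I. x i \<le> t}"
    and c: "\<And>t. 0 \<le> t \<Longrightarrow> c t = real (card {i \<in> I. x i \<le> t})"
  shows "measure_of_counting c = dirac_sum I x"
proof -
  define F where "F t = real (card {i \<in> I. x i \<le> t})" for t
  have F: "(\<lambda>t. if t < 0 then 0 else c t) = F"
  proof
    fix t
    have "t < 0 \<Longrightarrow> card {i \<in> I. x i \<le> t} = 0"
      using x0 by (force intro: arg_cong[of _ "{}" card, simplified])
    then show "(if t < 0 then 0 else c t) = F t"
      using c[of t] by (auto simp: F_def)
  qed
  have mono: "F s \<le> F t" if "s \<le> t" for s t
    unfolding F_def of_nat_le_iff by (rule card_mono[OF fin]) (use that in auto)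
  have rcont: "continuous (at_right t) F" for t
  proof (subst continuous_at_right_real_increasing[OF mono], assumption, intro allI impI)
    fix e :: real assume e: "0 < e"
    define A where "A = insert 1 ((\<lambda>i. x i - t) ` {i \<in> I. x i \<le> t + 1 \<and> t < x i})"
    have "finite A"
      unfolding A_def by (intro finite.insertI finite_imageI finite_subset[OF _ fin[of "t + 1"]]) auto
    then have A: "0 < Min A" "Min A \<le> 1" "\<And>i. i \<in> I \<Longrightarrow> x i \<le> t + 1 \<Longrightarrow> t < x i \<Longrightarrow> Min A \<le> x i - t"
      by (auto simp: A_def)
    then have "{i \<in> I. x i \<le> t + Min A / 2} = {i \<in> I. x i \<le> t}"
      by force
    then have "F (t + Min A / 2) - F t < e"
      using e by (simp add: F_def)
    then show "\<exists>d>0. F (t + d) - F t < e"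
      using A by (intro exI[of _ "Min A / 2"]) auto
  qed
  have ioc: "emeasure (distr (count_space I) borel x) {a<..b} = ennreal (F b - F a)" if "a \<le> b" for a b
  proof -
    have "emeasure (distr (count_space I) borel x) {a<..b} = emeasure (count_space I) {i \<in> I. a < x i \<and> x i \<le> b}"
      by (subst emeasure_distr) (auto intro!: arg_cong2[where f = emeasure])
    also have "\<dots> = ennreal (real (card {i \<in> I. a < x i \<and> x i \<le> b}))"
      by (subst emeasure_count_space_finite)
        (auto intro: finite_subset[OF _ fin[of b]] simp: ennreal_of_nat_eq_real_of_nat)
    also have "{i \<in> I. a < x i \<and> x i \<le> b} = {i \<in> I. x i \<le> b} - {i \<in> I. x i \<le> a}"
      using that by auto
    also have "real (card \<dots>) = F b - F a"
      unfolding F_def using that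
      by (subst card_Diff_subset[OF fin]) (auto intro!: of_nat_diff card_mono fin)
    finally show ?thesis .
  qed
  have eq: "interval_measure F = distr (count_space I) borel x"
  proof (rule measure_eqI_generator_eq[where E = "range (\<lambda>(a, b). {a<..b})" and \<Omega> = UNIV and A = "\<lambda>n. {- real n<..real n}"])
    show "Int_stable (range (\<lambda>(a, b). {a<..b::real}))"
      by (auto simp: Int_stable_def)
    show "sets (interval_measure F) = sigma_sets UNIV (range (\<lambda>(a, b). {a<..b}))"
      "sets (distr (count_space I) borel x) = sigma_sets UNIV (range (\<lambda>(a, b). {a<..b}))"
      by (simp_all add: borel_sigma_sets_Ioc)
    fix S assume "S \<in> range (\<lambda>(a, b). {a<..b::real})"
    then obtain a b where S: "S = {a<..b}" by auto
    show "emeasure (interval_measure F) S = emeasure (distr (count_space I) borel x) S"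
    proof (cases "a \<le> b")
      case True
      then show ?thesis unfolding S by (simp add: ioc emeasure_interval_measure_Ioc mono rcont)
    qed (simp add: S)
  next
    show "(\<Union>n. {- real n<..real n}) = UNIV"
    proof (intro set_eqI iffI UNIV_I)
      fix t :: real
      obtain n where "\<bar>t\<bar> < real n" using reals_Archimedean2 by blast
      then show "t \<in> (\<Union>n. {- real n<..real n})" by (intro UN_I[of n]) auto
    qed
    show "emeasure (interval_measure F) {- real n<..real n} \<noteq> \<infinity>" for n
      by (subst emeasure_interval_measure_Ioc) (auto simp: mono rcont)
  qed auto
  show ?thesis
    unfolding measure_of_counting_def F eq
  proof (rule measure_eqI)
    show "sets (restrict_space (distr (count_space I) borel x) {0..}) = sets (dirac_sum I x)"
      by (simp add: dirac_sum_def sets_restrict_space)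
    fix A assume "A \<in> sets (restrict_space (distr (count_space I) borel x) {0..})"
    then have A: "A \<in> sets borel" "A \<subseteq> {0..}" "A \<in> sets borel_nonneg"
      by (auto simp: sets_restrict_space_iff sets_restrict_space)
    have "emeasure (restrict_space (distr (count_space I) borel x) {0..}) A = emeasure (count_space I) {i \<in> I. x i \<in> A}"
      using A by (subst emeasure_restrict_space)
        (auto simp: emeasure_distr intro!: arg_cong2[where f = emeasure])
    then show "emeasure (restrict_space (distr (count_space I) borel x) {0..}) A = emeasure (dirac_sum I x) A"
      by (subst emeasure_dirac_sum) (use x0 A in auto)
  qed
qed

lemma dirac_sum_in_point_measures:
  fixes I :: "nat set"
  assumes x0: "\<And>i. i \<in> I \<Longrightarrow> 0 \<le> x i" and fin: "\<And>t. finite {i \<in> I. x i \<le> t}"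
  shows "dirac_sum I x \<in> point_measures"
proof -
  have "emeasure (dirac_sum I x) K < \<infinity>" if K: "compact K" "K \<subseteq> {0..}" for K
  proof -
    obtain t where t: "\<And>y. y \<in> K \<Longrightarrow> y \<le> t"
      using K(1) by (meson bounded_imp_bdd_above compact_imp_bounded bdd_above_def)
    have "K \<in> sets borel_nonneg"
      using K by (auto simp: sets_restrict_space_iff intro: borel_compact)
    then have "emeasure (dirac_sum I x) K = emeasure (count_space I) {i \<in> I. x i \<in> K}"
      using x0 by (intro emeasure_dirac_sum)
    also have "\<dots> < \<infinity>"
      using t by (subst emeasure_count_space_finite) (auto intro: finite_subset[OF _ fin[of t]] simp: of_nat_less_top)
    finally show ?thesis .
  qed
  moreover have "x ` I \<subseteq> {0..}" using x0 by auto
  ultimately show ?thesis unfolding point_measures_def by blast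
qed

lemma integral_dirac_sum:
  assumes x0: "\<And>i. i \<in> I \<Longrightarrow> 0 \<le> x i" and fin: "finite {i \<in> I. x i \<le> a}"
    and f: "f \<in> test_functions" and a: "\<And>y. y > a \<Longrightarrow> f y = 0"
  shows "(\<integral>y. f y \<partial>dirac_sum I x) = (\<Sum>i | i \<in> I \<and> x i \<le> a. f (x i))"
proof -
  have "x \<in> count_space I \<rightarrow>\<^sub>M borel_nonneg"
    using x0 by (auto simp: space_restrict_space)
  then have "(\<integral>y. f y \<partial>dirac_sum I x) = (\<integral>i. f (x i) \<partial>count_space I)"
    unfolding dirac_sum_def by (rule integral_distr) (rule test_function_measurable[OF f])
  also have sub: "{i \<in> I. f (x i) \<noteq> 0} \<subseteq> {i \<in> I. x i \<le> a}"
    using a by (auto simp: not_less[symmetric])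
  have "(\<integral>i. f (x i) \<partial>count_space I) = (\<Sum>i | i \<in> I \<and> f (x i) \<noteq> 0. f (x i))"
    by (rule lebesgue_integral_count_space_finite_support) (rule finite_subset[OF sub fin])
  also have "\<dots> = (\<Sum>i | i \<in> I \<and> x i \<le> a. f (x i))"
    by (rule sum.mono_neutral_left[OF fin sub]) auto
  finally show ?thesis .
qed

section \<open>Right-continuous counting functions\<close>

text \<open>The infimum is attained: an integer-valued right-continuous function is constant on some interval to the
  right of every point.\<close>

lemma counting_function_Inf:
  fixes n :: "real \<Rightarrow> nat"
  assumes mono: "mono_on {0..} n" and rc: "\<And>t. 0 \<le> t \<Longrightarrow> continuous (at_right t) n"
    and ne: "0 \<le> s" "k \<le> n s"
  shows "0 \<le> Inf {t. 0 \<le> t \<and> k \<le> n t}" "k \<le> n (Inf {t. 0 \<le> t \<and> k \<le> n t})"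
proof -
  let ?S = "{t. 0 \<le> t \<and> k \<le> n t}"
  define \<tau> where "\<tau> = Inf ?S"
  have bdd: "bdd_below ?S" and nemp: "?S \<noteq> {}"
    using ne by (auto intro: bdd_belowI[of _ 0])
  show \<tau>0: "0 \<le> Inf ?S"
    by (rule cInf_greatest[OF nemp]) auto
  have "(n \<longlongrightarrow> n \<tau>) (at_right \<tau>)"
    using rc[of \<tau>] \<tau>0 by (simp add: \<tau>_def continuous_within)
  then have "\<forall>\<^sub>F u in at_right \<tau>. n u = n \<tau>"
    by (simp add: tendsto_discrete)
  then obtain b where b: "\<tau> < b" "\<And>u. \<tau> < u \<Longrightarrow> u < b \<Longrightarrow> n u = n \<tau>"
    unfolding eventually_at_right_field by blast
  obtain t where t: "t \<in> ?S" "t < b"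
    using cInf_lessD[OF nemp, of b] b(1) by (auto simp: \<tau>_def)
  have "\<tau> \<le> t" unfolding \<tau>_def by (rule cInf_lower[OF t(1) bdd])
  then show "k \<le> n (Inf ?S)"
    using b(2)[of t] t by (cases "t = \<tau>") (auto simp: \<tau>_def)
qed

lemma counting_function_Inf_le_iff:
  fixes n :: "real \<Rightarrow> nat"
  assumes mono: "mono_on {0..} n" and rc: "\<And>t. 0 \<le> t \<Longrightarrow> continuous (at_right t) n"
    and ne: "0 \<le> s" "k \<le> n s" and t: "0 \<le> t"
  shows "Inf {t. 0 \<le> t \<and> k \<le> n t} \<le> t \<longleftrightarrow> k \<le> n t"
proof
  assume "Inf {t. 0 \<le> t \<and> k \<le> n t} \<le> t"
  then show "k \<le> n t"
    using counting_function_Inf[OF assms(1-4)] t mono_onD[OF mono] by (meson atLeast_iff order_trans)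
next
  assume "k \<le> n t"
  then show "Inf {t. 0 \<le> t \<and> k \<le> n t} \<le> t"
    using t by (intro cInf_lower) (auto intro: bdd_belowI[of _ 0])
qed

lemma measure_of_counting_nat:
  fixes n :: "real \<Rightarrow> nat"
  assumes mono: "mono_on {0..} n" and rc: "\<And>t. 0 \<le> t \<Longrightarrow> continuous (at_right t) n"
  shows "measure_of_counting (\<lambda>t. real (n t)) \<in> point_measures"
    and "0 \<le> a \<Longrightarrow> a \<le> b \<Longrightarrow> emeasure (measure_of_counting (\<lambda>t. real (n t))) {a<..b} = ennreal (real (n b - n a))"
    and "emeasure (measure_of_counting (\<lambda>t. real (n t))) {0} = ennreal (real (n 0))"
proof -
  define I where "I = {k. \<exists>t\<ge>0. Suc k \<le> n t}"
  define x where "x k = Inf {t. 0 \<le> t \<and> Suc k \<le> n t}" for k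
  have x0: "0 \<le> x k" if "k \<in> I" for k
    using that counting_function_Inf(1)[OF mono rc] unfolding I_def x_def by blast
  have x_le: "x k \<le> t \<longleftrightarrow> k < n t" if k: "k \<in> I" and t: "0 \<le> t" for k t
  proof -
    obtain s where s: "0 \<le> s" "Suc k \<le> n s" using k by (auto simp: I_def)
    show ?thesis
      using counting_function_Inf_le_iff[OF mono rc s t] unfolding x_def by (simp add: Suc_le_eq)
  qed
  have set: "{k \<in> I. x k \<le> t} = {..<n t}" if "0 \<le> t" for t
    using x_le[OF _ that] that by (auto simp: I_def Suc_le_eq)
  have fin: "finite {k \<in> I. x k \<le> t}" for t
  proof (rule finite_subset)
    show "{k \<in> I. x k \<le> t} \<subseteq> {k \<in> I. x k \<le> max 0 t}" by auto
  qed (simp add: set)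
  have eq: "measure_of_counting (\<lambda>t. real (n t)) = dirac_sum I x"
    by (rule measure_of_counting_eq_dirac_sum[OF x0 fin]) (simp_all add: set)
  show "measure_of_counting (\<lambda>t. real (n t)) \<in> point_measures"
    unfolding eq by (rule dirac_sum_in_point_measures[OF x0 fin])
  have em: "emeasure (dirac_sum I x) A = ennreal (real (card {k \<in> I. x k \<in> A}))"
    if "A \<in> sets borel" "A \<subseteq> {0..t}" for A t
  proof -
    have A: "A \<in> sets borel_nonneg" using that by (auto simp: sets_restrict_space_iff)
    have "finite {k \<in> I. x k \<in> A}"
      by (rule finite_subset[OF _ fin[of t]]) (use that in auto)
    moreover have "emeasure (dirac_sum I x) A = emeasure (count_space I) {k \<in> I. x k \<in> A}"
      using x0 by (intro emeasure_dirac_sum A)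
    ultimately show ?thesis
      by (subst (asm) emeasure_count_space_finite) (auto simp: ennreal_of_nat_eq_real_of_nat)
  qed
  {
    assume ab: "0 \<le> a" "a \<le> b"
    have "{k \<in> I. x k \<in> {a<..b}} = {k \<in> I. x k \<le> b} - {k \<in> I. x k \<le> a}"
      by auto
    also have "\<dots> = {n a..<n b}"
      using ab by (subst (1 2) set) auto
    finally show "emeasure (measure_of_counting (\<lambda>t. real (n t))) {a<..b} = ennreal (real (n b - n a))"
      unfolding eq using ab by (subst em[of _ b]) auto
  }
  have "{k \<in> I. x k \<in> {0}} = {k \<in> I. x k \<le> 0}"
    using x0 by force
  then show "emeasure (measure_of_counting (\<lambda>t. real (n t))) {0} = ennreal (real (n 0))"
    unfolding eq by (subst em[of _ 0]) (auto simp: set)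
qed

text \<open>This serves twice, for the point measure of a Poisson path and for Lebesgue measure, so that both sides of
  the Laplace functional are discretised along the same grid.\<close>

lemma tendsto_Riemann_sums:
  fixes A :: nat
  assumes sets: "\<And>a b. 0 \<le> a \<Longrightarrow> {a<..b} \<in> sets \<nu>"
    and fin: "emeasure \<nu> {0<..real A} < \<infinity>"
    and h: "continuous_on {0..} h"
  shows "(\<lambda>n. \<Sum>k<Suc n * A. h (real (Suc k) / real (Suc n)) * measure \<nu> {real k / real (Suc n)<..real (Suc k) / real (Suc n)})
    \<longlonglongrightarrow> (\<integral>x. indicator {0<..real A} x * h x \<partial>\<nu>)"
proof -
  let ?J = "\<lambda>n k. {real k / real (Suc n)<..real (Suc k) / real (Suc n)}"
  define s where "s n x = (\<Sum>k<Suc n * A. h (real (Suc k) / real (Suc n)) * indicator (?J n k) x)" for n x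
  have J_sub: "?J n k \<subseteq> {0<..real A}" if "k < Suc n * A" for n k
  proof -
    have "real (Suc k) \<le> real (Suc n * A)" using that by (simp only: of_nat_le_iff Suc_le_eq)
    then have "real (Suc k) / real (Suc n) \<le> real A"
      by (simp add: divide_le_eq algebra_simps)
    moreover have "0 \<le> real k / real (Suc n)" by simp
    ultimately show ?thesis
      unfolding subset_iff greaterThanAtMost_iff by (meson order_le_less_trans order_trans)
  qed
  have J_fin: "emeasure \<nu> (?J n k) < \<infinity>" if "k < Suc n * A" for n k
    using emeasure_mono[OF J_sub[OF that] sets[of 0 "real A"]] fin by auto
  have s_val: "\<exists>y. s n x = h y \<and> \<bar>y - x\<bar> < 1 / real (Suc n) \<and> 0 \<le> y \<and> y \<le> real A" if x: "x \<in> {0<..real A}" for n x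
  proof -
    define k0 where "k0 = nat (\<lceil>x * real (Suc n)\<rceil> - 1)"
    have pos: "0 < x * real (Suc n)" using x by simp
    have k0: "real k0 = real_of_int \<lceil>x * real (Suc n)\<rceil> - 1"
      using pos by (simp add: k0_def less_ceiling_iff)
    have iff: "x \<in> ?J n k \<longleftrightarrow> k = k0" for k
    proof -
      have "x \<in> ?J n k \<longleftrightarrow> real k < x * real (Suc n) \<and> x * real (Suc n) \<le> real k + 1"
        by (auto simp: divide_less_eq le_divide_eq)
      also have "\<dots> \<longleftrightarrow> \<lceil>x * real (Suc n)\<rceil> = int k + 1"
        by (subst ceiling_eq_iff) auto
      also have "\<dots> \<longleftrightarrow> real k = real k0"
        unfolding k0 by linarith
      finally show ?thesis by simp
    qed
    have xJ: "x \<in> ?J n k0" by (simp only: iff)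
    have "real k0 < real (Suc n * A)"
    proof -
      have "real k0 < x * real (Suc n)" using xJ by (simp add: divide_less_eq)
      also have "\<dots> \<le> real A * real (Suc n)" using x by (intro mult_right_mono) auto
      finally show ?thesis by (simp add: algebra_simps)
    qed
    then have k0A: "k0 < Suc n * A" by (simp only: of_nat_less_iff)
    have "s n x = (\<Sum>k<Suc n * A. if k = k0 then h (real (Suc k) / real (Suc n)) else 0)"
      unfolding s_def by (intro sum.cong refl) (simp only: indicator_def iff, simp)
    also have "\<dots> = h (real (Suc k0) / real (Suc n))"
      using k0A by (simp add: sum.delta del: mult_Suc)
    finally have 1: "s n x = h (real (Suc k0) / real (Suc n))" .
    have 2: "\<bar>real (Suc k0) / real (Suc n) - x\<bar> < 1 / real (Suc n)"
    proof -
      have "real (Suc k0) / real (Suc n) = real k0 / real (Suc n) + 1 / real (Suc n)"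
        by (simp add: add_divide_distrib)
      moreover have "0 < 1 / real (Suc n)" by simp
      ultimately show ?thesis
        using xJ unfolding greaterThanAtMost_iff abs_less_iff by linarith
    qed
    have "real (Suc k0) / real (Suc n) \<in> ?J n k0" by (simp add: divide_less_eq)
    with J_sub[OF k0A] have "real (Suc k0) / real (Suc n) \<in> {0<..real A}" by blast
    with 1 2 show ?thesis by (intro exI[of _ "real (Suc k0) / real (Suc n)"]) auto
  qed
  have s_out: "s n x = 0" if "x \<notin> {0<..real A}" for n x
    unfolding s_def
  proof (rule sum.neutral, rule ballI)
    fix k assume "k \<in> {..<Suc n * A}"
    then have "x \<notin> ?J n k" using J_sub[of k n] that by blast
    then show "h (real (Suc k) / real (Suc n)) * indicator (?J n k) x = 0" by simp
  qed
  have lim: "(\<lambda>n. s n x) \<longlonglongrightarrow> indicator {0<..real A} x * h x" for x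
  proof (cases "x \<in> {0<..real A}")
    case False
    then show ?thesis by (simp add: s_out)
  next
    case True
    obtain y where y: "\<And>n. s n x = h (y n)" "\<And>n. \<bar>y n - x\<bar> < 1 / real (Suc n)" "\<And>n. 0 \<le> y n"
      using s_val[OF True] by metis
    have "(\<lambda>n. y n - x) \<longlonglongrightarrow> 0"
      by (rule LIMSEQ_norm_0) (use y(2) in auto)
    then have "y \<longlonglongrightarrow> x" by (simp add: LIM_zero_iff)
    then have "(\<lambda>n. h (y n)) \<longlonglongrightarrow> h x"
      using h y(3) True by (intro continuous_on_tendsto_compose[OF h]) auto
    then show ?thesis using True by (simp add: y(1))
  qed
  obtain C where C: "\<And>x. x \<in> {0..real A} \<Longrightarrow> \<bar>h x\<bar> \<le> C"
    by (rule continuous_on_compact_abs_bounded[OF compact_Icc continuous_on_subset[OF h], of 0 "real A"]) auto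
  have meas: "s n \<in> borel_measurable \<nu>" for n
    unfolding s_def using sets by (intro borel_measurable_sum borel_measurable_times borel_measurable_indicator) auto
  have "(\<lambda>n. \<integral>x. s n x \<partial>\<nu>) \<longlonglongrightarrow> (\<integral>x. indicator {0<..real A} x * h x \<partial>\<nu>)"
  proof (rule integral_dominated_convergence[where w = "\<lambda>x. C * indicator {0<..real A} x"])
    show "(\<lambda>x. indicator {0<..real A} x * h x) \<in> borel_measurable \<nu>"
      by (rule borel_measurable_LIMSEQ_real[OF lim meas])
    show "integrable \<nu> (\<lambda>x. C * indicator {0<..real A} x)"
      using fin sets by (intro integrable_mult_right integrable_real_indicator) auto
    show "AE x in \<nu>. norm (s n x) \<le> C * indicator {0<..real A} x" for n
    proof (rule AE_I2)
      fix x
      show "norm (s n x) \<le> C * indicator {0<..real A} x"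
      proof (cases "x \<in> {0<..real A}")
        case True
        then show ?thesis using s_val[OF True, of n] C by auto
      qed (simp add: s_out)
    qed
  qed (use lim meas in auto)
  also have "(\<lambda>n. \<integral>x. s n x \<partial>\<nu>) = (\<lambda>n. \<Sum>k<Suc n * A. h (real (Suc k) / real (Suc n)) * measure \<nu> (?J n k))"
  proof
    fix n
    have "integrable \<nu> (\<lambda>x. h (real (Suc k) / real (Suc n)) * indicator (?J n k) x)" if "k < Suc n * A" for k
      using sets J_fin[OF that] by (intro integrable_mult_right integrable_real_indicator) auto
    then have "(\<integral>x. s n x \<partial>\<nu>) = (\<Sum>k<Suc n * A. \<integral>x. h (real (Suc k) / real (Suc n)) * indicator (?J n k) x \<partial>\<nu>)"
      unfolding s_def by (intro Bochner_Integration.integral_sum) auto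
    also have "\<dots> = (\<Sum>k<Suc n * A. h (real (Suc k) / real (Suc n)) * measure \<nu> (?J n k))"
      by (intro sum.cong refl) (simp add: measure_restricted sets.Int_space_eq2[symmetric] sets)
    finally show "(\<integral>x. s n x \<partial>\<nu>) = (\<Sum>k<Suc n * A. h (real (Suc k) / real (Suc n)) * measure \<nu> (?J n k))" .
  qed
  finally show ?thesis .
qed

section \<open>Laplace functional of a Poisson process\<close>

lemma poisson_pgf:
  assumes "0 < c" "0 \<le> z" "z \<le> 1"
  shows "(\<integral>n. z ^ n \<partial>measure_pmf (poisson_pmf c)) = exp (- c * (1 - z))"
proof -
  have s: "(\<lambda>n. pmf (poisson_pmf c) n * z ^ n) sums exp (- c * (1 - z))"
  proof -
    have "(\<lambda>n. (c * z) ^ n / fact n * exp (- c)) sums (exp (c * z) * exp (- c))"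
      by (intro sums_mult2) (use exp_converges[of "c * z"] in \<open>simp add: divide_inverse mult.commute\<close>)
    then show ?thesis
      by (simp add: pmf_poisson[OF assms(1)] power_mult_distrib exp_add[symmetric] algebra_simps)
  qed
  have "integrable (count_space UNIV) (\<lambda>n. pmf (poisson_pmf c) n * z ^ n)"
    using s assms by (subst integrable_count_space_nat_iff) (simp add: abs_mult sums_iff)
  then have "(\<integral>n. pmf (poisson_pmf c) n * z ^ n \<partial>count_space UNIV) = exp (- c * (1 - z))"
    using s by (subst integral_count_space_nat) (auto simp: sums_iff)
  then show ?thesis
    by (simp add: measure_pmf_eq_density integral_density)
qed

lemma poisson_process_pgf:
  assumes N: "poisson_process M 1 N"
    and t: "0 \<le> t 0" "\<And>i. i < n \<Longrightarrow> t i < t (Suc i)"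
    and z: "\<And>i. i < n \<Longrightarrow> 0 \<le> z i" "\<And>i. i < n \<Longrightarrow> z i \<le> 1"
  shows "(\<integral>\<omega>. (\<Prod>i<n. z i ^ (N (t (Suc i)) \<omega> - N (t i) \<omega>)) \<partial>M)
    = exp (- (\<Sum>i<n. (t (Suc i) - t i) * (1 - z i)))"
proof -
  interpret prob_space M using N by (simp add: poisson_process_def)
  have t0: "0 \<le> t i" if "i \<le> n" for i
    using that
  proof (induction i)
    case (Suc i)
    then show ?case using t(2)[of i] by simp
  qed (rule t(1))
  define D where "D i \<omega> = N (t (Suc i)) \<omega> - N (t i) \<omega>" for i \<omega>
  have distr: "distr M (count_space UNIV) (D i) = measure_pmf (poisson_pmf (1 * (t (Suc i) - t i)))"
    if "i < n" for i
    using N t(2)[OF that] t0[of i] that unfolding poisson_process_def D_def by simp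
  have indep: "indep_vars (\<lambda>_. count_space UNIV) D {..<n}"
    using N t unfolding poisson_process_def D_def by blast
  then have D_meas: "D i \<in> M \<rightarrow>\<^sub>M count_space UNIV" if "i < n" for i
    using that unfolding indep_vars_def by blast
  have "indep_vars (\<lambda>_. borel) (\<lambda>i \<omega>. z i ^ D i \<omega>) {..<n}"
    by (rule indep_vars_compose2[OF indep]) auto
  then have "(\<integral>\<omega>. (\<Prod>i<n. z i ^ D i \<omega>) \<partial>M) = (\<Prod>i<n. \<integral>\<omega>. z i ^ D i \<omega> \<partial>M)"
  proof (rule indep_vars_lebesgue_integral[rotated])
    fix i assume i: "i \<in> {..<n}"
    then have "(\<lambda>\<omega>. z i ^ D i \<omega>) \<in> borel_measurable M"
      by (intro measurable_compose[OF D_meas]) auto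
    then show "integrable M (\<lambda>\<omega>. z i ^ D i \<omega>)"
      using z[of i] i by (intro integrable_const_bound[of _ 1]) (auto intro!: AE_I2 power_le_one)
  qed simp
  also have "\<dots> = (\<Prod>i<n. exp (- ((t (Suc i) - t i) * (1 - z i))))"
  proof (rule prod.cong[OF refl])
    fix i assume "i \<in> {..<n}"
    then have i: "i < n" by simp
    have "(\<integral>\<omega>. z i ^ D i \<omega> \<partial>M) = (\<integral>m. z i ^ m \<partial>distr M (count_space UNIV) (D i))"
      by (subst integral_distr[OF D_meas[OF i]]) auto
    also have "\<dots> = exp (- (t (Suc i) - t i) * (1 - z i))"
      unfolding distr[OF i] using t(2)[OF i] z[OF i] by (subst poisson_pgf) auto
    finally show "(\<integral>\<omega>. z i ^ D i \<omega> \<partial>M) = exp (- ((t (Suc i) - t i) * (1 - z i)))"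
      by (simp only: mult_minus_left)
  qed
  finally show ?thesis
    by (simp add: exp_sum[symmetric] sum_negf D_def)
qed

text \<open>For a Riemann sum in place of the integral, independence of the increments and the generating function of the
  Poisson distribution give the exponential of minus a Riemann sum of \<open>1 - exp (- f)\<close>.\<close>

lemma poisson_process_Laplace:
  assumes N: "poisson_process M 1 N"
    and f: "f \<in> test_functions" "\<And>x. 0 \<le> x \<Longrightarrow> 0 \<le> f x"
    and A: "\<And>x. x > real A \<Longrightarrow> f x = 0"
  shows "(\<lambda>\<omega>. \<integral>x. f x \<partial>measure_of_counting (\<lambda>\<theta>. real (N \<theta> \<omega>))) \<in> borel_measurable M" (is ?m)
    and "(\<integral>\<omega>. exp (- (\<integral>x. f x \<partial>measure_of_counting (\<lambda>\<theta>. real (N \<theta> \<omega>)))) \<partial>M)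
      = exp (- (\<integral>x. indicator {0<..real A} x * (1 - exp (- f x)) \<partial>lborel))" (is ?i)
proof -
  interpret prob_space M using N by (simp add: poisson_process_def)
  have meas[measurable]: "N t \<in> M \<rightarrow>\<^sub>M count_space UNIV" if "0 \<le> t" for t
    using N that by (simp add: poisson_process_def)
  have path: "N 0 \<omega> = 0" "mono_on {0..} (\<lambda>t. N t \<omega>)" "\<And>t. 0 \<le> t \<Longrightarrow> continuous (at_right t) (\<lambda>t. N t \<omega>)"
    if "\<omega> \<in> space M" for \<omega>
    using N that by (simp_all add: poisson_process_def)
  have cont: "continuous_on {0..} f" using f by (simp add: test_functions_def)
  define t where "t n k = real k / real (Suc n)" for n k
  have t0: "0 \<le> t n k" for n k by (simp add: t_def)
  have t_less: "t n k < t n (Suc k)" for n k by (simp add: t_def divide_strict_right_mono)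
  define S where "S n \<omega> = (\<Sum>k<Suc n * A. f (t n (Suc k)) * real (N (t n (Suc k)) \<omega> - N (t n k) \<omega>))" for n \<omega>
  have S_meas[measurable]: "S n \<in> borel_measurable M" for n
    unfolding S_def using t0 by measurable
  have S_lim: "(\<lambda>n. S n \<omega>) \<longlonglongrightarrow> (\<integral>x. f x \<partial>measure_of_counting (\<lambda>\<theta>. real (N \<theta> \<omega>)))" if \<omega>: "\<omega> \<in> space M" for \<omega>
  proof -
    let ?\<mu> = "measure_of_counting (\<lambda>\<theta>. real (N \<theta> \<omega>))"
    note mc = measure_of_counting_nat[OF path(2,3)[OF \<omega>], simplified]
    note sets = sets_point_measures[OF mc(1)]
    have ioc: "{a<..b} \<in> sets ?\<mu>" if "0 \<le> a" for a b
      unfolding sets(1) using that by (auto simp: sets_restrict_space_iff)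
    have "(\<lambda>n. \<Sum>k<Suc n * A. f (real (Suc k) / real (Suc n)) * measure ?\<mu> {real k / real (Suc n)<..real (Suc k) / real (Suc n)})
      \<longlonglongrightarrow> (\<integral>x. indicator {0<..real A} x * f x \<partial>?\<mu>)"
      by (rule tendsto_Riemann_sums[OF ioc _ cont]) (simp_all add: mc(2))
    also have "(\<integral>x. indicator {0<..real A} x * f x \<partial>?\<mu>) = (\<integral>x. f x \<partial>?\<mu>)"
    proof (rule integral_cong_AE)
      have "{0} \<in> null_sets ?\<mu>"
        using mc(3) path(1)[OF \<omega>] by (auto simp: null_sets_def sets(1) sets_restrict_space_iff)
      then have "AE x in ?\<mu>. x \<notin> {0}" by (rule AE_not_in)
      moreover have "AE x in ?\<mu>. x \<in> space ?\<mu>" by (rule AE_space)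
      ultimately show "AE x in ?\<mu>. indicator {0<..real A} x * f x = f x"
        by eventually_elim (use A in \<open>auto simp: sets(2) indicator_def\<close>)
      show "f \<in> borel_measurable ?\<mu>"
        using test_function_measurable[OF f(1)] sets(1) by (simp cong: measurable_cong_sets)
      then show "(\<lambda>x. indicator {0<..real A} x * f x) \<in> borel_measurable ?\<mu>"
        using ioc[of 0 "real A"] by (intro borel_measurable_times borel_measurable_indicator) auto
    qed
    also have "(\<lambda>n. \<Sum>k<Suc n * A. f (real (Suc k) / real (Suc n)) * measure ?\<mu> {real k / real (Suc n)<..real (Suc k) / real (Suc n)}) = (\<lambda>n. S n \<omega>)"
      unfolding S_def t_def by (intro ext sum.cong refl) (simp add: measure_def mc(2) divide_right_mono)
    finally show ?thesis .
  qed
  show m: ?m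
    by (rule borel_measurable_LIMSEQ_real[OF S_lim S_meas])
  have S0: "0 \<le> S n \<omega>" for n \<omega>
    unfolding S_def using f(2) t0 by (intro sum_nonneg mult_nonneg_nonneg) auto
  have "(\<lambda>n. \<integral>\<omega>. exp (- S n \<omega>) \<partial>M) \<longlonglongrightarrow> (\<integral>\<omega>. exp (- (\<integral>x. f x \<partial>measure_of_counting (\<lambda>\<theta>. real (N \<theta> \<omega>)))) \<partial>M)"
    using m S_lim S0
    by (intro integral_dominated_convergence[where w = "\<lambda>_. 1"]) (auto intro!: tendsto_intros AE_I2)
  moreover have "(\<integral>\<omega>. exp (- S n \<omega>) \<partial>M) = exp (- (\<Sum>k<Suc n * A. (1 - exp (- f (t n (Suc k)))) * measure lborel {t n k<..t n (Suc k)}))" for n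
  proof -
    define z where "z k = exp (- f (t n (Suc k)))" for k
    have z: "0 \<le> z k" "z k \<le> 1" for k
      using f(2)[OF t0] by (auto simp: z_def)
    have "(\<lambda>\<omega>. exp (- S n \<omega>)) = (\<lambda>\<omega>. \<Prod>k<Suc n * A. z k ^ (N (t n (Suc k)) \<omega> - N (t n k) \<omega>))"
      by (simp add: S_def z_def exp_of_nat_mult[symmetric] exp_sum[symmetric] sum_negf mult.commute del: mult_Suc)
    then show ?thesis
      using poisson_process_pgf[OF N, of "t n" "Suc n * A" z] t0 t_less[of n] z
      by (simp add: z_def mult.commute less_imp_le del: mult_Suc)
  qed
  moreover have "(\<lambda>n. exp (- (\<Sum>k<Suc n * A. (1 - exp (- f (t n (Suc k)))) * measure lborel {t n k<..t n (Suc k)})))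
    \<longlonglongrightarrow> exp (- (\<integral>x. indicator {0<..real A} x * (1 - exp (- f x)) \<partial>lborel))"
    unfolding t_def
    by (intro tendsto_exp tendsto_minus tendsto_Riemann_sums continuous_intros cont) auto
  ultimately show ?i
    using LIMSEQ_unique by auto
qed

section \<open>Independent thinning of the arrivals\<close>

lemma (in prob_space) indep_var_iterated_expectation:
  fixes h :: "'b \<times> 'b \<Rightarrow> real"
  assumes ind: "indep_var S U T V" and h: "h \<in> borel_measurable (S \<Otimes>\<^sub>M T)"
    and bound: "\<And>y. \<bar>h y\<bar> \<le> C"
  shows "(\<integral>\<omega>. h (U \<omega>, V \<omega>) \<partial>M) = (\<integral>\<omega>. (\<integral>\<omega>'. h (U \<omega>, V \<omega>') \<partial>M) \<partial>M)"
proof -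
  have U[measurable]: "U \<in> M \<rightarrow>\<^sub>M S" and V[measurable]: "V \<in> M \<rightarrow>\<^sub>M T"
    and joint: "distr M S U \<Otimes>\<^sub>M distr M T V = distr M (S \<Otimes>\<^sub>M T) (\<lambda>x. (U x, V x))"
    using ind unfolding indep_var_distribution_eq by auto
  interpret U: prob_space "distr M S U" by (rule prob_space_distr) measurable
  interpret V: prob_space "distr M T V" by (rule prob_space_distr) measurable
  interpret UV: pair_prob_space "distr M S U" "distr M T V" ..
  note [measurable] = h
  have "(\<integral>\<omega>. h (U \<omega>, V \<omega>) \<partial>M) = (\<integral>y. h y \<partial>(distr M S U \<Otimes>\<^sub>M distr M T V))"
    unfolding joint by (subst integral_distr) auto
  also have "\<dots> = (\<integral>u. (\<integral>v. h (u, v) \<partial>distr M T V) \<partial>distr M S U)"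
  proof (rule UV.integral_fst'[symmetric])
    show "integrable (distr M S U \<Otimes>\<^sub>M distr M T V) h"
      using bound by (intro UV.integrable_const_bound[of _ C]) auto
  qed
  also have "\<dots> = (\<integral>\<omega>. (\<integral>v. h (U \<omega>, v) \<partial>distr M T V) \<partial>M)"
    by (rule integral_distr) measurable
  also have "\<dots> = (\<integral>\<omega>. (\<integral>\<omega>'. h (U \<omega>, V \<omega>') \<partial>M) \<partial>M)"
  proof (rule Bochner_Integration.integral_cong[OF refl])
    fix \<omega> assume "\<omega> \<in> space M"
    then have [measurable]: "U \<omega> \<in> space S" using measurable_space[OF U] by simp
    show "(\<integral>v. h (U \<omega>, v) \<partial>distr M T V) = (\<integral>\<omega>'. h (U \<omega>, V \<omega>') \<partial>M)"
      by (rule integral_distr) measurable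
  qed
  finally show ?thesis .
qed

lemma prod_blocks:
  fixes n :: "nat \<Rightarrow> nat"
  assumes "n 0 = 0" "\<And>i. i < l \<Longrightarrow> n i \<le> n (Suc i)"
  shows "(\<Prod>i<l. \<Prod>k\<in>{n i..<n (Suc i)}. f k) = (\<Prod>k<n l. f k :: real)"
  using assms(2)
proof (induction l)
  case (Suc l)
  have "0 \<le> n l" "n l \<le> n (Suc l)" using Suc.prems by auto
  then show ?case
    using Suc prod.atLeastLessThan_concat[of 0 "n l" "n (Suc l)" f] by (simp add: atLeast0LessThan)
qed (simp add: assms)

locale poissonised_occupancy = prob_space M for M :: "'a measure" +
  fixes p :: "nat \<Rightarrow> real" and P :: "real \<Rightarrow> 'a \<Rightarrow> nat" and X :: "nat \<Rightarrow> 'a \<Rightarrow> nat"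
  assumes scheme: "occupancy_scheme M p P X"
begin

lemma p_pos: "0 < p j" and p_sums: "p sums 1"
  and P_poisson: "poisson_process M 1 P"
  and X_indep: "indep_vars (\<lambda>_. count_space UNIV) X UNIV"
  and X_prob: "prob {\<omega> \<in> space M. X k \<omega> = j} = p j"
  and PX_indep: "indep_var (PiM UNIV (\<lambda>_. count_space UNIV)) (\<lambda>\<omega> i. P (real i) \<omega>)
       (PiM UNIV (\<lambda>_. count_space UNIV)) (\<lambda>\<omega> k. X k \<omega>)"
  using scheme by (simp_all add: occupancy_scheme_def atLeast_0)

lemma P_meas[measurable (raw)]: "0 \<le> t \<Longrightarrow> P t \<in> M \<rightarrow>\<^sub>M count_space UNIV"
  using P_poisson by (simp add: poisson_process_def)

lemma P_0: "\<omega> \<in> space M \<Longrightarrow> P 0 \<omega> = 0"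
  and P_mono: "\<omega> \<in> space M \<Longrightarrow> mono_on {0..} (\<lambda>t. P t \<omega>)"
  and P_rc: "\<omega> \<in> space M \<Longrightarrow> 0 \<le> t \<Longrightarrow> continuous (at_right t) (\<lambda>t. P t \<omega>)"
  using P_poisson by (simp_all add: poisson_process_def)

lemma P_le: "\<omega> \<in> space M \<Longrightarrow> 0 \<le> s \<Longrightarrow> s \<le> t \<Longrightarrow> P s \<omega> \<le> P t \<omega>"
  using monotone_onD[OF P_mono] by fastforce

lemma X_meas[measurable]: "X k \<in> M \<rightarrow>\<^sub>M count_space UNIV"
  using X_indep unfolding indep_vars_def by blast

text \<open>The factor that a ball in box \<open>x\<close> arriving during the time interval from \<open>i\<close> to \<open>i + 1\<close> contributes to
  \<open>\<Prod>j<J. z j ^ c j\<close>, where \<open>c j\<close> counts the balls in box \<open>j\<close> by time \<open>idx j\<close>.\<close>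

definition block_weight :: "nat \<Rightarrow> (nat \<Rightarrow> nat) \<Rightarrow> (nat \<Rightarrow> real) \<Rightarrow> nat \<Rightarrow> nat \<Rightarrow> real" where
  "block_weight J idx z i x = (\<Prod>j<J. if x = j \<and> i < idx j then z j else 1)"

lemma block_weight_bounds:
  assumes "\<And>j. j < J \<Longrightarrow> 0 \<le> z j" "\<And>j. j < J \<Longrightarrow> z j \<le> 1"
  shows "0 \<le> block_weight J idx z i x" "block_weight J idx z i x \<le> 1"
  unfolding block_weight_def using assms by (auto intro!: prod_nonneg prod_le_1)

lemma expectation_block_weight:
  "expectation (\<lambda>\<omega>. block_weight J idx z i (X k \<omega>)) = 1 - (\<Sum>j<J. p j * (if i < idx j then 1 - z j else 0))"
proof -
  have eq: "block_weight J idx z i x = 1 - (\<Sum>j<J. (if i < idx j then 1 - z j else 0) * indicator {j} x)" for x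
  proof -
    have "block_weight J idx z i x = (\<Prod>j<J. if j = x then (if i < idx j then z j else 1) else 1)"
      unfolding block_weight_def by (intro prod.cong) auto
    also have "\<dots> = (if x < J then (if i < idx x then z x else 1) else 1)"
      by (simp add: prod.delta)
    finally have 1: "block_weight J idx z i x = (if x < J then (if i < idx x then z x else 1) else 1)" .
    have "(\<Sum>j<J. (if i < idx j then 1 - z j else 0) * indicator {j} x)
        = (\<Sum>j<J. if j = x then (if i < idx j then 1 - z j else 0) else 0)"
      by (intro sum.cong) (auto simp: indicator_def)
    also have "\<dots> = (if x < J then (if i < idx x then 1 - z x else 0) else 0)"
      by (simp add: sum.delta)
    finally show ?thesis using 1 by simp
  qed
  have ind: "expectation (\<lambda>\<omega>. indicat_real {j} (X k \<omega>)) = p j" for j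
  proof -
    have "expectation (\<lambda>\<omega>. indicat_real {j} (X k \<omega>)) = expectation (indicat_real {\<omega> \<in> space M. X k \<omega> = j})"
      by (intro Bochner_Integration.integral_cong) (auto simp: indicator_def)
    then show ?thesis using X_prob[of k j] by simp
  qed
  have int: "integrable M (\<lambda>\<omega>. indicator {j} (X k \<omega>) :: real)" for j
    by (rule integrable_const_bound[of _ 1]) (auto intro!: measurable_compose[OF X_meas])
  have "expectation (\<lambda>\<omega>. \<Sum>j<J. (if i < idx j then 1 - z j else 0) * indicat_real {j} (X k \<omega>))
      = (\<Sum>j<J. p j * (if i < idx j then 1 - z j else 0))"
    by (subst Bochner_Integration.integral_sum) (use int in \<open>auto simp: ind intro!: sum.cong\<close>)
  then show ?thesis
    unfolding eq by (subst Bochner_Integration.integral_diff)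
      (use int in \<open>auto simp: prob_space intro!: Bochner_Integration.integrable_sum integrable_mult_right simp del: sum_mult_indicator\<close>)
qed

lemma box_count_product:
  fixes n :: "nat \<Rightarrow> nat"
  assumes n: "n 0 = 0" "\<And>i. i < m \<Longrightarrow> n i \<le> n (Suc i)" and idx: "\<And>j. j < J \<Longrightarrow> idx j \<le> m"
  shows "(\<Prod>j<J. z j ^ card {k. k < n (idx j) \<and> x k = j})
    = (\<Prod>i<m. \<Prod>k\<in>{n i..<n (Suc i)}. block_weight J idx z i (x k))"
proof -
  have "(\<Prod>i<m. \<Prod>k\<in>{n i..<n (Suc i)}. block_weight J idx z i (x k))
     = (\<Prod>i<m. \<Prod>j<J. \<Prod>k\<in>{n i..<n (Suc i)}. if x k = j \<and> i < idx j then z j else 1)"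
    unfolding block_weight_def by (intro prod.cong refl prod.swap)
  also have "\<dots> = (\<Prod>j<J. \<Prod>i<m. \<Prod>k\<in>{n i..<n (Suc i)}. if x k = j \<and> i < idx j then z j else 1)"
    by (rule prod.swap)
  also have "\<dots> = (\<Prod>j<J. z j ^ card {k. k < n (idx j) \<and> x k = j})"
  proof (rule prod.cong[OF refl])
    fix j assume j: "j \<in> {..<J}"
    have "(\<Prod>i<m. \<Prod>k\<in>{n i..<n (Suc i)}. if x k = j \<and> i < idx j then z j else 1)
       = (\<Prod>i<idx j. \<Prod>k\<in>{n i..<n (Suc i)}. if x k = j then z j else 1)"
      using idx[of j] j by (intro prod.mono_neutral_cong_right) auto
    also have "\<dots> = (\<Prod>k<n (idx j). if x k = j then z j else 1)"
      using idx[of j] j n by (intro prod_blocks) auto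
    also have "\<dots> = (\<Prod>k\<in>{k. k < n (idx j) \<and> x k = j}. z j)"
      by (intro prod.mono_neutral_cong_right) auto
    finally show "(\<Prod>i<m. \<Prod>k\<in>{n i..<n (Suc i)}. if x k = j \<and> i < idx j then z j else 1)
       = z j ^ card {k. k < n (idx j) \<and> x k = j}" by simp
  qed
  finally show ?thesis by simp
qed

lemma expectation_block_weights:
  fixes n :: "nat \<Rightarrow> nat"
  assumes n: "n 0 = 0" "\<And>i. i < m \<Longrightarrow> n i \<le> n (Suc i)"
    and z: "\<And>j. j < J \<Longrightarrow> 0 \<le> z j" "\<And>j. j < J \<Longrightarrow> z j \<le> 1"
  shows "expectation (\<lambda>\<omega>. \<Prod>i<m. \<Prod>k\<in>{n i..<n (Suc i)}. block_weight J idx z i (X k \<omega>))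
    = (\<Prod>i<m. (1 - (\<Sum>j<J. p j * (if i < idx j then 1 - z j else 0))) ^ (n (Suc i) - n i))"
proof -
  \<comment> \<open>The unit interval in which ball \<open>k\<close> arrives.\<close>
  define blk where "blk k = (LEAST i. k < n (Suc i))" for k
  have mono: "n i \<le> n l" if "i \<le> l" "l \<le> m" for i l
    using that by (induction l) (auto simp: le_Suc_eq intro: order_trans[OF _ n(2)])
  have blk: "blk k = i" if "i < m" "k \<in> {n i..<n (Suc i)}" for i k
    unfolding blk_def
  proof (rule Least_equality)
    show "k < n (Suc i)" using that by simp
    fix y assume "k < n (Suc y)"
    then show "i \<le> y"
      using mono[of "Suc y" i] that by (meson atLeastLessThan_iff leD leI less_imp_le_nat not_less_eq_eq order_trans)
  qed
  let ?w = "\<lambda>i. 1 - (\<Sum>j<J. p j * (if i < idx j then 1 - z j else 0))"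
  have "indep_vars (\<lambda>_. count_space UNIV) X {..<n m}"
    by (rule indep_vars_subset[OF X_indep]) auto
  then have ind: "indep_vars (\<lambda>_. borel) (\<lambda>k \<omega>. block_weight J idx z (blk k) (X k \<omega>)) {..<n m}"
    by (rule indep_vars_compose2) auto
  have "expectation (\<lambda>\<omega>. \<Prod>i<m. \<Prod>k\<in>{n i..<n (Suc i)}. block_weight J idx z i (X k \<omega>))
    = expectation (\<lambda>\<omega>. \<Prod>i<m. \<Prod>k\<in>{n i..<n (Suc i)}. block_weight J idx z (blk k) (X k \<omega>))"
    by (intro Bochner_Integration.integral_cong prod.cong refl) (simp add: blk)
  also have "\<dots> = expectation (\<lambda>\<omega>. \<Prod>k<n m. block_weight J idx z (blk k) (X k \<omega>))"
    by (subst prod_blocks[OF n]) auto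
  also have "\<dots> = (\<Prod>k<n m. expectation (\<lambda>\<omega>. block_weight J idx z (blk k) (X k \<omega>)))"
    using block_weight_bounds[OF z]
    by (intro indep_vars_lebesgue_integral ind) (auto intro!: integrable_const_bound[of _ 1] AE_I2)
  also have "\<dots> = (\<Prod>k<n m. ?w (blk k))"
    by (simp add: expectation_block_weight)
  also have "\<dots> = (\<Prod>i<m. \<Prod>k\<in>{n i..<n (Suc i)}. ?w (blk k))"
    by (rule prod_blocks[OF n, symmetric]) auto
  also have "\<dots> = (\<Prod>i<m. \<Prod>k\<in>{n i..<n (Suc i)}. ?w i)"
    by (intro prod.cong refl) (simp add: blk)
  finally show ?thesis by simp
qed

text \<open>Thinning, at natural times. Given the numbers of arrivals in the unit intervals, the balls are independent and
  every ball of the interval from \<open>i\<close> to \<open>i + 1\<close> contributes the same mean factor; averaging over the Poisson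
  increments turns the powers of these factors into exponentials that split over the boxes.\<close>

lemma box_counts_pgf:
  fixes s :: "nat \<Rightarrow> nat"
  assumes z: "\<And>j. j < J \<Longrightarrow> 0 \<le> z j" "\<And>j. j < J \<Longrightarrow> z j \<le> 1"
  shows "expectation (\<lambda>\<omega>. \<Prod>j<J. z j ^ box_count P X j (real (s j)) \<omega>)
    = (\<Prod>j<J. exp (- (p j * real (s j) * (1 - z j))))"
proof -
  define m where "m = (\<Sum>j<J. s j)"
  have s: "s j \<le> m" if "j < J" for j
    unfolding m_def using that by (intro member_le_sum) auto
  define h where "h = (\<lambda>(\<pi> :: nat \<Rightarrow> nat, x :: nat \<Rightarrow> nat).
    \<Prod>i<m. \<Prod>k\<in>{\<pi> i..<\<pi> (Suc i)}. block_weight J s z i (x k))"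
  let ?S = "PiM UNIV (\<lambda>_. count_space UNIV) \<Otimes>\<^sub>M PiM UNIV (\<lambda>_. count_space UNIV) :: ((nat \<Rightarrow> nat) \<times> (nat \<Rightarrow> nat)) measure"
  let ?w = "\<lambda>i. 1 - (\<Sum>j<J. p j * (if i < s j then 1 - z j else 0))"
  have w: "0 \<le> ?w i" "?w i \<le> 1" for i
  proof -
    have "integrable M (\<lambda>\<omega>. block_weight J s z i (X 0 \<omega>))"
      using block_weight_bounds[OF z] by (intro integrable_const_bound[of _ 1]) auto
    then show "0 \<le> ?w i" "?w i \<le> 1"
      unfolding expectation_block_weight[of J s z i 0, symmetric]
      using block_weight_bounds[OF z] by (auto intro!: integral_nonneg_AE integral_le_const AE_I2)
  qed
  have h_meas: "h \<in> borel_measurable ?S"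
    unfolding h_def split_beta
  proof (rule borel_measurable_prod)
    fix i
    have P: "(\<lambda>y. fst y l) \<in> ?S \<rightarrow>\<^sub>M count_space UNIV" for l
      by (intro measurable_compose[OF measurable_fst] measurable_component_singleton) auto
    have X: "(\<lambda>y. block_weight J s z i (snd y k)) \<in> borel_measurable ?S" for k
      by (rule measurable_compose[OF measurable_snd], rule measurable_compose[OF measurable_component_singleton[of k]]) auto
    have "(\<lambda>y. \<Prod>k\<in>{a..<b}. block_weight J s z i (snd y k)) \<in> borel_measurable ?S" for a b
      using X by (intro borel_measurable_prod) auto
    from measurable_compose_countable[OF this P[of i]]
    have "(\<lambda>y. \<Prod>k\<in>{fst y i..<b}. block_weight J s z i (snd y k)) \<in> borel_measurable ?S" for b .
    from measurable_compose_countable[OF this P[of "Suc i"]]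
    show "(\<lambda>y. \<Prod>k\<in>{fst y i..<fst y (Suc i)}. block_weight J s z i (snd y k)) \<in> borel_measurable ?S" .
  qed
  have h_bound: "\<bar>h y\<bar> \<le> 1" for y
    unfolding h_def split_beta using block_weight_bounds[OF z]
    by (auto simp: abs_prod intro!: prod_le_1 prod_nonneg)
  have path: "P (real 0) \<omega> = 0" "\<And>i. i < m \<Longrightarrow> P (real i) \<omega> \<le> P (real (Suc i)) \<omega>" if "\<omega> \<in> space M" for \<omega>
    using that by (auto simp: P_0 intro!: P_le)
  have "expectation (\<lambda>\<omega>. \<Prod>j<J. z j ^ box_count P X j (real (s j)) \<omega>) = expectation (\<lambda>\<omega>. h (\<lambda>i. P (real i) \<omega>, \<lambda>k. X k \<omega>))"
  proof (rule Bochner_Integration.integral_cong[OF refl])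
    fix \<omega> assume "\<omega> \<in> space M"
    from box_count_product[of "\<lambda>i. P (real i) \<omega>" m J s z "\<lambda>k. X k \<omega>", OF path[OF this] s]
    show "(\<Prod>j<J. z j ^ box_count P X j (real (s j)) \<omega>) = h (\<lambda>i. P (real i) \<omega>, \<lambda>k. X k \<omega>)"
      unfolding h_def box_count_def by simp
  qed
  also have "\<dots> = (\<integral>\<omega>. (\<integral>\<omega>'. h (\<lambda>i. P (real i) \<omega>, \<lambda>k. X k \<omega>') \<partial>M) \<partial>M)"
    by (rule indep_var_iterated_expectation[OF PX_indep h_meas h_bound])
  also have "\<dots> = (\<integral>\<omega>. (\<Prod>i<m. ?w i ^ (P (real (Suc i)) \<omega> - P (real i) \<omega>)) \<partial>M)"
    unfolding h_def split
  proof (rule Bochner_Integration.integral_cong[OF refl])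
    fix \<omega> assume "\<omega> \<in> space M"
    from expectation_block_weights[of "\<lambda>i. P (real i) \<omega>" m J z s, OF path[OF this] z]
    show "(\<integral>\<omega>'. (\<Prod>i<m. \<Prod>k\<in>{P (real i) \<omega>..<P (real (Suc i)) \<omega>}. block_weight J s z i (X k \<omega>')) \<partial>M)
      = (\<Prod>i<m. ?w i ^ (P (real (Suc i)) \<omega> - P (real i) \<omega>))" .
  qed
  also have "\<dots> = exp (- (\<Sum>i<m. (real (Suc i) - real i) * (1 - ?w i)))"
    using w by (intro poisson_process_pgf[OF P_poisson]) auto
  also have "(\<Sum>i<m. (real (Suc i) - real i) * (1 - ?w i)) = (\<Sum>j<J. \<Sum>i<m. p j * (if i < s j then 1 - z j else 0))"
    by (subst sum.swap) simp
  also have "\<dots> = (\<Sum>j<J. p j * real (s j) * (1 - z j))"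
  proof (rule sum.cong[OF refl])
    fix j assume j: "j \<in> {..<J}"
    have "(\<Sum>i<m. p j * (if i < s j then 1 - z j else 0)) = (\<Sum>i<s j. p j * (1 - z j))"
      using s[of j] j by (intro sum.mono_neutral_cong_right) auto
    then show "(\<Sum>i<m. p j * (if i < s j then 1 - z j else 0)) = p j * real (s j) * (1 - z j)"
      by simp
  qed
  finally show ?thesis by (simp add: exp_sum[symmetric] sum_negf)
qed

end

text \<open>Weierstrass approximation in one variable. The weight \<open>U\<close> holds the contributions of all other boxes, so that
  the boxes can be treated one after another.\<close>

lemma integral_eq_by_moments:
  fixes F :: "real \<Rightarrow> real"
  assumes M1: "prob_space M1" and M2: "prob_space M2"
    and U: "U \<in> borel_measurable M1" "\<And>\<omega>. \<bar>U \<omega>\<bar> \<le> 1"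
    and V1: "V1 \<in> borel_measurable M1" "\<And>\<omega>. V1 \<omega> \<in> {0..1}"
    and V2: "V2 \<in> borel_measurable M2" "\<And>\<omega>. V2 \<omega> \<in> {0..1}"
    and moments: "\<And>a::nat. (\<integral>\<omega>. U \<omega> * V1 \<omega> ^ a \<partial>M1) = c * (\<integral>\<omega>. V2 \<omega> ^ a \<partial>M2)"
    and F: "continuous_on UNIV F"
  shows "(\<integral>\<omega>. U \<omega> * F (V1 \<omega>) \<partial>M1) = c * (\<integral>\<omega>. F (V2 \<omega>) \<partial>M2)"
proof -
  interpret M1: prob_space M1 by fact
  interpret M2: prob_space M2 by fact
  note [measurable] = U(1) V1(1) V2(1)
  have int1: "integrable M1 (\<lambda>\<omega>. U \<omega> * G (V1 \<omega>))" and int2: "integrable M2 (\<lambda>\<omega>. G (V2 \<omega>))"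
    if G: "continuous_on UNIV G" for G :: "real \<Rightarrow> real"
  proof -
    obtain C where C: "\<And>x. x \<in> {0..1} \<Longrightarrow> \<bar>G x\<bar> \<le> C"
      by (rule continuous_on_compact_abs_bounded[OF compact_Icc continuous_on_subset[OF G], of 0 1]) auto
    have [measurable]: "G \<in> borel_measurable borel" using G by (rule borel_measurable_continuous_onI)
    have "\<bar>U \<omega>\<bar> * \<bar>G (V1 \<omega>)\<bar> \<le> 1 * C" for \<omega>
      using U(2)[of \<omega>] C[OF V1(2)] by (intro mult_mono) auto
    then show "integrable M1 (\<lambda>\<omega>. U \<omega> * G (V1 \<omega>))"
      by (intro M1.integrable_const_bound[of _ C]) (auto simp: abs_mult)
    show "integrable M2 (\<lambda>\<omega>. G (V2 \<omega>))"
      using C V2(2) by (intro M2.integrable_const_bound[of _ C]) auto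
  qed
  have "\<bar>(\<integral>\<omega>. U \<omega> * F (V1 \<omega>) \<partial>M1) - c * (\<integral>\<omega>. F (V2 \<omega>) \<partial>M2)\<bar> \<le> \<epsilon>" if "0 < \<epsilon>" for \<epsilon>
  proof -
    define \<delta> where "\<delta> = \<epsilon> / (1 + \<bar>c\<bar>)"
    have "(1 + y) * (\<epsilon> / (1 + y)) = \<epsilon>" if "0 \<le> y" for y
      using that by simp
    then have "\<epsilon> / (1 + y) + y * (\<epsilon> / (1 + y)) = \<epsilon>" if "0 \<le> y" for y
      using that by (simp only: distrib_right mult_1)
    then have \<delta>: "0 < \<delta>" "\<delta> + \<bar>c\<bar> * \<delta> = \<epsilon>"
      using that by (auto simp: \<delta>_def intro!: divide_pos_pos add_pos_nonneg)
    obtain g where g: "real_polynomial_function g" "\<And>x. x \<in> {0..1} \<Longrightarrow> \<bar>F x - g x\<bar> < \<delta>"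
      using Stone_Weierstrass_real_polynomial_function[of "{0..1::real}" F \<delta>] \<delta> continuous_on_subset[OF F] by auto
    then obtain b d where gb: "g = (\<lambda>x. \<Sum>k\<le>d. b k * x ^ k)"
      by (auto simp: real_polynomial_function_iff_sum)
    have gc: "continuous_on UNIV g" unfolding gb by (intro continuous_intros)
    have pc: "continuous_on UNIV (\<lambda>x::real. x ^ k)" for k by (intro continuous_intros)
    have "(\<integral>\<omega>. U \<omega> * g (V1 \<omega>) \<partial>M1) = (\<integral>\<omega>. (\<Sum>k\<le>d. b k * (U \<omega> * V1 \<omega> ^ k)) \<partial>M1)"
      unfolding gb by (simp add: sum_distrib_left mult.left_commute)
    also have "\<dots> = (\<Sum>k\<le>d. b k * (\<integral>\<omega>. U \<omega> * V1 \<omega> ^ k \<partial>M1))"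
      using int1[OF pc] by simp
    also have "\<dots> = c * (\<Sum>k\<le>d. b k * (\<integral>\<omega>. V2 \<omega> ^ k \<partial>M2))"
      by (simp only: moments sum_distrib_left mult.left_commute)
    also have "(\<Sum>k\<le>d. b k * (\<integral>\<omega>. V2 \<omega> ^ k \<partial>M2)) = (\<integral>\<omega>. g (V2 \<omega>) \<partial>M2)"
      using int2[OF pc] unfolding gb by simp
    finally have eq: "(\<integral>\<omega>. U \<omega> * g (V1 \<omega>) \<partial>M1) = c * (\<integral>\<omega>. g (V2 \<omega>) \<partial>M2)" .
    have "\<bar>(\<integral>\<omega>. U \<omega> * F (V1 \<omega>) \<partial>M1) - (\<integral>\<omega>. U \<omega> * g (V1 \<omega>) \<partial>M1)\<bar> = \<bar>\<integral>\<omega>. U \<omega> * F (V1 \<omega>) - U \<omega> * g (V1 \<omega>) \<partial>M1\<bar>"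
      using int1[OF F] int1[OF gc] by simp
    also have "\<dots> \<le> (\<integral>\<omega>. \<delta> \<partial>M1)"
    proof (intro integral_abs_bound[THEN order_trans] integral_mono)
      fix \<omega>
      have "\<bar>U \<omega>\<bar> * \<bar>F (V1 \<omega>) - g (V1 \<omega>)\<bar> \<le> 1 * \<delta>"
        using U(2)[of \<omega>] g(2)[OF V1(2)[of \<omega>]] by (intro mult_mono) auto
      then show "\<bar>U \<omega> * F (V1 \<omega>) - U \<omega> * g (V1 \<omega>)\<bar> \<le> \<delta>"
        by (simp add: right_diff_distrib[symmetric] abs_mult)
    qed (use int1[OF F] int1[OF gc] in auto)
    finally have 1: "\<bar>(\<integral>\<omega>. U \<omega> * F (V1 \<omega>) \<partial>M1) - (\<integral>\<omega>. U \<omega> * g (V1 \<omega>) \<partial>M1)\<bar> \<le> \<delta>"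
      by (simp add: M1.prob_space)
    have "\<bar>(\<integral>\<omega>. F (V2 \<omega>) \<partial>M2) - (\<integral>\<omega>. g (V2 \<omega>) \<partial>M2)\<bar> = \<bar>\<integral>\<omega>. F (V2 \<omega>) - g (V2 \<omega>) \<partial>M2\<bar>"
      using int2[OF F] int2[OF gc] by simp
    also have "\<dots> \<le> (\<integral>\<omega>. \<delta> \<partial>M2)"
      using int2[OF F] int2[OF gc] less_imp_le[OF g(2)[OF V2(2)]]
      by (intro integral_abs_bound[THEN order_trans] integral_mono) auto
    finally have "\<bar>(\<integral>\<omega>. F (V2 \<omega>) \<partial>M2) - (\<integral>\<omega>. g (V2 \<omega>) \<partial>M2)\<bar> \<le> \<delta>"
      by (simp add: M2.prob_space)
    then have "\<bar>c * (\<integral>\<omega>. F (V2 \<omega>) \<partial>M2) - c * (\<integral>\<omega>. g (V2 \<omega>) \<partial>M2)\<bar> \<le> \<bar>c\<bar> * \<delta>"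
      unfolding right_diff_distrib[symmetric] abs_mult by (intro mult_left_mono) auto
    with 1 eq \<delta>(2) show ?thesis by linarith
  qed
  then show ?thesis
    using field_le_epsilon[of "\<bar>(\<integral>\<omega>. U \<omega> * F (V1 \<omega>) \<partial>M1) - c * (\<integral>\<omega>. F (V2 \<omega>) \<partial>M2)\<bar>" 0] by simp
qed

context poissonised_occupancy
begin

lemma box_count_meas[measurable (raw)]:
  assumes "0 \<le> t"
  shows "box_count P X j t \<in> M \<rightarrow>\<^sub>M count_space UNIV"
proof -
  have "(\<lambda>\<omega>. card {k. k < n \<and> X k \<omega> = j}) \<in> M \<rightarrow>\<^sub>M count_space UNIV" for n
  proof -
    have "(\<lambda>\<omega>. \<Sum>k<n. if X k \<omega> = j then 1 else 0 :: nat) \<in> M \<rightarrow>\<^sub>M count_space UNIV"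
      by measurable
    also have "(\<lambda>\<omega>. \<Sum>k<n. if X k \<omega> = j then 1 else 0 :: nat) = (\<lambda>\<omega>. card {k. k < n \<and> X k \<omega> = j})"
      by (auto simp: sum.If_cases Int_def)
    finally show ?thesis .
  qed
  from measurable_compose_countable[OF this P_meas[OF assms]] show ?thesis
    unfolding box_count_def .
qed

text \<open>The step from generating functions to probabilities. Induction on \<open>A\<close> replaces, box by box, the power
  \<open>2 ^ (- b j * c)\<close> of the count \<open>c\<close> by the indicator of \<open>r \<le> c\<close>; the exponents of the remaining boxes stay
  arbitrary, and those of the box in turn are the moments that determine its law.\<close>

lemma box_counts_tail:
  fixes s :: "nat \<Rightarrow> nat"
  assumes s: "\<And>j. j < J \<Longrightarrow> 0 < s j" and r: "1 \<le> r"
  shows "A \<subseteq> {..<J} \<Longrightarrow> expectation (\<lambda>\<omega>. \<Prod>j<J. if j \<in> A then of_bool (r \<le> box_count P X j (real (s j)) \<omega>)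
      else (1/2) ^ (b j * box_count P X j (real (s j)) \<omega>))
    = (\<Prod>j<J. if j \<in> A then measure_pmf.prob (poisson_pmf (p j * real (s j))) {r..}
      else exp (- (p j * real (s j) * (1 - (1/2) ^ b j))))"
proof (induction A arbitrary: b rule: infinite_finite_induct)
  case (infinite A)
  then show ?case using finite_subset by blast
next
  case empty
  show ?case
    using box_counts_pgf[of J "\<lambda>j. (1/2) ^ b j" s] by (auto simp: power_mult power_le_one less_imp_le)
next
  case (insert i A)
  define C where "C j = box_count P X j (real (s j))" for j
  define \<tau> where "\<tau> j = measure_pmf.prob (poisson_pmf (p j * real (s j))) {r..}" for j
  define e where "e j = exp (- (p j * real (s j) * (1 - (1/2) ^ b j)))" for j
  have C_meas[measurable]: "C j \<in> M \<rightarrow>\<^sub>M count_space UNIV" if "j < J" for j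
    unfolding C_def by (intro box_count_meas) auto
  have i: "i < J" "i \<notin> A" "A \<subseteq> {..<J}" using insert by auto
  define u where "u j \<omega> = (if j \<in> A then of_bool (r \<le> C j \<omega>) else (1/2) ^ (b j * C j \<omega>) :: real)" for j \<omega>
  define U where "U \<omega> = (\<Prod>j\<in>{..<J} - {i}. u j \<omega>)" for \<omega>
  define c where "c = (\<Prod>j\<in>{..<J} - {i}. if j \<in> A then \<tau> j else e j)"
  have u: "u j \<in> borel_measurable M" if "j < J" for j
    unfolding u_def using measurable_compose[OF C_meas[OF that],
      of "\<lambda>n. if j \<in> A then of_bool (r \<le> n) else (1/2) ^ (b j * n)" borel] by simp
  have u01: "0 \<le> u j \<omega>" "u j \<omega> \<le> 1" for j \<omega>
    by (auto simp: u_def power_le_one)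
  have U: "U \<in> borel_measurable M" "\<And>\<omega>. \<bar>U \<omega>\<bar> \<le> 1"
    unfolding U_def using u u01 by (auto simp: abs_prod intro!: borel_measurable_prod prod_le_1)
  have split: "(\<Prod>j<J. f j) = f i * (\<Prod>j\<in>{..<J} - {i}. f j)" for f :: "nat \<Rightarrow> real"
    using i by (intro prod.remove) auto
  \<comment> \<open>This clamped affine function of \<open>2\<^sup>-\<^sup>n\<close> is the indicator of \<open>r \<le> n\<close>.\<close>
  define F where "F v = max 0 (min 1 (((1/2) ^ (r - 1) - v) * 2 ^ r))" for v :: real
  have F: "F ((1/2) ^ n) = of_bool (r \<le> n)" for n
  proof (cases "r \<le> n")
    case True
    then have "(1/2 :: real) ^ n \<le> (1/2) ^ r" by (intro power_decreasing) auto
    moreover have "(1/2 :: real) ^ (r - 1) = 2 * (1/2) ^ r" using r by (cases r) auto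
    ultimately have "(1/2) ^ r * 2 ^ r \<le> ((1/2) ^ (r - 1) - (1/2) ^ n) * (2 :: real) ^ r"
      by (intro mult_right_mono) auto
    then show ?thesis using True by (simp add: F_def power_mult_distrib[symmetric])
  next
    case False
    then have "(1/2 :: real) ^ (r - 1) \<le> (1/2) ^ n" by (intro power_decreasing) auto
    then have "((1/2) ^ (r - 1) - (1/2) ^ n) * (2 :: real) ^ r \<le> 0" by (intro mult_nonpos_nonneg) auto
    then show ?thesis using False by (simp add: F_def)
  qed
  have "(\<integral>\<omega>. U \<omega> * F ((1/2) ^ C i \<omega>) \<partial>M) = c * (\<integral>n. F ((1/2) ^ n) \<partial>measure_pmf (poisson_pmf (p i * real (s i))))"
  proof (rule integral_eq_by_moments[where F = F and ?V2.0 = "\<lambda>n. (1/2) ^ n", OF prob_space_axioms _ U])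
    show "prob_space (measure_pmf (poisson_pmf (p i * real (s i))))"
      by (rule prob_space_measure_pmf)
    show "(\<lambda>\<omega>. (1/2) ^ C i \<omega>) \<in> borel_measurable M"
      using C_meas[OF i(1)] by measurable
    show "continuous_on UNIV F" unfolding F_def by (intro continuous_intros)
    fix a :: nat
    have "(\<integral>\<omega>. U \<omega> * ((1/2) ^ C i \<omega>) ^ a \<partial>M)
      = expectation (\<lambda>\<omega>. \<Prod>j<J. if j \<in> A then of_bool (r \<le> C j \<omega>) else (1/2) ^ ((b(i := a)) j * C j \<omega>))"
    proof (rule Bochner_Integration.integral_cong[OF refl])
      fix \<omega>
      have "(\<Prod>j\<in>{..<J} - {i}. if j \<in> A then of_bool (r \<le> C j \<omega>) else (1/2) ^ ((b(i := a)) j * C j \<omega>)) = U \<omega>"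
        unfolding U_def u_def by (rule prod.cong) simp_all
      then show "U \<omega> * ((1/2) ^ C i \<omega>) ^ a
        = (\<Prod>j<J. if j \<in> A then of_bool (r \<le> C j \<omega>) else (1/2) ^ ((b(i := a)) j * C j \<omega>))"
        unfolding split using i by (simp add: power_mult[symmetric] mult.commute)
    qed
    also have "\<dots> = (\<Prod>j<J. if j \<in> A then \<tau> j else exp (- (p j * real (s j) * (1 - (1/2) ^ (b(i := a)) j))))"
      unfolding C_def \<tau>_def by (rule insert.IH[OF i(3)])
    also have "\<dots> = exp (- (p i * real (s i) * (1 - (1/2) ^ a))) * c"
    proof -
      have "(\<Prod>j\<in>{..<J} - {i}. if j \<in> A then \<tau> j else exp (- (p j * real (s j) * (1 - (1/2) ^ (b(i := a)) j)))) = c"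
        unfolding c_def e_def by (rule prod.cong) simp_all
      then show ?thesis unfolding split using i by simp
    qed
    also have "exp (- (p i * real (s i) * (1 - (1/2) ^ a))) = (\<integral>n. ((1/2) ^ a) ^ n \<partial>measure_pmf (poisson_pmf (p i * real (s i))))"
      using p_pos[of i] s[OF i(1)] by (subst poisson_pgf) (auto simp: power_le_one)
    finally show "(\<integral>\<omega>. U \<omega> * ((1/2) ^ C i \<omega>) ^ a \<partial>M) = c * (\<integral>n. ((1/2) ^ n) ^ a \<partial>measure_pmf (poisson_pmf (p i * real (s i))))"
      by (simp add: power_mult[symmetric] mult.commute)
  qed (auto simp: power_le_one)
  also have "(\<integral>n. F ((1/2) ^ n) \<partial>measure_pmf (poisson_pmf (p i * real (s i)))) = \<tau> i"
  proof -
    have "(\<lambda>n. F ((1/2) ^ n)) = indicator {r..}" by (auto simp: F indicator_def)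
    then show ?thesis by (simp add: \<tau>_def)
  qed
  finally have main: "(\<integral>\<omega>. U \<omega> * of_bool (r \<le> C i \<omega>) \<partial>M) = c * \<tau> i" by (simp add: F)
  have "expectation (\<lambda>\<omega>. \<Prod>j<J. if j \<in> insert i A then of_bool (r \<le> C j \<omega>) else (1/2) ^ (b j * C j \<omega>))
    = (\<integral>\<omega>. U \<omega> * of_bool (r \<le> C i \<omega>) \<partial>M)"
    unfolding split by (intro Bochner_Integration.integral_cong refl) (auto simp: U_def u_def mult.commute intro!: prod.cong)
  also have "\<dots> = (\<Prod>j<J. if j \<in> insert i A then \<tau> j else e j)"
    unfolding main split c_def by (auto simp: mult.commute intro!: prod.cong)
  finally show ?case unfolding C_def \<tau>_def e_def .
qed

end

section \<open>Elementary facts on Poisson weights\<close>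

abbreviation poisson_weight :: "nat \<Rightarrow> real \<Rightarrow> real" where
  "poisson_weight n x \<equiv> x ^ n / fact n * exp (- x)"

abbreviation rceil :: "real \<Rightarrow> real" where
  "rceil x \<equiv> real_of_int \<lceil>x\<rceil>"

lemma rceil_le_iff: "rceil x \<le> y \<longleftrightarrow> x \<le> real_of_int \<lfloor>y\<rfloor>"
  by (simp add: le_floor_iff[symmetric] ceiling_le_iff[symmetric])

lemma poisson_mean:
  assumes "0 < c"
  shows "integrable (measure_pmf (poisson_pmf c)) real" "(\<integral>n. real n \<partial>measure_pmf (poisson_pmf c)) = c"
proof -
  have "(\<lambda>n. poisson_weight (Suc n) c * real (Suc n)) = (\<lambda>n. c * exp (- c) * (c ^ n / fact n))"
    by (simp add: fact_Suc mult_ac del: of_nat_Suc)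
  moreover have "(\<lambda>n. c * exp (- c) * (c ^ n / fact n)) sums (c * exp (- c) * exp c)"
    by (intro sums_mult) (use exp_converges[of c] in \<open>simp add: divide_inverse mult.commute\<close>)
  moreover have "c * exp (- c) * exp c = c" by (simp add: exp_minus)
  ultimately have "(\<lambda>n. poisson_weight (Suc n) c * real (Suc n)) sums c"
    by (simp only:)
  then have s: "(\<lambda>n. pmf (poisson_pmf c) n * real n) sums c"
    using assms sums_Suc_iff[of "\<lambda>n. pmf (poisson_pmf c) n * real n" c] by simp
  have i: "integrable (count_space UNIV) (\<lambda>n. pmf (poisson_pmf c) n * real n)"
    using s by (subst integrable_count_space_nat_iff) (simp add: abs_mult sums_iff)
  then have "(\<integral>n. pmf (poisson_pmf c) n * real n \<partial>count_space UNIV) = c"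
    using s by (subst integral_count_space_nat) (auto simp: sums_iff)
  then show "(\<integral>n. real n \<partial>measure_pmf (poisson_pmf c)) = c"
    by (simp add: measure_pmf_eq_density integral_density)
  show "integrable (measure_pmf (poisson_pmf c)) real"
    using i by (simp add: measure_pmf_eq_density integrable_density)
qed

lemma poisson_tail:
  assumes "0 < c"
  shows "measure_pmf.prob (poisson_pmf c) {r..} = 1 - (\<Sum>n<r. poisson_weight n c)"
proof -
  have "measure_pmf.prob (poisson_pmf c) {r..} = 1 - measure_pmf.prob (poisson_pmf c) {..<r}"
    using measure_pmf.prob_compl[of "{..<r}" "poisson_pmf c"] by (simp add: Compl_eq_Diff_UNIV[symmetric])
  also have "measure_pmf.prob (poisson_pmf c) {..<r} = (\<Sum>n<r. poisson_weight n c)"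
    using assms by (subst measure_measure_pmf_finite) auto
  finally show ?thesis .
qed

lemma poisson_two_or_more:
  assumes "0 < c"
  shows "measure_pmf.prob (poisson_pmf c) {2..} \<le> c\<^sup>2"
proof -
  have "measure_pmf.prob (poisson_pmf c) {2..} = 1 - exp (- c) * (1 + c)"
    unfolding poisson_tail[OF assms] by (simp add: numeral_2_eq_2 algebra_simps)
  moreover have "(1 - c) * (1 + c) \<le> exp (- c) * (1 + c)"
    using exp_ge_add_one_self[of "- c"] assms by (intro mult_right_mono) auto
  ultimately show ?thesis by (simp add: algebra_simps power2_eq_square)
qed

lemma poisson_weight_le_1: "0 \<le> x \<Longrightarrow> x ^ n / fact n * exp (- x) \<le> (1::real)"
proof (cases "x = 0")
  case False
  assume "0 \<le> x"
  then have "pmf (poisson_pmf x) n = poisson_weight n x" using False by simp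
  then show ?thesis using pmf_le_1[of "poisson_pmf x" n] by simp
qed (cases n; simp)

lemma poisson_weight_Lipschitz:
  assumes "0 \<le> x" "0 \<le> y"
  shows "\<bar>poisson_weight (Suc n) x - poisson_weight (Suc n) y\<bar> \<le> \<bar>x - y :: real\<bar>"
proof -
  have "norm (poisson_weight (Suc n) x - poisson_weight (Suc n) y) \<le> 1 * norm (x - y)"
  proof (rule field_differentiable_bound[where S = "{0..}" and f = "\<lambda>z. poisson_weight (Suc n) z"
        and f' = "\<lambda>z. poisson_weight n z - poisson_weight (Suc n) z"])
    fix z :: real assume "z \<in> {0..}"
    then have "0 \<le> z" by simp
    have "real (Suc n) * z ^ n / fact (Suc n) = z ^ n / fact n"
      by (simp add: fact_Suc del: of_nat_Suc)
    moreover have "((\<lambda>z. poisson_weight (Suc n) z) has_field_derivative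
        real (Suc n) * z ^ n / fact (Suc n) * exp (- z) + z ^ Suc n / fact (Suc n) * (- exp (- z))) (at z within {0..})"
    proof -
      have "((\<lambda>z. exp (- z)) has_field_derivative - exp (- z)) (at z within {0..})"
        by (auto intro!: derivative_eq_intros)
      from DERIV_mult[OF DERIV_cdivide[OF DERIV_pow[of "Suc n" z "{0..}"], of "fact (Suc n)"] this]
      show ?thesis by (simp only: mult.commute diff_Suc_1 One_nat_def[symmetric])
    qed
    ultimately show "((\<lambda>z. poisson_weight (Suc n) z) has_field_derivative
        poisson_weight n z - poisson_weight (Suc n) z) (at z within {0..})"
      by simp
    show "norm (poisson_weight n z - poisson_weight (Suc n) z) \<le> 1"
      using poisson_weight_le_1[OF \<open>0 \<le> z\<close>, of n] poisson_weight_le_1[OF \<open>0 \<le> z\<close>, of "Suc n"] \<open>0 \<le> z\<close>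
        zero_le_power[OF \<open>0 \<le> z\<close>, of n]
      unfolding real_norm_def abs_le_iff
      by (smt (verit) divide_nonneg_nonneg exp_ge_zero fact_ge_zero mult_nonneg_nonneg zero_le_power)
  qed (use assms in auto)
  then show ?thesis by simp
qed

section \<open>Record times\<close>

context poissonised_occupancy
begin

lemma P_increment_prob:
  assumes "0 \<le> s" "s < t"
  shows "prob {\<omega> \<in> space M. P t \<omega> - P s \<omega> \<in> A} = measure_pmf.prob (poisson_pmf (t - s)) A"
proof -
  have d: "distr M (count_space UNIV) (\<lambda>\<omega>. P t \<omega> - P s \<omega>) = measure_pmf (poisson_pmf (t - s))"
    using P_poisson assms unfolding poisson_process_def by simp
  have [measurable]: "P t \<in> M \<rightarrow>\<^sub>M count_space UNIV" "P s \<in> M \<rightarrow>\<^sub>M count_space UNIV"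
    using assms by (auto intro: P_meas)
  have "measure (distr M (count_space UNIV) (\<lambda>\<omega>. P t \<omega> - P s \<omega>)) A = prob {\<omega> \<in> space M. P t \<omega> - P s \<omega> \<in> A}"
    by (subst measure_distr) (auto intro!: arg_cong[where f = prob])
  then show ?thesis unfolding d by simp
qed

lemma P_prob: "0 < t \<Longrightarrow> prob {\<omega> \<in> space M. P t \<omega> \<in> A} = measure_pmf.prob (poisson_pmf t) A"
  using P_increment_prob[of 0 t A] by (simp add: P_0 cong: conj_cong)

lemma poisson_below_tendsto_0:
  assumes "0 < c"
  shows "(\<lambda>T. \<Sum>n<k. poisson_weight n (c * real T)) \<longlonglongrightarrow> 0"
proof -
  have lim: "filterlim (\<lambda>T. c * real T) at_top sequentially"
    using assms by (intro filterlim_tendsto_pos_mult_at_top[OF tendsto_const] filterlim_real_sequentially)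
  have "(\<lambda>T. (c * real T) ^ n / exp (c * real T) / fact n) \<longlonglongrightarrow> 0 / fact n" for n
    by (intro tendsto_divide filterlim_compose[OF tendsto_power_div_exp_0 lim] tendsto_const) auto
  then have "(\<lambda>T. \<Sum>n<k. (c * real T) ^ n / exp (c * real T) / fact n) \<longlonglongrightarrow> (\<Sum>n<k. 0)"
    by (intro tendsto_sum) simp
  then show ?thesis by (simp add: exp_minus divide_inverse mult_ac)
qed

text \<open>If a path reaches at least \<open>k\<close> by time \<open>T\<close> without ever taking the value \<open>k\<close>, then on the grid of mesh
  \<open>1 / n\<close> some increment is at least 2.
  There are \<open>T n\<close> increments, each of them at least 2 with probability at most \<open>1 / n\<^sup>2\<close>.\<close>

lemma AE_P_hits: "AE \<omega> in M. \<forall>k. \<exists>t\<ge>0. P t \<omega> = k"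
  unfolding AE_all_countable
proof
  fix k
  define step where "step n i = {\<omega> \<in> space M. P (real (Suc i) / real (Suc n)) \<omega> - P (real i / real (Suc n)) \<omega> \<in> {2..}}" for n i
  define low where "low T = {\<omega> \<in> space M. P (real T) \<omega> \<in> {..<k}}" for T
  define skip where "skip = {\<omega> \<in> space M. \<forall>t\<ge>0. P t \<omega> \<noteq> k}"
  define E where "E = (\<Inter>T. \<Inter>n. low T \<union> (\<Union>i<T * Suc n. step n i))"
  have [measurable]: "P (real T) \<in> M \<rightarrow>\<^sub>M count_space UNIV" "P (real i / real (Suc n)) \<in> M \<rightarrow>\<^sub>M count_space UNIV" for T i n
    by (auto intro!: P_meas)
  have sets: "step n i \<in> sets M" "low T \<in> sets M" for n i T
  proof -
    have "(\<lambda>\<omega>. P (real (Suc i) / real (Suc n)) \<omega> - P (real i / real (Suc n)) \<omega>) \<in> M \<rightarrow>\<^sub>M count_space UNIV"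
      by measurable
    from measurable_sets[OF this, of "{2..}"] show "step n i \<in> sets M"
      by (simp add: step_def vimage_def Int_def conj_commute)
    from measurable_sets[OF P_meas[of "real T"], of "{..<k}"] show "low T \<in> sets M"
      by (simp add: low_def vimage_def Int_def conj_commute)
  qed
  have E_sets: "E \<in> sets M"
    unfolding E_def using sets by (intro sets.countable_INT sets.Un sets.countable_UN) auto
  have sub: "skip \<subseteq> low T \<union> (\<Union>i<T * Suc n. step n i)" for T n
  proof
    fix \<omega> assume "\<omega> \<in> skip"
    then have \<omega>: "\<omega> \<in> space M" "\<And>t. 0 \<le> t \<Longrightarrow> P t \<omega> \<noteq> k" by (auto simp: skip_def)
    show "\<omega> \<in> low T \<union> (\<Union>i<T * Suc n. step n i)"
    proof (rule ccontr)
      assume c: "\<omega> \<notin> low T \<union> (\<Union>i<T * Suc n. step n i)"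
      have "P (real i / real (Suc n)) \<omega> < k" if "i \<le> T * Suc n" for i
        using that
      proof (induction i)
        case 0
        then show ?case using \<omega>(2)[of 0] P_0[OF \<omega>(1)] by simp
      next
        case (Suc i)
        have "\<omega> \<notin> step n i" using c Suc.prems by auto
        then have "P (real (Suc i) / real (Suc n)) \<omega> < P (real i / real (Suc n)) \<omega> + 2"
          using \<omega>(1) by (auto simp: step_def)
        moreover have "P (real (Suc i) / real (Suc n)) \<omega> \<noteq> k" by (intro \<omega>(2)) simp
        ultimately show ?case using Suc by linarith
      qed
      from this[of "T * Suc n"] have "P (real T) \<omega> < k"
        by (simp add: nonzero_mult_div_cancel_right del: of_nat_Suc mult_Suc_right)
      then show False using c \<omega>(1) by (simp add: low_def)
    qed
  qed
  have step_prob: "prob (step n i) \<le> (1 / real (Suc n))\<^sup>2" for n i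
  proof -
    have "real (Suc i) / real (Suc n) - real i / real (Suc n) = 1 / real (Suc n)"
      by (simp add: diff_divide_distrib[symmetric])
    then have "prob (step n i) = measure_pmf.prob (poisson_pmf (1 / real (Suc n))) {2..}"
      unfolding step_def by (subst P_increment_prob) (auto intro: divide_strict_right_mono)
    then show ?thesis using poisson_two_or_more[of "1 / real (Suc n)"] by simp
  qed
  have bound: "prob E \<le> prob (low T) + real T / real (Suc n)" for T n
  proof -
    have "prob E \<le> prob (low T \<union> (\<Union>i<T * Suc n. step n i))"
    proof (rule finite_measure_mono)
      show "E \<subseteq> low T \<union> (\<Union>i<T * Suc n. step n i)" unfolding E_def by blast
    qed (use sets in auto)
    also have "\<dots> \<le> prob (low T) + prob (\<Union>i<T * Suc n. step n i)"
      using sets by (intro measure_Un_le) auto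
    also have "prob (\<Union>i<T * Suc n. step n i) \<le> (\<Sum>i<T * Suc n. prob (step n i))"
      using sets by (intro finite_measure_subadditive_finite) auto
    also have "\<dots> \<le> (\<Sum>i<T * Suc n. (1 / real (Suc n))\<^sup>2)"
      by (intro sum_mono step_prob)
    also have "\<dots> = real T / real (Suc n)"
      by (simp add: power2_eq_square del: of_nat_Suc mult_Suc_right)
    finally show ?thesis by simp
  qed
  have E_low: "prob E \<le> prob (low T)" for T
  proof (rule LIMSEQ_le_const)
    have "(\<lambda>n. real T * inverse (real (Suc n))) \<longlonglongrightarrow> real T * 0"
      by (intro tendsto_mult_left LIMSEQ_inverse_real_of_nat)
    then show "(\<lambda>n. prob (low T) + real T / real (Suc n)) \<longlonglongrightarrow> prob (low T)"
      using tendsto_add[OF tendsto_const, of _ 0 sequentially "prob (low T)"] by (simp add: divide_inverse)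
  qed (use bound in auto)
  have "prob E \<le> 0"
  proof (rule LIMSEQ_le_const)
    show "(\<lambda>T. \<Sum>n<k. poisson_weight n (1 * real T)) \<longlonglongrightarrow> 0"
      by (rule poisson_below_tendsto_0) simp
    have "prob E \<le> (\<Sum>n<k. poisson_weight n (1 * real T))" if "1 \<le> T" for T
    proof -
      have "prob (low T) = (\<Sum>n<k. poisson_weight n (1 * real T))"
        unfolding low_def using that by (subst P_prob) (auto simp: measure_measure_pmf_finite)
      then show ?thesis using E_low[of T] by simp
    qed
    then show "\<exists>N. \<forall>n\<ge>N. prob E \<le> (\<Sum>i<k. poisson_weight i (1 * real n))" by blast
  qed
  then have "E \<in> null_sets M"
    using E_sets by (auto simp: null_sets_def emeasure_eq_measure measure_le_0_iff)
  moreover have "{\<omega> \<in> space M. \<not> (\<exists>t\<ge>0. P t \<omega> = k)} \<subseteq> E"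
    using sub unfolding E_def skip_def by blast
  ultimately show "AE \<omega> in M. \<exists>t\<ge>0. P t \<omega> = k"
    by (rule AE_I')
qed

lemma box_count_mono: "\<omega> \<in> space M \<Longrightarrow> mono_on {0..} (\<lambda>t. box_count P X j t \<omega>)"
  unfolding box_count_def
  by (intro mono_onI card_mono) (auto dest: P_le)

lemma box_count_rc:
  assumes "\<omega> \<in> space M" "0 \<le> t"
  shows "continuous (at_right t) (\<lambda>t. box_count P X j t \<omega>)"
proof -
  have "\<forall>\<^sub>F u in at_right t. P u \<omega> = P t \<omega>"
    using P_rc[OF assms] by (simp add: continuous_within tendsto_discrete)
  then have "\<forall>\<^sub>F u in at_right t. box_count P X j u \<omega> = box_count P X j t \<omega>"
    by eventually_elim (simp add: box_count_def)
  then show ?thesis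
    by (simp add: continuous_within tendsto_discrete)
qed

lemma box_count_pos_imp:
  assumes "1 \<le> box_count P X j t \<omega>"
  shows "j \<in> (\<lambda>k. X k \<omega>) ` {..<P t \<omega>}"
proof -
  have "{k. k < P t \<omega> \<and> X k \<omega> = j} \<noteq> {}"
    using assms unfolding box_count_def by (metis card.empty not_one_le_zero)
  then show ?thesis by auto
qed

lemma box_count_0: "\<omega> \<in> space M \<Longrightarrow> box_count P X j 0 \<omega> = 0"
  by (simp add: box_count_def P_0)

text \<open>The record time is the infimum of the times at which the content equals \<open>r\<close>. When there are such times, it
  is also the first time at which the content is at least \<open>r\<close>.\<close>

lemma record_time_finite:
  assumes \<omega>: "\<omega> \<in> space M" and fin: "record_time P X j r \<omega> < \<infinity>"
  obtains b where "0 \<le> b" "record_time P X j r \<omega> = ereal b" "box_count P X j b \<omega> = r"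
proof -
  let ?S = "{t. 0 \<le> t \<and> r \<le> box_count P X j t \<omega>}"
  define b where "b = Inf ?S"
  have "{ereal t | t. 0 \<le> t \<and> box_count P X j t \<omega> = r} \<noteq> {}"
  proof
    assume "{ereal t | t. 0 \<le> t \<and> box_count P X j t \<omega> = r} = {}"
    then have "record_time P X j r \<omega> = Inf {}" unfolding record_time_def by (rule arg_cong)
    then show False using fin by (simp add: top_ereal_def)
  qed
  then obtain t where t: "0 \<le> t" "box_count P X j t \<omega> = r" by auto
  note inf = counting_function_Inf[OF box_count_mono[OF \<omega>] box_count_rc[OF \<omega>] t(1), of r j, folded b_def]
  have lower: "b \<le> u" if "0 \<le> u" "box_count P X j u \<omega> = r" for u
    unfolding b_def by (rule cInf_lower) (use that in \<open>auto intro: bdd_belowI[of _ 0]\<close>)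
  have b: "0 \<le> b" "r \<le> box_count P X j b \<omega>" using inf t by auto
  moreover have "box_count P X j b \<omega> \<le> r"
    using monotone_onD[OF box_count_mono[OF \<omega>], of b t j] lower[OF t] b t by simp
  ultimately have eq: "box_count P X j b \<omega> = r" by simp
  have "record_time P X j r \<omega> = ereal b"
    unfolding record_time_def
  proof (rule antisym)
    show "Inf {ereal t | t. 0 \<le> t \<and> box_count P X j t \<omega> = r} \<le> ereal b"
      using b eq by (intro Inf_lower) auto
    show "ereal b \<le> Inf {ereal t | t. 0 \<le> t \<and> box_count P X j t \<omega> = r}"
      by (rule Inf_greatest) (use lower in auto)
  qed
  then show ?thesis using that b eq by blast
qed

lemma record_time_meas[measurable]: "record_time P X j r \<in> borel_measurable M"
proof (rule borel_measurableI_less)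
  fix y :: ereal
  have "{\<omega> \<in> space M. record_time P X j r \<omega> < y}
    = (\<Union>q\<in>{q \<in> \<rat>. 0 \<le> q \<and> ereal q < y}. {\<omega> \<in> space M. box_count P X j q \<omega> = r})"
  proof (intro set_eqI iffI)
    fix \<omega> assume "\<omega> \<in> {\<omega> \<in> space M. record_time P X j r \<omega> < y}"
    then have \<omega>: "\<omega> \<in> space M" "record_time P X j r \<omega> < y" by auto
    then have "record_time P X j r \<omega> < \<infinity>" by (metis ereal_infty_less(1) less_trans neq_iff not_less_iff_gr_or_eq)
    then obtain b where b: "0 \<le> b" "record_time P X j r \<omega> = ereal b" "box_count P X j b \<omega> = r"
      using record_time_finite[OF \<omega>(1)] by blast
    have "\<forall>\<^sub>F u in at_right b. box_count P X j u \<omega> = r"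
      using box_count_rc[OF \<omega>(1) b(1), of j] b(3) by (simp add: continuous_within tendsto_discrete)
    then obtain c where c: "b < c" "\<And>u. b < u \<Longrightarrow> u < c \<Longrightarrow> box_count P X j u \<omega> = r"
      unfolding eventually_at_right_field by blast
    obtain d where d: "b < d" "ereal d \<le> y"
    proof (cases y)
      case (real d)
      then show ?thesis using that[of d] \<omega>(2) b(2) by simp
    next
      case PInf
      then show ?thesis using that[of "b + 1"] by simp
    qed (use \<omega>(2) in auto)
    obtain q where q: "q \<in> \<rat>" "b < q" "q < min c d"
      using Rats_dense_in_real[of b "min c d"] c d by auto
    have "ereal q < y" using q d by (metis less_ereal.simps(1) less_le_trans min_less_iff_conj)
    then show "\<omega> \<in> (\<Union>q\<in>{q \<in> \<rat>. 0 \<le> q \<and> ereal q < y}. {\<omega> \<in> space M. box_count P X j q \<omega> = r})"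
      using q c(2)[of q] b(1) \<omega>(1) by auto
  next
    fix \<omega> assume "\<omega> \<in> (\<Union>q\<in>{q \<in> \<rat>. 0 \<le> q \<and> ereal q < y}. {\<omega> \<in> space M. box_count P X j q \<omega> = r})"
    then obtain q where q: "0 \<le> q" "ereal q < y" "\<omega> \<in> space M" "box_count P X j q \<omega> = r" by auto
    have "record_time P X j r \<omega> \<le> ereal q"
      unfolding record_time_def using q by (intro Inf_lower) auto
    then show "\<omega> \<in> {\<omega> \<in> space M. record_time P X j r \<omega> < y}" using q by auto
  qed
  also have "\<dots> \<in> sets M"
  proof (rule sets.countable_UN'')
    show "countable {q \<in> \<rat>. 0 \<le> q \<and> ereal q < y}"
      by (rule countable_subset[OF _ countable_rat]) auto
    fix q assume "q \<in> {q \<in> \<rat>. 0 \<le> q \<and> ereal q < y}"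
    then have [measurable]: "box_count P X j q \<in> M \<rightarrow>\<^sub>M count_space UNIV" by (auto intro: box_count_meas)
    show "{\<omega> \<in> space M. box_count P X j q \<omega> = r} \<in> sets M" by measurable
  qed
  finally show "{\<omega> \<in> space M. record_time P X j r \<omega> < y} \<in> sets M" .
qed

text \<open>A box whose record time is infinite is given the value \<open>0\<close>, which lies outside every window
  \<open>(t\<^sub>0, \<infinity>)\<close> with \<open>t\<^sub>0 \<ge> 0\<close>.\<close>

definition rec :: "nat \<Rightarrow> nat \<Rightarrow> 'a \<Rightarrow> real" where
  "rec r j \<omega> = real_of_ereal (record_time P X j r \<omega>)"

lemma rec_meas[measurable]: "rec r j \<in> borel_measurable M"
  unfolding rec_def by measurable

lemma rec_pos_finite: "0 < rec r j \<omega> \<Longrightarrow> record_time P X j r \<omega> < \<infinity>"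
  by (cases "record_time P X j r \<omega>") (auto simp: rec_def)

lemma rec_le_iff:
  assumes \<omega>: "\<omega> \<in> space M" and fin: "record_time P X j r \<omega> < \<infinity>" and t: "0 \<le> t"
  shows "rec r j \<omega> \<le> t \<longleftrightarrow> r \<le> box_count P X j t \<omega>"
proof -
  obtain b where b: "0 \<le> b" "record_time P X j r \<omega> = ereal b" "box_count P X j b \<omega> = r"
    using record_time_finite[OF \<omega> fin] by blast
  have rec: "rec r j \<omega> = b" using b by (simp add: rec_def)
  show ?thesis
  proof
    assume "rec r j \<omega> \<le> t"
    then show "r \<le> box_count P X j t \<omega>"
      using monotone_onD[OF box_count_mono[OF \<omega>], of b t j] b t rec by simp
  next
    assume le: "r \<le> box_count P X j t \<omega>"
    show "rec r j \<omega> \<le> t"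
    proof (rule ccontr)
      assume "\<not> rec r j \<omega> \<le> t"
      then have "t < b" using rec by simp
      then have "box_count P X j t \<omega> \<le> r"
        using monotone_onD[OF box_count_mono[OF \<omega>], of t b j] b t by simp
      then have "box_count P X j t \<omega> = r" using le by simp
      then have "record_time P X j r \<omega> \<le> ereal t"
        unfolding record_time_def using t by (intro Inf_lower) auto
      then show False using b \<open>t < b\<close> by simp
    qed
  qed
qed

lemma finite_records:
  assumes \<omega>: "\<omega> \<in> space M" and r: "1 \<le> r" and t: "0 \<le> t0"
  shows "finite {j. t0 < rec r j \<omega> \<and> rec r j \<omega> \<le> t}"
proof (rule finite_subset)
  show "{j. t0 < rec r j \<omega> \<and> rec r j \<omega> \<le> t} \<subseteq> (\<lambda>k. X k \<omega>) ` {..<P t \<omega>}"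
  proof
    fix j assume "j \<in> {j. t0 < rec r j \<omega> \<and> rec r j \<omega> \<le> t}"
    then have j: "t0 < rec r j \<omega>" "rec r j \<omega> \<le> t" by auto
    then have "r \<le> box_count P X j t \<omega>"
      using rec_le_iff[OF \<omega> rec_pos_finite, of r j t] t by simp
    then show "j \<in> (\<lambda>k. X k \<omega>) ` {..<P t \<omega>}"
      using r by (intro box_count_pos_imp) simp
  qed
qed simp

lemma box_tail:
  assumes "0 < n" "1 \<le> r"
  shows "prob {\<omega> \<in> space M. r \<le> box_count P X j (real n) \<omega>} = measure_pmf.prob (poisson_pmf (p j * real n)) {r..}"
proof -
  have [measurable]: "box_count P X j (real n) \<in> M \<rightarrow>\<^sub>M count_space UNIV" by (rule box_count_meas) simp
  have "expectation (\<lambda>\<omega>. \<Prod>i<Suc j. if i \<in> {j} then of_bool (r \<le> box_count P X i (real n) \<omega>) else (1/2) ^ (0 * box_count P X i (real n) \<omega>))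
    = (\<Prod>i<Suc j. if i \<in> {j} then measure_pmf.prob (poisson_pmf (p i * real n)) {r..} else exp (- (p i * real n * (1 - (1/2) ^ 0))))"
    using assms by (intro box_counts_tail[where s = "\<lambda>_. n" and b = "\<lambda>_. 0"]) auto
  also have "\<dots> = measure_pmf.prob (poisson_pmf (p j * real n)) {r..}"
    by (simp add: lessThan_Suc)
  also have "(\<lambda>\<omega>. \<Prod>i<Suc j. if i \<in> {j} then of_bool (r \<le> box_count P X i (real n) \<omega>) else (1/2 :: real) ^ (0 * box_count P X i (real n) \<omega>))
    = indicator {\<omega>. r \<le> box_count P X j (real n) \<omega>}"
    by (auto simp: lessThan_Suc indicator_def)
  also have "expectation (indicator {\<omega>. r \<le> box_count P X j (real n) \<omega>}) = prob {\<omega> \<in> space M. r \<le> box_count P X j (real n) \<omega>}"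
    by (simp add: Int_def conj_commute)
  finally show ?thesis .
qed

text \<open>Almost surely the content of the box exceeds every bound. It grows by single units because the ball count
  takes every value, so it attains \<open>r\<close>.\<close>

lemma AE_record_times_finite:
  assumes r: "1 \<le> r"
  shows "AE \<omega> in M. \<forall>j. record_time P X j r \<omega> < \<infinity>"
  unfolding AE_all_countable
proof
  fix j
  define E where "E n = {\<omega> \<in> space M. box_count P X j (real n) \<omega> < r}" for n
  have E_sets: "E n \<in> sets M" for n
  proof -
    have [measurable]: "box_count P X j (real n) \<in> M \<rightarrow>\<^sub>M count_space UNIV" by (rule box_count_meas) simp
    show ?thesis unfolding E_def by measurable
  qed
  have E_prob: "prob (E n) = (\<Sum>i<r. poisson_weight i (p j * real n))" if "0 < n" for n
  proof -
    have "E n = space M - {\<omega> \<in> space M. r \<le> box_count P X j (real n) \<omega>}"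
      by (auto simp: E_def)
    moreover have "{\<omega> \<in> space M. r \<le> box_count P X j (real n) \<omega>} = space M - E n" by (auto simp: E_def)
    ultimately have "prob (E n) = 1 - prob {\<omega> \<in> space M. r \<le> box_count P X j (real n) \<omega>}"
      using prob_compl[OF E_sets[of n]] by simp
    then show ?thesis
      using that p_pos[of j] r by (simp add: box_tail poisson_tail)
  qed
  have "prob (\<Inter>n. E n) \<le> 0"
  proof (rule LIMSEQ_le_const[OF poisson_below_tendsto_0[OF p_pos[of j], of r]])
    have "prob (\<Inter>n. E n) \<le> (\<Sum>i<r. poisson_weight i (p j * real n))" if "1 \<le> n" for n
    proof -
      have "prob (\<Inter>n. E n) \<le> prob (E n)"
        using E_sets by (intro finite_measure_mono) auto
      then show ?thesis using E_prob[of n] that by simp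
    qed
    then show "\<exists>N. \<forall>n\<ge>N. prob (\<Inter>n. E n) \<le> (\<Sum>i<r. poisson_weight i (p j * real n))" by blast
  qed
  then have "(\<Inter>n. E n) \<in> null_sets M"
    using E_sets by (auto simp: null_sets_def emeasure_eq_measure measure_le_0_iff)
  then have "AE \<omega> in M. \<omega> \<notin> (\<Inter>n. E n)" by (rule AE_not_in)
  then show "AE \<omega> in M. record_time P X j r \<omega> < \<infinity>"
    using AE_P_hits AE_space
  proof eventually_elim
    case (elim \<omega>)
    then obtain n where "\<omega> \<notin> E n" by blast
    then have n: "r \<le> box_count P X j (real n) \<omega>" using elim(3) by (simp add: E_def not_less)
    define S where "S l = card {k. k < l \<and> X k \<omega> = j}" for l
    have S: "S (Suc l) \<le> S l + 1" for l
    proof -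
      have "{k. k < Suc l \<and> X k \<omega> = j} \<subseteq> insert l {k. k < l \<and> X k \<omega> = j}" by auto
      from card_mono[OF _ this] show ?thesis unfolding S_def
        by (auto intro: order_trans card_insert_le_m1 simp: card_insert_if split: if_splits)
    qed
    have "\<exists>l. S l = r"
    proof (rule ccontr)
      assume "\<nexists>l. S l = r"
      then have "S l < r" for l
      proof (induction l)
        case 0
        then show ?case using r by (simp add: S_def)
      next
        case (Suc l)
        then have "S l < r" "S (Suc l) \<noteq> r" by auto
        then show ?case using S[of l] by linarith
      qed
      then show False using n by (simp add: S_def box_count_def not_less[symmetric])
    qed
    then obtain l where l: "S l = r" by blast
    obtain t where t: "0 \<le> t" "P t \<omega> = l" using elim(2) by blast
    have "record_time P X j r \<omega> \<le> ereal t"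
      unfolding record_time_def using t l by (intro Inf_lower) (auto simp: box_count_def S_def)
    then show ?case by (rule order_le_less_trans) simp
  qed
qed

text \<open>A record time rounded up is at most \<open>a\<close> when the content of the box at the natural time \<open>\<lfloor>a\<rfloor>\<close> is at least \<open>r\<close>;
  contents at natural times have the law given by thinning.\<close>

lemma ceiling_record_joint:
  assumes r: "1 \<le> r" and A: "finite A"
  shows "prob {\<omega> \<in> space M. \<forall>j\<in>A. rceil (rec r j \<omega>) \<le> a j}
    = (\<Prod>j\<in>A. erlang_CDF (r - 1) (p j) (real_of_int \<lfloor>a j\<rfloor>))"
proof -
  have E_sets: "{\<omega> \<in> space M. \<forall>j\<in>A. rceil (rec r j \<omega>) \<le> a j} \<in> sets M"
    unfolding rceil_le_iff using A by measurable
  show ?thesis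
  proof (cases "\<forall>j\<in>A. 1 \<le> a j")
    case False
    then obtain i where i: "i \<in> A" "a i < 1" by auto
    then have fl: "\<lfloor>a i\<rfloor> \<le> 0" by linarith
    have "AE \<omega> in M. \<not> (\<forall>j\<in>A. rceil (rec r j \<omega>) \<le> a j)"
      using AE_record_times_finite[OF r] AE_space
    proof eventually_elim
      case (elim \<omega>)
      have "\<not> rec r i \<omega> \<le> 0"
        using rec_le_iff[of \<omega> i r 0] elim r by (simp add: box_count_0)
      moreover have "real_of_int \<lfloor>a i\<rfloor> \<le> 0" using fl by simp
      ultimately have "\<not> rceil (rec r i \<omega>) \<le> a i" unfolding rceil_le_iff by linarith
      then show ?case using i(1) by blast
    qed
    then have "prob {\<omega> \<in> space M. \<forall>j\<in>A. rceil (rec r j \<omega>) \<le> a j} = 0"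
      using E_sets by (subst prob_eq_0) auto
    moreover have "erlang_CDF (r - 1) (p i) (real_of_int \<lfloor>a i\<rfloor>) = 0"
    proof (cases "\<lfloor>a i\<rfloor> = 0")
      case True
      then show ?thesis by (simp add: erlang_CDF_at0)
    next
      case False
      then have "real_of_int \<lfloor>a i\<rfloor> < 0" using fl by linarith
      then show ?thesis by (simp only: erlang_CDF_def if_True)
    qed
    ultimately show ?thesis using prod_zero[OF A, of "\<lambda>j. erlang_CDF (r - 1) (p j) (real_of_int \<lfloor>a j\<rfloor>)"] i by auto
  next
    case True
    define n where "n j = (if j \<in> A then nat \<lfloor>a j\<rfloor> else 1)" for j
    have n: "0 < n j" for j using True by (auto simp: n_def)
    have na: "real (n j) = real_of_int \<lfloor>a j\<rfloor>" if "j \<in> A" for j using True that by (force simp: n_def)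
    obtain J where J: "A \<subseteq> {..<J}" using finite_nat_bounded[OF A] by blast
    have cm[measurable]: "box_count P X j (real (n j)) \<in> M \<rightarrow>\<^sub>M count_space UNIV" for j by (rule box_count_meas) simp
    have "prob {\<omega> \<in> space M. \<forall>j\<in>A. rceil (rec r j \<omega>) \<le> a j} = prob {\<omega> \<in> space M. \<forall>j\<in>A. r \<le> box_count P X j (real (n j)) \<omega>}"
    proof (rule finite_measure_eq_AE)
      show "AE \<omega> in M. \<omega> \<in> {\<omega> \<in> space M. \<forall>j\<in>A. rceil (rec r j \<omega>) \<le> a j} \<longleftrightarrow>
          \<omega> \<in> {\<omega> \<in> space M. \<forall>j\<in>A. r \<le> box_count P X j (real (n j)) \<omega>}"
        using AE_record_times_finite[OF r] AE_space
      proof eventually_elim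
        case (elim \<omega>)
        then show ?case unfolding rceil_le_iff by (simp add: na[symmetric] rec_le_iff cong: ball_cong)
      qed
      show "{\<omega> \<in> space M. \<forall>j\<in>A. r \<le> box_count P X j (real (n j)) \<omega>} \<in> sets M"
        using A by measurable
    qed (rule E_sets)
    also have "\<dots> = expectation (indicator {\<omega> \<in> space M. \<forall>j\<in>A. r \<le> box_count P X j (real (n j)) \<omega>})"
      by simp
    also have "\<dots> = expectation (\<lambda>\<omega>. \<Prod>j<J. if j \<in> A then of_bool (r \<le> box_count P X j (real (n j)) \<omega>)
        else (1/2) ^ (0 * box_count P X j (real (n j)) \<omega>))"
    proof (rule Bochner_Integration.integral_cong[OF refl])
      fix \<omega> assume \<omega>: "\<omega> \<in> space M"
      have "(\<Prod>j<J. if j \<in> A then of_bool (r \<le> box_count P X j (real (n j)) \<omega>) else (1/2 :: real) ^ (0 * box_count P X j (real (n j)) \<omega>))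
        = (\<Prod>j\<in>A. of_bool (r \<le> box_count P X j (real (n j)) \<omega>))"
        using J by (intro prod.mono_neutral_cong_right) auto
      also have "\<dots> = of_bool (\<forall>j\<in>A. r \<le> box_count P X j (real (n j)) \<omega>)"
        using A by (induction A rule: finite_induct) auto
      finally show "indicator {\<omega> \<in> space M. \<forall>j\<in>A. r \<le> box_count P X j (real (n j)) \<omega>} \<omega>
        = (\<Prod>j<J. if j \<in> A then of_bool (r \<le> box_count P X j (real (n j)) \<omega>) else (1/2 :: real) ^ (0 * box_count P X j (real (n j)) \<omega>))"
        using \<omega> by (simp add: indicator_def)
    qed
    also have "\<dots> = (\<Prod>j<J. if j \<in> A then measure_pmf.prob (poisson_pmf (p j * real (n j))) {r..} else exp (- (p j * real (n j) * (1 - (1/2) ^ 0))))"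
      using n J by (intro box_counts_tail[where b = "\<lambda>_. 0"] r)
    also have "\<dots> = (\<Prod>j\<in>A. erlang_CDF (r - 1) (p j) (real_of_int \<lfloor>a j\<rfloor>))"
    proof (rule prod.mono_neutral_cong_right)
      fix j assume j: "j \<in> A"
      have "{..<r} = {..r - 1}" using r by auto
      then have "measure_pmf.prob (poisson_pmf (p j * real (n j))) {r..} = erlang_CDF (r - 1) (p j) (real (n j))"
        using n[of j] p_pos[of j] by (subst poisson_tail) (auto simp: erlang_CDF_def mult.commute)
      then show "(if j \<in> A then measure_pmf.prob (poisson_pmf (p j * real (n j))) {r..} else exp (- (p j * real (n j) * (1 - (1/2) ^ 0))))
        = erlang_CDF (r - 1) (p j) (real_of_int \<lfloor>a j\<rfloor>)"
        using j by (simp add: na)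
    qed (use J in auto)
    finally show ?thesis .
  qed
qed

lemma indep_ceiling_records:
  assumes r: "1 \<le> r"
  shows "indep_vars (\<lambda>_. borel) (\<lambda>j \<omega>. rceil (rec r j \<omega>)) {..<Suc J}"
proof (subst indep_vars_finite[where E = "\<lambda>_. insert UNIV (range atMost)"])
  show "sets borel = sigma_sets (space borel) (insert UNIV (range atMost) :: real set set)"
  proof -
    have "sigma_sets UNIV (insert UNIV (range atMost) :: real set set) = sigma_sets UNIV (range atMost)"
      by (rule sigma_sets_eqI) (auto intro: sigma_sets_top)
    then show ?thesis
      by (simp add: borel_eq_atMost image_def)
  qed
  show "\<forall>A\<in>{..<Suc J} \<rightarrow> insert UNIV (range atMost).
    prob (\<Inter>j\<in>{..<Suc J}. (\<lambda>\<omega>. rceil (rec r j \<omega>)) -` A j \<inter> space M)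
    = (\<Prod>j<Suc J. prob ((\<lambda>\<omega>. rceil (rec r j \<omega>)) -` A j \<inter> space M))"
  proof
    fix A :: "nat \<Rightarrow> real set" assume "A \<in> {..<Suc J} \<rightarrow> insert UNIV (range atMost)"
    then have "\<forall>j\<in>{..<Suc J}. A j = UNIV \<or> (\<exists>x. A j = {..x})" by (auto simp: Pi_iff)
    then obtain a where a: "\<And>j. j < Suc J \<Longrightarrow> A j = UNIV \<or> A j = {..a j}" by (metis lessThan_iff)
    define B where "B = {j. j < Suc J \<and> A j \<noteq> UNIV}"
    have B: "finite B" "B \<subseteq> {..<Suc J}" "\<And>j. j \<in> B \<Longrightarrow> A j = {..a j}" using a by (auto simp: B_def)
    have key: "y \<in> A j \<longleftrightarrow> (j \<in> B \<longrightarrow> y \<le> a j)" if "j < Suc J" for y j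
      using B(3)[of j] that by (cases "j \<in> B") (auto simp: B_def)
    have "(\<Inter>j\<in>{..<Suc J}. (\<lambda>\<omega>. rceil (rec r j \<omega>)) -` A j \<inter> space M)
      = {\<omega> \<in> space M. \<forall>j\<in>B. rceil (rec r j \<omega>) \<le> a j}"
      using B(2) by (auto simp: key)
    then have "prob (\<Inter>j\<in>{..<Suc J}. (\<lambda>\<omega>. rceil (rec r j \<omega>)) -` A j \<inter> space M)
      = (\<Prod>j\<in>B. erlang_CDF (r - 1) (p j) (real_of_int \<lfloor>a j\<rfloor>))"
      using ceiling_record_joint[OF r B(1)] by simp
    also have "\<dots> = (\<Prod>j<Suc J. prob ((\<lambda>\<omega>. rceil (rec r j \<omega>)) -` A j \<inter> space M))"
    proof (rule prod.mono_neutral_cong_left)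
      show "\<forall>j\<in>{..<Suc J} - B. prob ((\<lambda>\<omega>. rceil (rec r j \<omega>)) -` A j \<inter> space M) = 1"
        by (auto simp: B_def prob_space)
      fix j assume j: "j \<in> B"
      have "(\<lambda>\<omega>. rceil (rec r j \<omega>)) -` A j \<inter> space M = {\<omega> \<in> space M. \<forall>i\<in>{j}. rceil (rec r i \<omega>) \<le> a i}"
        using B(3)[OF j] by auto
      then show "erlang_CDF (r - 1) (p j) (real_of_int \<lfloor>a j\<rfloor>) = prob ((\<lambda>\<omega>. rceil (rec r j \<omega>)) -` A j \<inter> space M)"
        using ceiling_record_joint[OF r, of "{j}" a] by simp
    qed (use B in auto)
    finally show "prob (\<Inter>j\<in>{..<Suc J}. (\<lambda>\<omega>. rceil (rec r j \<omega>)) -` A j \<inter> space M)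
      = (\<Prod>j<Suc J. prob ((\<lambda>\<omega>. rceil (rec r j \<omega>)) -` A j \<inter> space M))" .
  qed
  show "Int_stable (insert UNIV (range atMost) :: real set set)"
    by (auto simp: Int_stable_def)
qed auto

text \<open>The rounded record time is distributed as a rounded Erlang variable, which makes the sums over integers
  integrals over the line.\<close>

lemma expectation_ceiling_record:
  fixes \<psi> :: "real \<Rightarrow> real"
  assumes r: "1 \<le> r" and \<psi>[measurable]: "\<psi> \<in> borel_measurable borel"
  shows "expectation (\<lambda>\<omega>. \<psi> (rceil (rec r j \<omega>)))
    = (\<integral>s. erlang_density (r - 1) (p j) s * \<psi> (rceil s) \<partial>lborel)"
proof -
  let ?E = "density lborel (erlang_density (r - 1) (p j))"
  interpret E: prob_space ?E by (rule prob_space_erlang_density[OF p_pos])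
  let ?c = "\<lambda>s::real. rceil s"
  have eq: "distr M borel (\<lambda>\<omega>. ?c (rec r j \<omega>)) = distr ?E borel ?c"
  proof (rule cdf_unique)
    show "real_distribution (distr M borel (\<lambda>\<omega>. ?c (rec r j \<omega>)))"
      by (rule real_distribution_distr) measurable
    show "real_distribution (distr ?E borel ?c)"
      by (rule E.real_distribution_distr) measurable
    show "cdf (distr M borel (\<lambda>\<omega>. ?c (rec r j \<omega>))) = cdf (distr ?E borel ?c)"
    proof
      fix a
      have "cdf (distr M borel (\<lambda>\<omega>. ?c (rec r j \<omega>))) a = prob {\<omega> \<in> space M. \<forall>i\<in>{j}. rceil (rec r i \<omega>) \<le> a}"
        unfolding cdf_def by (subst measure_distr) (auto intro!: arg_cong[where f = prob])
      also have "\<dots> = erlang_CDF (r - 1) (p j) (real_of_int \<lfloor>a\<rfloor>)"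
        by (subst ceiling_record_joint[OF r, of "{j}" "\<lambda>_. a"]) auto
      also have "\<dots> = measure ?E {..real_of_int \<lfloor>a\<rfloor>}"
        using emeasure_erlang_density[OF p_pos[of j], of "r - 1" "real_of_int \<lfloor>a\<rfloor>"] p_pos[of j]
        by (simp add: measure_def)
      also have "\<dots> = cdf (distr ?E borel ?c) a"
      proof -
        have "?c -` {..a} = {..real_of_int \<lfloor>a\<rfloor>}"
          by (rule set_eqI) (simp only: vimage_eq atMost_iff rceil_le_iff)
        then show ?thesis unfolding cdf_def by (subst measure_distr) simp_all
      qed
      finally show "cdf (distr M borel (\<lambda>\<omega>. ?c (rec r j \<omega>))) a = cdf (distr ?E borel ?c) a" .
    qed
  qed
  have "expectation (\<lambda>\<omega>. \<psi> (?c (rec r j \<omega>))) = (\<integral>x. \<psi> x \<partial>distr M borel (\<lambda>\<omega>. ?c (rec r j \<omega>)))"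
    by (subst integral_distr) auto
  also have "\<dots> = (\<integral>s. \<psi> (?c s) \<partial>?E)"
    unfolding eq by (subst integral_distr) auto
  also have "\<dots> = (\<integral>s. erlang_density (r - 1) (p j) s * \<psi> (?c s) \<partial>lborel)"
    using p_pos[of j] by (subst integral_density) auto
  finally show ?thesis .
qed

end

section \<open>The mean number of boxes with a given content\<close>

context poissonised_occupancy
begin

text \<open>At natural times this is the mean number of boxes that hold exactly \<open>r\<close> balls.\<close>

definition phi :: "nat \<Rightarrow> real \<Rightarrow> real" where
  "phi r t = (\<Sum>j. poisson_weight r (p j * t))"

lemma weight_le: "1 \<le> r \<Longrightarrow> 0 \<le> x \<Longrightarrow> x ^ r / fact r * exp (- x) \<le> (x :: real)"
  using poisson_weight_Lipschitz[of x 0 "r - 1"] by (cases r) auto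

lemma p_nonneg: "0 \<le> p j"
  using p_pos[of j] by simp

lemma phi_summable:
  assumes "1 \<le> r" "0 \<le> t"
  shows "summable (\<lambda>j. poisson_weight r (p j * t))"
proof (rule summable_comparison_test')
  show "summable (\<lambda>j. p j * t)" using p_sums by (intro summable_mult2) (auto simp: sums_iff)
  fix j :: nat
  show "norm (poisson_weight r (p j * t)) \<le> p j * t"
    using weight_le[OF assms(1), of "p j * t"] p_nonneg[of j] assms(2) by (simp add: abs_mult)
qed

lemma phi_sums:
  assumes "1 \<le> r" "0 \<le> t"
  shows "(\<lambda>j. poisson_weight r (p j * t)) sums phi r t"
  unfolding phi_def by (rule summable_sums[OF phi_summable[OF assms]])

lemma phi_nonneg: "1 \<le> r \<Longrightarrow> 0 \<le> t \<Longrightarrow> 0 \<le> phi r t"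
  unfolding phi_def by (rule suminf_nonneg[OF phi_summable]) (auto simp: p_nonneg)

lemma phi_le: "1 \<le> r \<Longrightarrow> 0 \<le> t \<Longrightarrow> phi r t \<le> t"
proof -
  assume rt: "1 \<le> r" "0 \<le> t"
  have "phi r t \<le> 1 * t"
  proof (rule sums_le[OF _ phi_sums[OF rt] sums_mult2[OF p_sums]])
    show "poisson_weight r (p j * t) \<le> p j * t" for j
      by (rule weight_le[OF rt(1)]) (use rt(2) p_nonneg in simp)
  qed
  then show ?thesis by simp
qed

lemma phi_Lipschitz:
  assumes r: "1 \<le> r" and st: "0 \<le> s" "0 \<le> t"
  shows "\<bar>phi r s - phi r t\<bar> \<le> \<bar>s - t\<bar>"
proof -
  have d: "\<bar>poisson_weight r (p j * u) - poisson_weight r (p j * v)\<bar> \<le> p j * \<bar>s - t\<bar>"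
    if "(u = s \<and> v = t) \<or> (u = t \<and> v = s)" for u v j
  proof -
    have "\<bar>(p j * u) ^ Suc (r - 1) / fact (Suc (r - 1)) * exp (- (p j * u)) - (p j * v) ^ Suc (r - 1) / fact (Suc (r - 1)) * exp (- (p j * v))\<bar> \<le> \<bar>p j * u - p j * v\<bar>"
      using that st p_nonneg by (intro poisson_weight_Lipschitz) auto
    also have "\<bar>p j * u - p j * v\<bar> = p j * \<bar>s - t\<bar>"
      using that p_nonneg[of j] by (auto simp: right_diff_distrib[symmetric] abs_mult abs_minus_commute)
    finally show ?thesis using r by simp
  qed
  have le: "phi r u - phi r v \<le> \<bar>s - t\<bar>" if uv: "(u = s \<and> v = t) \<or> (u = t \<and> v = s)" for u v
  proof -
    have "phi r u - phi r v \<le> 1 * \<bar>s - t\<bar>"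
    proof (rule sums_le[OF _ sums_diff[OF phi_sums[OF r] phi_sums[OF r]] sums_mult2[OF p_sums]])
      fix j
      show "poisson_weight r (p j * u) - poisson_weight r (p j * v) \<le> p j * \<bar>s - t\<bar>"
        using d[OF uv, of j] by simp
    qed (use uv st in auto)
    then show ?thesis by simp
  qed
  show ?thesis using le[of s t] le[of t s] by (simp add: abs_le_iff)
qed

lemma phi_meas[measurable]: "phi r \<in> borel_measurable borel"
  unfolding phi_def by measurable

text \<open>\<open>phi r t / t ^ r\<close> is non-increasing, since each summand is.\<close>

lemma phi_growth:
  assumes r: "1 \<le> r" and t: "0 < t" "t \<le> s"
  shows "phi r s \<le> phi r t * (s / t) ^ r"
proof (rule sums_le[OF _ phi_sums[OF r] sums_mult2[OF phi_sums[OF r]]])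
  fix j
  have "(p j * s) ^ r = (p j * t) ^ r * (s / t) ^ r" using t by (simp add: power_mult_distrib[symmetric])
  moreover have "exp (- (p j * s)) \<le> exp (- (p j * t))" using t p_nonneg[of j] by (auto intro: mult_left_mono)
  ultimately show "poisson_weight r (p j * s) \<le> poisson_weight r (p j * t) * (s / t) ^ r"
    using t p_nonneg[of j]
    by (auto simp: divide_right_mono mult_left_mono mult.assoc mult.commute mult.left_commute
        intro!: divide_right_mono mult_left_mono mult_nonneg_nonneg)
qed (use t in auto)

text \<open>Convexity of the exponential: \<open>exp (- p s) \<ge> exp (- p t) (1 - p (s - t))\<close>, and the linear term is a multiple of
  the corresponding summand of \<open>phi (Suc r) t\<close>.\<close>

lemma phi_decay:
  assumes r: "1 \<le> r" and t: "0 < t" "t \<le> s"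
  shows "phi r t - (s - t) / t * real (Suc r) * phi (Suc r) t \<le> phi r s"
proof (rule sums_le[OF _ sums_diff[OF phi_sums[OF r] sums_mult[OF phi_sums]] phi_sums[OF r]])
  fix j
  let ?x = "p j * t"
  have x: "0 \<le> ?x" using t p_nonneg[of j] by simp
  have 1: "(s - t) / t * real (Suc r) * poisson_weight (Suc r) ?x = p j * (s - t) * poisson_weight r ?x"
  proof -
    have "real (Suc r) * (?x ^ Suc r / fact (Suc r)) = ?x * (?x ^ r / fact r)"
      by (simp add: fact_Suc del: of_nat_Suc)
    then have "(s - t) / t * (real (Suc r) * (?x ^ Suc r / fact (Suc r))) * exp (- ?x) = (s - t) / t * (?x * (?x ^ r / fact r)) * exp (- ?x)"
      by (simp only:)
    also have "\<dots> = p j * (s - t) * poisson_weight r ?x" using t by simp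
    finally show ?thesis by (simp only: mult.assoc)
  qed
  define W where "W = poisson_weight r ?x"
  define y where "y = p j * (s - t)"
  have "poisson_weight r ?x * (1 - p j * (s - t)) \<le> poisson_weight r ?x * exp (- (p j * (s - t)))"
    using exp_ge_add_one_self[of "- (p j * (s - t))"] x by (intro mult_left_mono) auto
  also have "\<dots> = ?x ^ r / fact r * exp (- (p j * s))"
    by (simp add: mult.assoc exp_add[symmetric] algebra_simps)
  also have "\<dots> \<le> poisson_weight r (p j * s)"
    using t p_nonneg[of j] x by (intro mult_right_mono divide_right_mono power_mono mult_left_mono) auto
  finally have "W * (1 - y) \<le> poisson_weight r (p j * s)"
    unfolding W_def y_def .
  then have "W - y * W \<le> poisson_weight r (p j * s)"
    by (simp add: right_diff_distrib mult.commute)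
  then show "poisson_weight r ?x - (s - t) / t * real (Suc r) * poisson_weight (Suc r) ?x
      \<le> poisson_weight r (p j * s)"
    unfolding 1 W_def y_def .
qed (use t r in auto)

text \<open>\<open>phi r t / t\<close> is a sum of terms bounded by \<open>p j\<close>, each of which vanishes in the limit.\<close>

lemma phi_sublinear:
  assumes r: "1 \<le> r"
  shows "((\<lambda>t. phi r t / t) \<longlongrightarrow> 0) at_top"
proof -
  define w where "w t j = poisson_weight r (p j * t) / t" for t j
  have "((\<lambda>t. \<integral>j. w t j \<partial>count_space UNIV) \<longlongrightarrow> (\<integral>j. 0 \<partial>(count_space UNIV :: nat measure))) at_top"
  proof (rule integral_dominated_convergence_at_top[where w = p])
    show "integrable (count_space UNIV) p"
      using p_sums p_nonneg by (subst integrable_count_space_nat_iff) (auto simp: sums_iff)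
    have "((\<lambda>t. w t j) \<longlongrightarrow> 0) at_top" for j
    proof -
      have lim: "filterlim (\<lambda>t. p j * t) at_top at_top"
        using p_pos[of j] by (intro filterlim_tendsto_pos_mult_at_top[OF tendsto_const _ filterlim_ident])
      have "((\<lambda>t. (p j * t) ^ r / exp (p j * t)) \<longlongrightarrow> 0) at_top"
        by (rule filterlim_compose[OF tendsto_power_div_exp_0 lim])
      moreover have "((\<lambda>t::real. inverse t) \<longlongrightarrow> 0) at_top" by (rule tendsto_inverse_0_at_top[OF filterlim_ident])
      ultimately have "((\<lambda>t. (p j * t) ^ r / exp (p j * t) / fact r * inverse t) \<longlongrightarrow> 0 / fact r * 0) at_top"
        by (intro tendsto_mult tendsto_divide tendsto_const) auto
      then show ?thesis by (simp add: w_def exp_minus divide_inverse mult_ac)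
    qed
    then show "AE j in count_space UNIV. ((\<lambda>t. w t j) \<longlongrightarrow> 0) at_top" by simp
    show "\<forall>\<^sub>F t in at_top. AE j in count_space UNIV. norm (w t j) \<le> p j"
      using eventually_gt_at_top[of 0]
    proof eventually_elim
      case (elim t)
      have "norm (w t j) \<le> p j" for j
        using weight_le[OF r, of "p j * t"] p_nonneg[of j] elim
        by (simp add: w_def abs_mult divide_le_eq mult_ac)
      then show ?case by simp
    qed
  qed simp_all
  moreover have "\<forall>\<^sub>F t in at_top. (\<integral>j. w t j \<partial>count_space UNIV) = phi r t / t"
    using eventually_gt_at_top[of 0]
  proof eventually_elim
    case (elim t)
    have s: "(\<lambda>j. w t j) sums (phi r t / t)"
      unfolding w_def using elim by (intro sums_divide phi_sums r) simp
    moreover have "norm (w t j) = w t j" for j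
      using elim p_nonneg[of j] by (simp add: w_def abs_mult)
    ultimately have "integrable (count_space UNIV) (w t)"
      by (simp add: integrable_count_space_nat_iff sums_iff)
    then show ?case using s by (subst integral_count_space_nat) (auto simp: sums_iff)
  qed
  ultimately have "((\<lambda>t. phi r t / t) \<longlongrightarrow> (\<integral>j. 0 \<partial>(count_space UNIV :: nat measure))) at_top"
    by (rule Lim_transform_eventually)
  then show ?thesis by simp
qed

lemma box_prob:
  assumes "0 < n" "1 \<le> r"
  shows "prob {\<omega> \<in> space M. box_count P X j (real n) \<omega> = r} = poisson_weight r (p j * real n)"
proof -
  have [measurable]: "box_count P X j (real n) \<in> M \<rightarrow>\<^sub>M count_space UNIV" by (rule box_count_meas) simp
  have eq: "{\<omega> \<in> space M. box_count P X j (real n) \<omega> = r}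
    = {\<omega> \<in> space M. r \<le> box_count P X j (real n) \<omega>} - {\<omega> \<in> space M. Suc r \<le> box_count P X j (real n) \<omega>}" by auto
  have "{\<omega> \<in> space M. Suc r \<le> box_count P X j (real n) \<omega>} \<subseteq> {\<omega> \<in> space M. r \<le> box_count P X j (real n) \<omega>}"
    by auto
  then have "prob {\<omega> \<in> space M. box_count P X j (real n) \<omega> = r}
    = prob {\<omega> \<in> space M. r \<le> box_count P X j (real n) \<omega>} - prob {\<omega> \<in> space M. Suc r \<le> box_count P X j (real n) \<omega>}"
    unfolding eq by (intro finite_measure_Diff) measurable
  then show ?thesis
    using assms p_pos[of j] by (simp add: box_tail poisson_tail)
qed

lemma boxes_with_content:
  assumes r: "1 \<le> r"
  shows "finite {j. box_count P X j t \<omega> = r}" "card {j. box_count P X j t \<omega> = r} \<le> P t \<omega>"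
proof -
  have sub: "{j. box_count P X j t \<omega> = r} \<subseteq> (\<lambda>k. X k \<omega>) ` {..<P t \<omega>}"
    using r by (auto intro: box_count_pos_imp)
  then show "finite {j. box_count P X j t \<omega> = r}" by (rule finite_subset) simp
  have "card {j. box_count P X j t \<omega> = r} \<le> card ((\<lambda>k. X k \<omega>) ` {..<P t \<omega>})"
    by (rule card_mono[OF _ sub]) simp
  also have "\<dots> \<le> P t \<omega>" using card_image_le[of "{..<P t \<omega>}"] by simp
  finally show "card {j. box_count P X j t \<omega> = r} \<le> P t \<omega>" .
qed

lemma P_increment_mean:
  assumes "0 \<le> s" "s < t"
  shows "integrable M (\<lambda>\<omega>. real (P t \<omega> - P s \<omega>))" "expectation (\<lambda>\<omega>. real (P t \<omega> - P s \<omega>)) = t - s"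
proof -
  have d: "distr M (count_space UNIV) (\<lambda>\<omega>. P t \<omega> - P s \<omega>) = measure_pmf (poisson_pmf (t - s))"
    using P_poisson assms unfolding poisson_process_def by simp
  have [measurable]: "P t \<in> M \<rightarrow>\<^sub>M count_space UNIV" "P s \<in> M \<rightarrow>\<^sub>M count_space UNIV"
    using assms by (auto intro: P_meas)
  have m: "(\<lambda>\<omega>. P t \<omega> - P s \<omega>) \<in> M \<rightarrow>\<^sub>M count_space UNIV" by measurable
  show "integrable M (\<lambda>\<omega>. real (P t \<omega> - P s \<omega>))"
    by (rule integrable_distr[OF m]) (use poisson_mean(1)[of "t - s"] assms in \<open>simp add: d\<close>)
  show "expectation (\<lambda>\<omega>. real (P t \<omega> - P s \<omega>)) = t - s"
    using poisson_mean(2)[of "t - s"] assms integral_distr[OF m, of real] by (simp add: d)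
qed

lemma P_integrable: "0 < t \<Longrightarrow> integrable M (\<lambda>\<omega>. real (P t \<omega>))"
  using P_increment_mean(1)[of 0 t] by (subst Bochner_Integration.integrable_cong[OF refl]) (auto simp: P_0)

lemma content_partial_sums:
  assumes r: "1 \<le> r" and t: "0 < t"
  shows "(\<lambda>\<omega>. real (card {j. box_count P X j t \<omega> = r})) \<in> borel_measurable M"
    and "(\<lambda>n. \<Sum>j<n. prob {\<omega> \<in> space M. box_count P X j t \<omega> = r}) \<longlonglongrightarrow> Phi M P X r t"
proof -
  define S where "S n \<omega> = (\<Sum>j<n. indicat_real {\<omega> \<in> space M. box_count P X j t \<omega> = r} \<omega>)" for n \<omega>
  have ev: "{\<omega> \<in> space M. box_count P X j t \<omega> = r} \<in> sets M" for j
  proof -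
    have [measurable]: "box_count P X j t \<in> M \<rightarrow>\<^sub>M count_space UNIV" using t by (intro box_count_meas) simp
    show ?thesis by measurable
  qed
  have S_meas: "S n \<in> borel_measurable M" for n
    unfolding S_def using ev by (intro borel_measurable_sum borel_measurable_indicator)
  have S_card: "S n \<omega> = real (card ({..<n} \<inter> {j. box_count P X j t \<omega> = r}))" if "\<omega> \<in> space M" for n \<omega>
    using that by (simp add: S_def indicator_def sum.If_cases)
  have lim: "(\<lambda>n. S n \<omega>) \<longlonglongrightarrow> real (card {j. box_count P X j t \<omega> = r})" if \<omega>: "\<omega> \<in> space M" for \<omega>
  proof -
    obtain N where "{j. box_count P X j t \<omega> = r} \<subseteq> {..<N}"
      using finite_nat_bounded[OF boxes_with_content(1)[OF r]] by blast
    then have "S n \<omega> = real (card {j. box_count P X j t \<omega> = r})" if "N \<le> n" for n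
      unfolding S_card[OF \<omega>] using that by (intro arg_cong[where f = "\<lambda>A. real (card A)"]) auto
    then show ?thesis
      by (intro tendsto_eventually) (auto simp: eventually_sequentially)
  qed
  show m: "(\<lambda>\<omega>. real (card {j. box_count P X j t \<omega> = r})) \<in> borel_measurable M"
    by (rule borel_measurable_LIMSEQ_real[OF lim S_meas])
  have bound: "norm (S n \<omega>) \<le> real (P t \<omega>)" if "\<omega> \<in> space M" for n \<omega>
  proof -
    have "card ({..<n} \<inter> {j. box_count P X j t \<omega> = r}) \<le> card {j. box_count P X j t \<omega> = r}"
      by (rule card_mono[OF boxes_with_content(1)[OF r]]) auto
    then show ?thesis
      unfolding S_card[OF that] using boxes_with_content(2)[OF r, of t \<omega>] by simp
  qed
  have "(\<lambda>n. expectation (S n)) \<longlonglongrightarrow> expectation (\<lambda>\<omega>. real (card {j. box_count P X j t \<omega> = r}))"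
    using m S_meas lim bound P_integrable[OF t]
    by (intro integral_dominated_convergence[where w = "\<lambda>\<omega>. real (P t \<omega>)"]) auto
  also have "(\<lambda>n. expectation (S n)) = (\<lambda>n. \<Sum>j<n. prob {\<omega> \<in> space M. box_count P X j t \<omega> = r})"
  proof
    fix n
    have int: "integrable M (indicat_real {\<omega> \<in> space M. box_count P X j t \<omega> = r})" for j
      using ev[of j] by (intro integrable_real_indicator) (auto simp: emeasure_eq_measure)
    have "expectation (S n) = (\<Sum>j<n. expectation (indicat_real {\<omega> \<in> space M. box_count P X j t \<omega> = r}))"
      unfolding S_def by (intro Bochner_Integration.integral_sum int)
    moreover have "{\<omega> \<in> space M. box_count P X j t \<omega> = r} \<inter> space M = {\<omega> \<in> space M. box_count P X j t \<omega> = r}" for j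
      by auto
    ultimately show "expectation (S n) = (\<Sum>j<n. prob {\<omega> \<in> space M. box_count P X j t \<omega> = r})" by simp
  qed
  finally show "(\<lambda>n. \<Sum>j<n. prob {\<omega> \<in> space M. box_count P X j t \<omega> = r}) \<longlonglongrightarrow> Phi M P X r t"
    unfolding Phi_def .
qed

lemma Phi_nat:
  assumes "1 \<le> r" "0 < n"
  shows "Phi M P X r (real n) = phi r (real n)"
proof -
  have "(\<lambda>j. poisson_weight r (p j * real n)) sums Phi M P X r (real n)"
    using content_partial_sums(2)[of r "real n"] assms by (simp add: sums_def box_prob)
  then show ?thesis
    using phi_sums[OF assms(1), of "real n"] by (simp add: sums_unique2)
qed

text \<open>Each ball changes the content of one box only, and the mean number of balls between \<open>s\<close> and \<open>t\<close> is \<open>t - s\<close>.\<close>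

lemma Phi_increment:
  assumes r: "1 \<le> r" and st: "0 < s" "s < t"
  shows "\<bar>Phi M P X r t - Phi M P X r s\<bar> \<le> t - s"
proof -
  let ?K = "\<lambda>t \<omega>. real (card {j. box_count P X j t \<omega> = r})"
  have int: "integrable M (?K u)" if "0 < u" for u
    using content_partial_sums(1)[OF r that] boxes_with_content(2)[OF r, of u]
    by (intro Bochner_Integration.integrable_bound[OF P_integrable[OF that]]) auto
  have diff: "\<bar>?K t \<omega> - ?K s \<omega>\<bar> \<le> real (P t \<omega> - P s \<omega>)" if \<omega>: "\<omega> \<in> space M" for \<omega>
  proof -
    let ?D = "(\<lambda>k. X k \<omega>) ` {P s \<omega>..<P t \<omega>}"
    have same: "box_count P X j t \<omega> = box_count P X j s \<omega>" if "j \<notin> ?D" for j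
      unfolding box_count_def
    proof (rule arg_cong[where f = card], intro set_eqI iffI)
      fix k assume "k \<in> {k. k < P t \<omega> \<and> X k \<omega> = j}"
      then show "k \<in> {k. k < P s \<omega> \<and> X k \<omega> = j}" using that by (force simp: not_less[symmetric])
    next
      fix k assume "k \<in> {k. k < P s \<omega> \<and> X k \<omega> = j}"
      then show "k \<in> {k. k < P t \<omega> \<and> X k \<omega> = j}" using P_le[OF \<omega>, of s t] st by auto
    qed
    have le: "card {j. box_count P X j u \<omega> = r} \<le> card {j. box_count P X j v \<omega> = r} + card ?D"
      if "(u = s \<and> v = t) \<or> (u = t \<and> v = s)" for u v
    proof -
      have "card {j. box_count P X j u \<omega> = r} \<le> card ({j. box_count P X j v \<omega> = r} \<union> ?D)"
        using boxes_with_content(1)[OF r] same that by (intro card_mono) force+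
      then show ?thesis by (rule order_trans) (rule card_Un_le)
    qed
    have "card ?D \<le> P t \<omega> - P s \<omega>" using card_image_le[of "{P s \<omega>..<P t \<omega>}"] by simp
    then show ?thesis using le[of s t] le[of t s] unfolding abs_le_iff by linarith
  qed
  have "Phi M P X r t - Phi M P X r s = expectation (\<lambda>\<omega>. ?K t \<omega> - ?K s \<omega>)"
    unfolding Phi_def using int st by simp
  also have "\<bar>\<dots>\<bar> \<le> expectation (\<lambda>\<omega>. real (P t \<omega> - P s \<omega>))"
    using int st diff P_increment_mean(1)[of s t]
    by (intro integral_abs_bound[THEN order_trans] integral_mono) auto
  finally show ?thesis using P_increment_mean(2)[of s t] st by simp
qed

text \<open>Both functions are Lipschitz with constant 1 and agree at natural times.\<close>

lemma Phi_close_phi: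
  assumes r: "1 \<le> r" and t: "1 \<le> t"
  shows "\<bar>Phi M P X r t - phi r t\<bar> \<le> 2"
proof -
  define n where "n = nat \<lfloor>t\<rfloor>"
  have n: "0 < n" "real n \<le> t" "t - real n \<le> 1"
    using t unfolding n_def by linarith+
  have "\<bar>Phi M P X r t - Phi M P X r (real n)\<bar> \<le> 1"
    using Phi_increment[OF r, of "real n" t] n by (cases "real n = t") auto
  moreover have "\<bar>phi r (real n) - phi r t\<bar> \<le> 1"
    using phi_Lipschitz[OF r, of "real n" t] n t by simp
  ultimately show ?thesis unfolding Phi_nat[OF r n(1)] by linarith
qed

end

section \<open>Laplace functional of the rescaled record process\<close>

lemma prod_one_minus_bounds:
  fixes q :: "nat \<Rightarrow> real"
  assumes q: "\<And>j. 0 \<le> q j" "\<And>j. q j \<le> \<eta>" and \<eta>: "\<eta> \<le> 1/2"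
  shows "exp (- (1 + 2 * \<eta>) * (\<Sum>j<n. q j)) \<le> (\<Prod>j<n. 1 - q j)" "(\<Prod>j<n. 1 - q j) \<le> exp (- (\<Sum>j<n. q j))"
proof -
  have "exp (- (1 + 2 * \<eta>) * q j) \<le> 1 - q j" for j
  proof -
    have "q j \<le> 1/2" using q(2)[of j] \<eta> by simp
    have "q j * q j \<le> \<eta> * q j" using q[of j] by (intro mult_right_mono) auto
    then have "- (1 + 2 * \<eta>) * q j \<le> - q j - 2 * (q j)\<^sup>2"
      by (simp add: power2_eq_square algebra_simps)
    also have "\<dots> \<le> ln (1 - q j)"
      by (rule ln_one_minus_pos_lower_bound) (use q(1) \<open>q j \<le> 1/2\<close> in auto)
    finally show ?thesis using \<open>q j \<le> 1/2\<close> by (subst (asm) ln_ge_iff) auto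
  qed
  then have "(\<Prod>j<n. exp (- (1 + 2 * \<eta>) * q j)) \<le> (\<Prod>j<n. 1 - q j)"
    by (intro prod_mono) auto
  then show "exp (- (1 + 2 * \<eta>) * (\<Sum>j<n. q j)) \<le> (\<Prod>j<n. 1 - q j)"
    by (simp only: exp_sum[symmetric] sum_distrib_left[symmetric] finite_lessThan)
  have "1 - q j \<le> exp (- q j)" for j using exp_ge_add_one_self[of "- q j"] by simp
  moreover have "0 \<le> 1 - q j" for j using q(2)[of j] \<eta> by simp
  ultimately have "(\<Prod>j<n. 1 - q j) \<le> (\<Prod>j<n. exp (- q j))"
    by (intro prod_mono) auto
  then show "(\<Prod>j<n. 1 - q j) \<le> exp (- (\<Sum>j<n. q j))"
    by (simp add: exp_sum[symmetric] sum_negf)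
qed

context poissonised_occupancy
begin

abbreviation record_points :: "nat \<Rightarrow> real \<Rightarrow> 'a \<Rightarrow> real measure" where
  "record_points r t0 \<omega> \<equiv> measure_of_counting (\<lambda>\<theta>. scaled_record_count M P X r t0 \<theta> \<omega>)"

lemma erlang_weight:
  assumes "1 \<le> r" "0 < s"
  shows "erlang_density (r - 1) l s = real r / s * poisson_weight r (l * s)"
proof -
  obtain k where k: "r = Suc k" using assms(1) by (cases r) auto
  have "real (Suc k) / s * ((l * s) ^ Suc k / fact (Suc k)) = l ^ Suc k * s ^ k / fact k"
    using assms(2) by (simp add: fact_Suc power_mult_distrib del: of_nat_Suc)
  then have "real (Suc k) / s * ((l * s) ^ Suc k / fact (Suc k)) * exp (- (l * s)) = l ^ Suc k * s ^ k / fact k * exp (- (l * s))"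
    by (simp only:)
  then show ?thesis using assms(2) by (simp add: k erlang_density_def mult.assoc del: fact_Suc of_nat_Suc power_Suc)
qed

lemma ceiling_record_expectation:
  fixes \<psi> :: "real \<Rightarrow> real"
  assumes r: "1 \<le> r" and \<psi>[measurable]: "\<psi> \<in> borel_measurable borel"
  shows "expectation (\<lambda>\<omega>. \<psi> (rceil (rec r j \<omega>)))
    = (\<integral>s. indicator {0<..} s * (real r / s * poisson_weight r (p j * s)) * \<psi> (rceil s) \<partial>lborel)"
  unfolding expectation_ceiling_record[OF r \<psi>]
proof (rule integral_cong_AE)
  have "AE s in lborel. s \<noteq> (0::real)" by (rule AE_lborel_singleton)
  then show "AE s in lborel. erlang_density (r - 1) (p j) s * \<psi> (rceil s)
    = indicator {0<..} s * (real r / s * poisson_weight r (p j * s)) * \<psi> (rceil s)"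
  proof eventually_elim
    case (elim s)
    then show ?case using erlang_weight[OF r, of s "p j"]
      by (cases "0 < s") (auto simp: erlang_density_def)
  qed
qed measurable

text \<open>The Erlang densities of all boxes sum to \<open>(r / s) \<phi>\<^sub>r(s)\<close>.\<close>

lemma record_intensity:
  fixes \<psi> :: "real \<Rightarrow> real"
  assumes r: "1 \<le> r" and \<psi>[measurable]: "\<psi> \<in> borel_measurable borel"
    and \<psi>01: "\<And>x. 0 \<le> \<psi> x" "\<And>x. \<psi> x \<le> 1" and b: "\<And>x. b < x \<Longrightarrow> \<psi> x = 0"
  shows "integrable lborel (\<lambda>s. indicator {0<..} s * (real r / s * phi r s) * \<psi> (rceil s))" (is "integrable _ ?I")
    and "(\<lambda>j. expectation (\<lambda>\<omega>. \<psi> (rceil (rec r j \<omega>)))) sums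
      (\<integral>s. indicator {0<..} s * (real r / s * phi r s) * \<psi> (rceil s) \<partial>lborel)"
proof -
  define g where "g j s = indicator {0<..} s * (real r / s * poisson_weight r (p j * s)) * \<psi> (rceil s)" for j s
  have g_meas[measurable]: "g j \<in> borel_measurable lborel" for j unfolding g_def by measurable
  have g0: "0 \<le> g j s" for j s
    unfolding g_def using \<psi>01(1) p_nonneg by (auto simp: indicator_def)
  have g_sums: "(\<lambda>j. g j s) sums ?I s" for s
  proof (cases "0 < s")
    case True
    then show ?thesis unfolding g_def
      by (intro sums_mult sums_mult2 phi_sums r) simp
  qed (simp add: g_def)
  have I0: "0 \<le> ?I s" for s using \<psi>01(1) phi_nonneg[OF r, of s] by (auto simp: indicator_def)
  have I_le: "?I s \<le> real r * indicator {0<..max 0 b} s" for s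
  proof (cases "0 < s \<and> s \<le> b")
    case True
    have "real r / s * phi r s * \<psi> (rceil s) \<le> real r / s * s * 1"
      using True phi_le[OF r, of s] phi_nonneg[OF r, of s] \<psi>01
      by (intro mult_mono mult_left_mono mult_nonneg_nonneg) auto
    then show ?thesis using True by simp
  next
    case False
    have "\<psi> (rceil s) = 0" if "b < s" by (rule b) (use that in linarith)
    then show ?thesis using False by (auto simp: indicator_def)
  qed
  show I_int: "integrable lborel ?I"
  proof (rule Bochner_Integration.integrable_bound[where f = "\<lambda>s. real r * indicator {0<..max 0 b} s"])
    show "AE s in lborel. norm (?I s) \<le> norm (real r * indicator {0<..max 0 b} s)"
    proof (rule AE_I2)
      fix s
      have "norm (?I s) = ?I s" using I0[of s] by (simp only: real_norm_def abs_of_nonneg)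
      also have "\<dots> \<le> norm (real r * indicator {0<..max 0 b} s)" using I_le[of s] by simp
      finally show "norm (?I s) \<le> norm (real r * indicator {0<..max 0 b} s)" .
    qed
  qed (auto intro!: integrable_mult_right integrable_real_indicator)
  have part: "(\<Sum>j<n. g j s) \<le> ?I s" for n s
    using sum_le_suminf[OF sums_summable[OF g_sums], of "{..<n}" s] g0 sums_unique[OF g_sums[of s]] by auto
  have g_int: "integrable lborel (g j)" for j
  proof (rule Bochner_Integration.integrable_bound[OF I_int])
    have "g j s \<le> ?I s" for s
      using part[of s "Suc j"] g0 sum_nonneg[of "{..<j}" "\<lambda>j. g j s"] by (simp add: add_increasing)
    then show "AE s in lborel. norm (g j s) \<le> norm (?I s)"
      using g0 I0 by (intro AE_I2) (simp only: real_norm_def abs_of_nonneg)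
  qed simp
  have "(\<lambda>n. \<integral>s. (\<Sum>j<n. g j s) \<partial>lborel) \<longlonglongrightarrow> (\<integral>s. ?I s \<partial>lborel)"
  proof (rule integral_dominated_convergence[OF _ _ I_int])
    show "AE s in lborel. (\<lambda>n. \<Sum>j<n. g j s) \<longlonglongrightarrow> ?I s"
      using g_sums by (intro AE_I2) (simp add: sums_def)
    show "AE s in lborel. norm (\<Sum>j<n. g j s) \<le> ?I s" for n
      using part g0 by (intro AE_I2) (simp add: sum_nonneg)
  qed measurable
  also have "(\<lambda>n. \<integral>s. (\<Sum>j<n. g j s) \<partial>lborel) = (\<lambda>n. \<Sum>j<n. expectation (\<lambda>\<omega>. \<psi> (rceil (rec r j \<omega>))))"
  proof
    fix n
    have E: "expectation (\<lambda>\<omega>. \<psi> (rceil (rec r j \<omega>))) = (\<integral>s. g j s \<partial>lborel)" for j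
      unfolding g_def by (rule ceiling_record_expectation[OF r \<psi>])
    show "(\<integral>s. (\<Sum>j<n. g j s) \<partial>lborel) = (\<Sum>j<n. expectation (\<lambda>\<omega>. \<psi> (rceil (rec r j \<omega>))))"
      unfolding E by (intro Bochner_Integration.integral_sum g_int)
  qed
  finally show "(\<lambda>j. expectation (\<lambda>\<omega>. \<psi> (rceil (rec r j \<omega>)))) sums (\<integral>s. ?I s \<partial>lborel)"
    unfolding sums_def .
qed

text \<open>Each Erlang density is at most \<open>r / s\<close>, because a Poisson weight is at most 1. This makes every single box
  negligible in a window that is short compared with its starting time.\<close>

lemma ceiling_record_expectation_le:
  fixes \<psi> :: "real \<Rightarrow> real"
  assumes r: "1 \<le> r" and \<psi>[measurable]: "\<psi> \<in> borel_measurable borel"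
    and \<psi>01: "\<And>x. 0 \<le> \<psi> x" "\<And>x. \<psi> x \<le> 1"
    and supp: "\<And>s. \<psi> (rceil s) \<noteq> 0 \<Longrightarrow> c < s \<and> s \<le> b" and c: "0 < c" "c \<le> b"
  shows "expectation (\<lambda>\<omega>. \<psi> (rceil (rec r j \<omega>))) \<le> real r / c * (b - c)"
proof -
  let ?f = "\<lambda>s. indicator {0<..} s * (real r / s * poisson_weight r (p j * s)) * \<psi> (rceil s)"
  have le: "?f s \<le> real r / c * indicator {c<..b} s" and f0: "0 \<le> ?f s" for s
  proof -
    show "0 \<le> ?f s" using \<psi>01(1) p_nonneg by (auto simp: indicator_def)
    show "?f s \<le> real r / c * indicator {c<..b} s"
    proof (cases "\<psi> (rceil s) = 0")
      case False
      then have s: "c < s" "s \<le> b" using supp by auto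
      have "real r / s * poisson_weight r (p j * s) * \<psi> (rceil s) \<le> real r / c * 1 * 1"
        using s c p_nonneg[of j] \<psi>01 poisson_weight_le_1[of "p j * s" r]
        by (intro mult_mono divide_left_mono mult_nonneg_nonneg) auto
      then show ?thesis using s c by simp
    qed (use c in simp)
  qed
  have int: "integrable lborel (\<lambda>s. real r / c * indicator {c<..b} s)"
    using c by (intro integrable_mult_right integrable_real_indicator) auto
  have "expectation (\<lambda>\<omega>. \<psi> (rceil (rec r j \<omega>))) = (\<integral>s. ?f s \<partial>lborel)"
    by (rule ceiling_record_expectation[OF r \<psi>])
  also have "\<dots> \<le> (\<integral>s. real r / c * indicator {c<..b} s \<partial>lborel)"
    by (rule integral_mono_AE'[OF int]) (intro AE_I2 le order_trans[OF f0 le])+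
  also have "\<dots> = real r / c * (b - c)" using c by simp
  finally show ?thesis .
qed

text \<open>The test function sees finitely many boxes, but their number depends on \<open>\<omega>\<close>; sums over initial segments of boxes
  are eventually constant and give the integral as a limit of random variables.\<close>

lemma scaled_record_process:
  assumes \<omega>: "\<omega> \<in> space M" and r: "1 \<le> r" and t0: "0 \<le> t0" and h: "0 < time_scale M P X r t0"
  shows "record_points r t0 \<omega> \<in> point_measures"
    and "f \<in> test_functions \<Longrightarrow> (\<And>x. x > A \<Longrightarrow> f x = 0) \<Longrightarrow> \<exists>J. \<forall>n\<ge>J.
      (\<integral>x. f x \<partial>record_points r t0 \<omega>)
      = (\<Sum>j<n. if t0 < rec r j \<omega> then f ((rec r j \<omega> - t0) / time_scale M P X r t0) else 0)"
proof -
  define h where "h = time_scale M P X r t0"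
  define I where "I = {j. t0 < rec r j \<omega>}"
  define x where "x j = (rec r j \<omega> - t0) / h" for j
  have h0: "0 < h" using h by (simp add: h_def)
  have x0: "0 \<le> x j" if "j \<in> I" for j using that h0 by (simp add: I_def x_def)
  have set: "{j \<in> I. x j \<le> \<theta>} = {j. t0 < rec r j \<omega> \<and> rec r j \<omega> \<le> t0 + h * \<theta>}" for \<theta>
    using h0 by (auto simp: I_def x_def divide_le_eq mult.commute)
  have fin: "finite {j \<in> I. x j \<le> \<theta>}" for \<theta>
    unfolding set by (rule finite_records[OF \<omega> r t0])
  have count: "scaled_record_count M P X r t0 \<theta> \<omega> = real (card {j \<in> I. x j \<le> \<theta>})" for \<theta>
  proof -
    let ?D = "{j. record_time P X j r \<omega> < \<infinity>}"
    let ?B = "{t0<..t0 + h * \<theta>}"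
    have B: "?B \<in> sets borel_nonneg" using t0 by (auto simp: sets_restrict_space_iff)
    have nonneg: "0 \<le> real_of_ereal (record_time P X j r \<omega>)" if j: "j \<in> ?D" for j
    proof -
      obtain b where "0 \<le> b" "record_time P X j r \<omega> = ereal b"
        using record_time_finite[OF \<omega>, of j r] j by auto
      then show ?thesis by simp
    qed
    have "emeasure (record_process P X r \<omega>) ?B = emeasure (count_space ?D) {j \<in> ?D. real_of_ereal (record_time P X j r \<omega>) \<in> ?B}"
      unfolding record_process_def using nonneg by (intro emeasure_dirac_sum B)
    also have "{j \<in> ?D. real_of_ereal (record_time P X j r \<omega>) \<in> ?B} = {j \<in> I. x j \<le> \<theta>}"
      unfolding set rec_def[symmetric] using t0 rec_pos_finite[of r _ \<omega>] by auto
    also have "emeasure (count_space ?D) \<dots> = of_nat (card {j \<in> I. x j \<le> \<theta>})"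
      using t0 rec_pos_finite[of r _ \<omega>] by (intro emeasure_count_space_finite fin) (auto simp: I_def)
    finally show ?thesis
      unfolding scaled_record_count_def h_def[symmetric] by (simp add: measure_def)
  qed
  have eq: "record_points r t0 \<omega> = dirac_sum I x"
    by (rule measure_of_counting_eq_dirac_sum[OF x0 fin count])
  show "record_points r t0 \<omega> \<in> point_measures"
    unfolding eq by (rule dirac_sum_in_point_measures[OF x0 fin])
  assume f: "f \<in> test_functions" "\<And>x. x > A \<Longrightarrow> f x = 0"
  obtain J where J: "{j \<in> I. x j \<le> A} \<subseteq> {..<J}"
    using finite_nat_bounded[OF fin] by blast
  have "(\<integral>x. f x \<partial>dirac_sum I x) = (\<Sum>j<n. if t0 < rec r j \<omega> then f (x j) else 0)" if "J \<le> n" for n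
  proof -
    have "(\<integral>x. f x \<partial>dirac_sum I x) = (\<Sum>j | j \<in> I \<and> x j \<le> A. f (x j))"
      by (rule integral_dirac_sum[OF x0 fin f])
    also have "\<dots> = (\<Sum>j<n. if t0 < rec r j \<omega> then f (x j) else 0)"
    proof (rule sum.mono_neutral_cong_left)
      show "{j. j \<in> I \<and> x j \<le> A} \<subseteq> {..<n}" using J that by auto
      show "\<forall>j\<in>{..<n} - {j. j \<in> I \<and> x j \<le> A}. (if t0 < rec r j \<omega> then f (x j) else 0) = 0"
      proof
        fix j assume "j \<in> {..<n} - {j. j \<in> I \<and> x j \<le> A}"
        then show "(if t0 < rec r j \<omega> then f (x j) else 0) = 0"
          using f(2)[of "x j"] by (cases "x j \<le> A") (auto simp: I_def)
      qed
    qed (auto simp: I_def)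
    finally show ?thesis .
  qed
  then show "\<exists>J. \<forall>n\<ge>J. (\<integral>x. f x \<partial>record_points r t0 \<omega>)
      = (\<Sum>j<n. if t0 < rec r j \<omega> then f ((rec r j \<omega> - t0) / time_scale M P X r t0) else 0)"
    unfolding eq x_def h_def by blast
qed

end

section \<open>Asymptotics of the record intensity\<close>

context poissonised_occupancy
begin

lemma Phi_nonneg: "0 \<le> Phi M P X r t"
  unfolding Phi_def by simp

text \<open>The time unit exceeds every bound, so that unit intervals of time become invisible.\<close>

lemma time_scale_at_top:
  assumes r: "1 \<le> r" and Phi: "filterlim (Phi M P X r) at_top at_top"
  shows "filterlim (time_scale M P X r) at_top at_top"
proof -
  have "((\<lambda>t. real r * (Phi M P X r t / t)) \<longlongrightarrow> 0) at_top"
  proof (rule real_tendsto_sandwich)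
    show "((\<lambda>t. 0) \<longlongrightarrow> (0 :: real)) at_top" by simp
    have "((\<lambda>t. real r * (phi r t / t + 2 * inverse t)) \<longlongrightarrow> real r * (0 + 2 * 0)) at_top"
      by (intro tendsto_intros phi_sublinear[OF r] tendsto_inverse_0_at_top[OF filterlim_ident])
    then show "((\<lambda>t. real r * (phi r t / t + 2 * inverse t)) \<longlongrightarrow> 0) at_top" by simp
    show "\<forall>\<^sub>F t in at_top. 0 \<le> real r * (Phi M P X r t / t)"
      using eventually_gt_at_top[of 0] by eventually_elim (simp add: Phi_nonneg)
    show "\<forall>\<^sub>F t in at_top. real r * (Phi M P X r t / t) \<le> real r * (phi r t / t + 2 * inverse t)"
      using eventually_ge_at_top[of 1]
    proof eventually_elim
      case (elim t)
      have "Phi M P X r t / t \<le> (phi r t + 2) / t"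
        using Phi_close_phi[OF r elim] elim by (intro divide_right_mono) auto
      then show ?case
        by (intro mult_left_mono) (auto simp: divide_inverse distrib_right)
    qed
  qed
  moreover have "\<forall>\<^sub>F t in at_top. 0 < real r * (Phi M P X r t / t)"
    using eventually_gt_at_top[of 0] filterlim_at_top_dense[THEN iffD1, OF Phi, rule_format, of 0]
    by eventually_elim (use r in simp)
  ultimately have "filterlim (\<lambda>t. inverse (real r * (Phi M P X r t / t))) at_top at_top"
    by (rule filterlim_inverse_at_top)
  then show ?thesis
    by (simp add: time_scale_def[abs_def] divide_inverse mult_ac)
qed

lemma time_scale_over_time:
  assumes r: "1 \<le> r" and Phi: "filterlim (Phi M P X r) at_top at_top"
  shows "((\<lambda>t. time_scale M P X r t / t) \<longlongrightarrow> 0) at_top"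
proof -
  have "((\<lambda>t. inverse (real r) * inverse (Phi M P X r t)) \<longlongrightarrow> inverse (real r) * 0) at_top"
    by (intro tendsto_intros tendsto_inverse_0_at_top[OF Phi])
  then have "((\<lambda>t. inverse (real r) * inverse (Phi M P X r t)) \<longlongrightarrow> 0) at_top" by simp
  moreover have "\<forall>\<^sub>F t in at_top. inverse (real r) * inverse (Phi M P X r t) = time_scale M P X r t / t"
    using eventually_gt_at_top[of 0] by eventually_elim (simp add: time_scale_def divide_inverse)
  ultimately show ?thesis by (rule Lim_transform_eventually)
qed

text \<open>Times slightly before \<open>t0\<close> are included because rounding up can carry a point from there into the window.\<close>

lemma record_density_bound:
  assumes r: "1 \<le> r" and t0: "2 \<le> t0" and Phi: "1 \<le> Phi M P X r t0" and s: "t0 - 1 < s" "s \<le> 2 * t0"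
  shows "time_scale M P X r t0 * (real r / s * phi r s) \<le> 2 ^ (r + 3)"
proof -
  \<comment> \<open>The factor 2 bounds \<open>t0 / s\<close>, the factor \<open>2 ^ r\<close> the growth of \<open>phi\<close> up to time \<open>2 * t0\<close>, and the factor 4
    absorbs the difference between \<open>phi\<close> and \<open>Phi\<close>.\<close>
  have close: "phi r t0 \<le> Phi M P X r t0 + 2" using Phi_close_phi[OF r, of t0] t0 by simp
  have phi0: "0 \<le> phi r t0" using phi_nonneg[OF r, of t0] t0 by simp
  have "phi r s \<le> 2 ^ r * (phi r t0 + 1)"
  proof (cases "s \<le> t0")
    case True
    have "phi r s \<le> phi r t0 + 1"
      using phi_Lipschitz[OF r, of s t0] True s t0 by simp
    also have "\<dots> \<le> 2 ^ r * (phi r t0 + 1)"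
      using phi0 one_le_power[of "2::real" r] mult_right_mono[of 1 "2 ^ r" "phi r t0 + 1"] by simp
    finally show ?thesis .
  next
    case False
    have "phi r s \<le> phi r t0 * (s / t0) ^ r"
      using False t0 by (intro phi_growth[OF r]) auto
    also have "\<dots> \<le> phi r t0 * 2 ^ r"
      using phi0 s t0 False by (intro mult_left_mono power_mono) (auto simp: divide_le_eq)
    also have "\<dots> \<le> 2 ^ r * (phi r t0 + 1)" by (simp add: algebra_simps)
    finally show ?thesis .
  qed
  also have "\<dots> \<le> 2 ^ r * (4 * Phi M P X r t0)"
    using close Phi by (intro mult_left_mono) auto
  finally have phi_s: "phi r s \<le> 2 ^ r * (4 * Phi M P X r t0)" .
  have "time_scale M P X r t0 * (real r / s * phi r s) = t0 / s * (phi r s / Phi M P X r t0)"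
    using r by (simp add: time_scale_def)
  also have "\<dots> \<le> 2 * (2 ^ r * 4)"
    using s t0 Phi phi_s phi_nonneg[OF r, of s] by (intro mult_mono) (auto simp: divide_le_eq)
  finally show ?thesis by (simp add: power_add)
qed

text \<open>Condition (ii) implies condition (i). The upper bound comes from \<open>phi_growth\<close> and the lower one from
  \<open>phi_decay\<close>, where the loss \<open>(s - t) / t * (r + 1) * \<phi>\<^sub>r\<^sub>+\<^sub>1(t)\<close> relative to \<open>\<Phi>\<^sub>r(t)\<close> is of the order of the ratio
  in (ii).\<close>

lemma Phi_ratio_of_next_small:
  assumes r: "1 \<le> r" and Phi: "filterlim (Phi M P X r) at_top at_top"
    and small: "((\<lambda>t. Phi M P X (r + 1) t / (Phi M P X r t)\<^sup>2) \<longlongrightarrow> 0) at_top" and \<theta>: "0 < \<theta>"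
  shows "((\<lambda>t. Phi M P X r (t + time_scale M P X r t * \<theta>) / Phi M P X r t) \<longlongrightarrow> 1) at_top"
proof -
  let ?F = "\<lambda>t. Phi M P X r t" and ?h = "\<lambda>t. time_scale M P X r t"
  have inv: "((\<lambda>t. inverse (?F t)) \<longlongrightarrow> 0) at_top" by (rule tendsto_inverse_0_at_top[OF Phi])
  have hpos: "\<forall>\<^sub>F t in at_top. 0 < ?h t"
    using filterlim_at_top_dense[THEN iffD1, OF time_scale_at_top[OF r Phi], rule_format, of 0] .
  have F1: "\<forall>\<^sub>F t in at_top. 1 < ?F t"
    using filterlim_at_top_dense[THEN iffD1, OF Phi, rule_format, of 1] .
  show ?thesis
  proof (rule real_tendsto_sandwich)
    have "((\<lambda>t. 1 - 4 * inverse (?F t) - \<theta> * real (Suc r) / real r * (Phi M P X (r + 1) t / (?F t)\<^sup>2 + 2 * (inverse (?F t))\<^sup>2))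
      \<longlongrightarrow> 1 - 4 * 0 - \<theta> * real (Suc r) / real r * (0 + 2 * 0\<^sup>2)) at_top"
      by (intro tendsto_intros inv small)
    then show "((\<lambda>t. 1 - 4 * inverse (?F t) - \<theta> * real (Suc r) / real r * (Phi M P X (r + 1) t / (?F t)\<^sup>2 + 2 * (inverse (?F t))\<^sup>2))
      \<longlongrightarrow> 1) at_top" by simp
    have "((\<lambda>t. (1 + 2 * inverse (?F t)) * (1 + ?h t / t * \<theta>) ^ r + 2 * inverse (?F t))
      \<longlongrightarrow> (1 + 2 * 0) * (1 + 0 * \<theta>) ^ r + 2 * 0) at_top"
      by (intro tendsto_intros inv time_scale_over_time[OF r Phi])
    then show "((\<lambda>t. (1 + 2 * inverse (?F t)) * (1 + ?h t / t * \<theta>) ^ r + 2 * inverse (?F t)) \<longlongrightarrow> 1) at_top"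
      by simp
    show "\<forall>\<^sub>F t in at_top. 1 - 4 * inverse (?F t) - \<theta> * real (Suc r) / real r * (Phi M P X (r + 1) t / (?F t)\<^sup>2 + 2 * (inverse (?F t))\<^sup>2)
        \<le> ?F (t + ?h t * \<theta>) / ?F t"
      using hpos F1 eventually_ge_at_top[of 1]
    proof eventually_elim
      case (elim t)
      define s where "s = t + ?h t * \<theta>"
      have s: "t \<le> s" "1 \<le> s" using elim \<theta> by (auto simp: s_def add_increasing2)
      \<comment> \<open>Passing from \<open>Phi\<close> to \<open>phi\<close> and back costs 2 each, hence the 4; the third 2 is spent on \<open>Phi (r + 1)\<close>.\<close>
      define c where "c = (s - t) / t * real (Suc r)"
      have c: "c = \<theta> * real (Suc r) / (real r * ?F t)"
        using elim by (simp add: c_def s_def time_scale_def)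
      have c0: "0 \<le> c" using s elim by (simp add: c_def)
      have "c * phi (Suc r) t \<le> c * (Phi M P X (r + 1) t + 2)"
        using Phi_close_phi[of "Suc r" t] elim c0 by (intro mult_left_mono) auto
      moreover have "phi r t - c * phi (Suc r) t \<le> phi r s"
        using phi_decay[OF r, of t s] s elim by (simp add: c_def)
      moreover have "?F t - 2 \<le> phi r t" "phi r s \<le> ?F s + 2"
        using Phi_close_phi[OF r, of t] Phi_close_phi[OF r, of s] s elim by auto
      ultimately have "?F t - 4 - c * (Phi M P X (r + 1) t + 2) \<le> ?F s" by linarith
      then have "(?F t - 4 - c * (Phi M P X (r + 1) t + 2)) / ?F t \<le> ?F s / ?F t"
        using elim by (intro divide_right_mono) auto
      moreover have "(?F t - 4 - c * (Phi M P X (r + 1) t + 2)) / ?F t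
        = 1 - 4 * inverse (?F t) - \<theta> * real (Suc r) / real r * (Phi M P X (r + 1) t / (?F t)\<^sup>2 + 2 * (inverse (?F t))\<^sup>2)"
      proof -
        have "c * (Phi M P X (r + 1) t + 2) / ?F t = \<theta> * real (Suc r) / real r * (Phi M P X (r + 1) t / (?F t)\<^sup>2 + 2 * (inverse (?F t))\<^sup>2)"
          unfolding c by (simp add: divide_inverse power2_eq_square algebra_simps del: of_nat_Suc)
        moreover have "(y - 4 - x) / y = 1 - 4 * inverse y - x / y" if "0 < y" for x y :: real
          using that by (simp add: field_simps)
        ultimately show ?thesis using elim by simp
      qed
      ultimately show ?case by (simp add: s_def)
    qed
    show "\<forall>\<^sub>F t in at_top. ?F (t + ?h t * \<theta>) / ?F t \<le> (1 + 2 * inverse (?F t)) * (1 + ?h t / t * \<theta>) ^ r + 2 * inverse (?F t)"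
      using hpos F1 eventually_ge_at_top[of 1]
    proof eventually_elim
      case (elim t)
      define s where "s = t + ?h t * \<theta>"
      have s: "t \<le> s" "1 \<le> s" using elim \<theta> by (auto simp: s_def add_increasing2)
      have st: "s / t = 1 + ?h t / t * \<theta>" using elim by (simp add: s_def add_divide_distrib)
      have "?F s \<le> phi r s + 2" using Phi_close_phi[OF r, of s] s by simp
      also have "phi r s \<le> phi r t * (s / t) ^ r" using s elim by (intro phi_growth[OF r]) auto
      also have "phi r t * (s / t) ^ r \<le> (?F t + 2) * (s / t) ^ r"
        using Phi_close_phi[OF r, of t] s elim by (intro mult_right_mono) auto
      finally have "?F s / ?F t \<le> ((?F t + 2) * (s / t) ^ r + 2) / ?F t"
        using elim by (intro divide_right_mono) auto
      also have "\<dots> = (1 + 2 * inverse (?F t)) * (s / t) ^ r + 2 * inverse (?F t)"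
        using elim by (simp add: field_simps)
      finally show ?case by (simp add: s_def[symmetric] st)
    qed
  qed
qed

text \<open>After the substitution \<open>s = t + h \<theta>\<close> the integrand converges pointwise to \<open>g\<close> on the positive half-line and to 0
  on the negative one; \<open>record_density_bound\<close> yields a dominating function.\<close>

lemma record_intensity_limit:
  fixes g :: "real \<Rightarrow> real"
  assumes r: "1 \<le> r" and Phi: "filterlim (Phi M P X r) at_top at_top"
    and ratio: "\<And>\<theta>. 0 < \<theta> \<Longrightarrow> ((\<lambda>t. Phi M P X r (t + time_scale M P X r t * \<theta>) / Phi M P X r t) \<longlongrightarrow> 1) at_top"
    and g: "continuous_on UNIV g" "\<And>x. 0 \<le> g x" "\<And>x. g x \<le> 1" "\<And>x. A < x \<Longrightarrow> g x = 0" and A: "0 \<le> A"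
  shows "((\<lambda>t. \<integral>s. indicator {0<..} s * (real r / s * phi r s) *
        (if t < rceil s then g ((rceil s - t) / time_scale M P X r t) else 0) \<partial>lborel)
      \<longlongrightarrow> (\<integral>x. indicator {0<..A} x * g x \<partial>lborel)) at_top"
proof -
  let ?F = "\<lambda>t. Phi M P X r t" and ?h = "\<lambda>t. time_scale M P X r t"
  define w where "w t s = indicator {0<..} s * (real r / s * phi r s) *
        (if t < rceil s then g ((rceil s - t) / ?h t) else 0)" for t s
  have [measurable]: "g \<in> borel_measurable borel" by (rule borel_measurable_continuous_onI[OF g(1)])
  have w_meas[measurable]: "w t \<in> borel_measurable borel" for t unfolding w_def by measurable
  note h_top = time_scale_at_top[OF r Phi]
  have hge: "\<forall>\<^sub>F t in at_top. c < ?h t" for c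
    using filterlim_at_top_dense[THEN iffD1, OF h_top, rule_format, of c] .
  have F1: "\<forall>\<^sub>F t in at_top. 1 < ?F t"
    using filterlim_at_top_dense[THEN iffD1, OF Phi, rule_format, of 1] .
  have invF: "((\<lambda>t. inverse (?F t)) \<longlongrightarrow> 0) at_top" by (rule tendsto_inverse_0_at_top[OF Phi])
  have invh: "((\<lambda>t. inverse (?h t)) \<longlongrightarrow> 0) at_top" by (rule tendsto_inverse_0_at_top[OF h_top])
  have hA: "\<forall>\<^sub>F t in at_top. ?h t * A \<le> t"
  proof -
    have "((\<lambda>t. ?h t / t * A) \<longlongrightarrow> 0 * A) at_top" by (intro tendsto_intros time_scale_over_time[OF r Phi])
    then have "\<forall>\<^sub>F t in at_top. ?h t / t * A < 1" by (rule order_tendstoD) simp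
    then show ?thesis using eventually_gt_at_top[of 0]
      by eventually_elim (simp add: divide_less_eq)
  qed
  have bound: "\<forall>\<^sub>F t in at_top. AE \<theta> in lborel. norm (?h t * w t (t + ?h t * \<theta>)) \<le> 2 ^ (r + 3) * indicator {-1..A} \<theta>"
    using hge[of 1] F1 hA eventually_ge_at_top[of 2]
  proof eventually_elim
    case (elim t)
    show ?case
    proof (rule AE_I2)
      fix \<theta>
      define s where "s = t + ?h t * \<theta>"
      define v where "v = (if t < rceil s then g ((rceil s - t) / ?h t) else 0)"
      have w: "w t s = indicator {0<..} s * (real r / s * phi r s) * v" by (simp add: w_def v_def)
      have v01: "0 \<le> v" "v \<le> 1" using g(2,3) by (auto simp: v_def)
      show "norm (?h t * w t (t + ?h t * \<theta>)) \<le> 2 ^ (r + 3) * indicator {-1..A} \<theta>"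
      proof (cases "v = 0 \<or> s \<le> 0")
        case True
        then show ?thesis by (auto simp: s_def[symmetric] w)
      next
        case False
        then have v: "t < rceil s" "(rceil s - t) / ?h t \<le> A"
          using g(4) by (auto simp: v_def not_le[symmetric] split: if_splits)
        have "rceil s \<le> t + ?h t * A" using v(2) elim by (simp add: divide_le_eq mult.commute)
        then have s: "t - 1 < s" "s \<le> t + ?h t * A" using v(1) by linarith+
        have "- ?h t < ?h t * \<theta>" "?h t * \<theta> \<le> ?h t * A" using s elim by (auto simp: s_def)
        then have \<theta>: "\<theta> \<in> {-1..A}"
          using elim mult_less_cancel_left_pos[of "?h t" "-1" \<theta>] by auto
        have b: "?h t * (real r / s * phi r s) \<le> 2 ^ (r + 3)"
          by (rule record_density_bound[OF r]) (use elim s in auto)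
        have nn: "0 \<le> ?h t * (real r / s * phi r s)"
          using elim False phi_nonneg[OF r, of s] by simp
        have "norm (?h t * w t s) = ?h t * (real r / s * phi r s) * v"
          using False nn v01 elim phi_nonneg[OF r, of s] by (simp add: w abs_mult)
        also have "\<dots> \<le> 2 ^ (r + 3) * 1" using b nn v01 by (intro mult_mono) auto
        finally show ?thesis using \<theta> by (simp add: s_def)
      qed
    qed
  qed
  have lim: "((\<lambda>t. ?h t * w t (t + ?h t * \<theta>)) \<longlongrightarrow> indicator {0<..A} \<theta> * g \<theta>) at_top" if "\<theta> \<noteq> 0" for \<theta>
  proof (cases "0 < \<theta>")
    case False
    then have \<theta>: "\<theta> < 0" using that by simp
    have "\<forall>\<^sub>F t in at_top. ?h t * w t (t + ?h t * \<theta>) = 0"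
      using hge[of "- 1 / \<theta>"]
    proof eventually_elim
      case (elim t)
      then have "?h t * \<theta> < -1" using mult_strict_right_mono_neg[OF elim \<theta>] \<theta> by simp
      then have "\<not> t < rceil (t + ?h t * \<theta>)" by linarith
      then show ?case by (simp add: w_def)
    qed
    then show ?thesis using False by (simp add: tendsto_eventually)
  next
    case True
    define s where "s t = t + ?h t * \<theta>" for t
    have s_top: "((\<lambda>t. s t / t) \<longlongrightarrow> 1) at_top"
    proof -
      have "((\<lambda>t. 1 + ?h t / t * \<theta>) \<longlongrightarrow> 1 + 0 * \<theta>) at_top"
        by (intro tendsto_intros time_scale_over_time[OF r Phi])
      moreover have "\<forall>\<^sub>F t in at_top. 1 + ?h t / t * \<theta> = s t / t"
        using eventually_gt_at_top[of 0] by eventually_elim (simp add: s_def add_divide_distrib)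
      ultimately show ?thesis by (simp add: Lim_transform_eventually)
    qed
    have ceil: "((\<lambda>t. (rceil (s t) - t) / ?h t) \<longlongrightarrow> \<theta>) at_top"
    proof (rule real_tendsto_sandwich)
      show "((\<lambda>t. \<theta>) \<longlongrightarrow> \<theta>) at_top" by simp
      show "((\<lambda>t. \<theta> + inverse (?h t)) \<longlongrightarrow> \<theta>) at_top" using tendsto_add[OF tendsto_const invh, of \<theta>] by simp
      show "\<forall>\<^sub>F t in at_top. \<theta> \<le> (rceil (s t) - t) / ?h t"
        using hge[of 0]
      proof eventually_elim
        case (elim t)
        have "?h t * \<theta> \<le> rceil (s t) - t" unfolding s_def by linarith
        then show ?case using elim by (simp add: le_divide_eq mult.commute)
      qed
      show "\<forall>\<^sub>F t in at_top. (rceil (s t) - t) / ?h t \<le> \<theta> + inverse (?h t)"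
        using hge[of 0]
      proof eventually_elim
        case (elim t)
        have "rceil (s t) - t \<le> ?h t * \<theta> + 1" unfolding s_def by linarith
        then have "(rceil (s t) - t) / ?h t \<le> (?h t * \<theta> + 1) / ?h t"
          using elim by (intro divide_right_mono) auto
        also have "(?h t * \<theta> + 1) / ?h t = \<theta> + inverse (?h t)"
          using elim by (simp add: field_simps)
        finally show ?case .
      qed
    qed
    have glim: "((\<lambda>t. g ((rceil (s t) - t) / ?h t)) \<longlongrightarrow> g \<theta>) at_top"
      by (rule continuous_on_tendsto_compose[OF g(1) ceil]) auto
    have phi_lim: "((\<lambda>t. phi r (s t) / ?F t) \<longlongrightarrow> 1) at_top"
    proof (rule real_tendsto_sandwich)
      have "((\<lambda>t. ?F (s t) / ?F t - 2 * inverse (?F t)) \<longlongrightarrow> 1 - 2 * 0) at_top"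
        unfolding s_def by (intro tendsto_intros invF ratio True)
      then show "((\<lambda>t. ?F (s t) / ?F t - 2 * inverse (?F t)) \<longlongrightarrow> 1) at_top" by simp
      have "((\<lambda>t. ?F (s t) / ?F t + 2 * inverse (?F t)) \<longlongrightarrow> 1 + 2 * 0) at_top"
        unfolding s_def by (intro tendsto_intros invF ratio True)
      then show "((\<lambda>t. ?F (s t) / ?F t + 2 * inverse (?F t)) \<longlongrightarrow> 1) at_top" by simp
      have s1: "1 \<le> s t" if "0 < ?h t" "1 \<le> t" for t using that True by (simp add: s_def add_increasing2)
      show "\<forall>\<^sub>F t in at_top. ?F (s t) / ?F t - 2 * inverse (?F t) \<le> phi r (s t) / ?F t"
        using hge[of 0] F1 eventually_ge_at_top[of 1]
      proof eventually_elim
        case (elim t)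
        have "(?F (s t) - 2) / ?F t \<le> phi r (s t) / ?F t"
          using Phi_close_phi[OF r s1[of t]] elim by (intro divide_right_mono) auto
        then show ?case by (simp add: left_diff_distrib divide_inverse)
      qed
      show "\<forall>\<^sub>F t in at_top. phi r (s t) / ?F t \<le> ?F (s t) / ?F t + 2 * inverse (?F t)"
        using hge[of 0] F1 eventually_ge_at_top[of 1]
      proof eventually_elim
        case (elim t)
        have "phi r (s t) / ?F t \<le> (?F (s t) + 2) / ?F t"
          using Phi_close_phi[OF r s1[of t]] elim by (intro divide_right_mono) auto
        then show ?case by (simp add: distrib_right divide_inverse)
      qed
    qed
    have "((\<lambda>t. inverse (s t / t) * (phi r (s t) / ?F t) * g ((rceil (s t) - t) / ?h t)) \<longlongrightarrow> inverse 1 * 1 * g \<theta>) at_top"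
      by (intro tendsto_intros s_top phi_lim glim) auto
    moreover have "\<forall>\<^sub>F t in at_top. inverse (s t / t) * (phi r (s t) / ?F t) * g ((rceil (s t) - t) / ?h t) = ?h t * w t (t + ?h t * \<theta>)"
      using hge[of 0] F1 eventually_gt_at_top[of 0]
    proof eventually_elim
      case (elim t)
      have st: "t < s t" using elim True by (simp add: s_def)
      then have "t < rceil (s t)" by linarith
      then have "?h t * w t (s t) = ?h t * (real r / s t * phi r (s t)) * g ((rceil (s t) - t) / ?h t)"
        using st elim by (simp add: w_def)
      also have "?h t * (real r / s t * phi r (s t)) = inverse (s t / t) * (phi r (s t) / ?F t)"
        using r by (simp add: time_scale_def)
      finally show ?case by (simp add: s_def)
    qed
    ultimately have "((\<lambda>t. ?h t * w t (t + ?h t * \<theta>)) \<longlongrightarrow> inverse 1 * 1 * g \<theta>) at_top"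
      by (rule Lim_transform_eventually)
    moreover have "indicator {0<..A} \<theta> * g \<theta> = g \<theta>" using True g(4)[of \<theta>] by (auto simp: indicator_def)
    ultimately show ?thesis by (simp only: mult_1_left inverse_1)
  qed
  have "((\<lambda>t. \<integral>\<theta>. ?h t * w t (t + ?h t * \<theta>) \<partial>lborel) \<longlongrightarrow> (\<integral>\<theta>. indicator {0<..A} \<theta> * g \<theta> \<partial>lborel)) at_top"
  proof (rule integral_dominated_convergence_at_top[OF _ _ _ _ bound])
    show "integrable lborel (\<lambda>\<theta>. 2 ^ (r + 3) * indicator {-1..A} \<theta> :: real)"
      using A by (intro integrable_mult_right integrable_real_indicator) auto
    have "AE \<theta> in lborel. \<theta> \<noteq> (0::real)" by (rule AE_lborel_singleton)
    then show "AE \<theta> in lborel. ((\<lambda>t. ?h t * w t (t + ?h t * \<theta>)) \<longlongrightarrow> indicator {0<..A} \<theta> * g \<theta>) at_top"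
      by eventually_elim (rule lim)
  qed measurable
  moreover have "\<forall>\<^sub>F t in at_top. (\<integral>\<theta>. ?h t * w t (t + ?h t * \<theta>) \<partial>lborel) = (\<integral>s. w t s \<partial>lborel)"
    using hge[of 0]
  proof eventually_elim
    case (elim t)
    then show ?case using lborel_integral_real_affine[of "?h t" "w t" t] by simp
  qed
  ultimately have "((\<lambda>t. \<integral>s. w t s \<partial>lborel) \<longlongrightarrow> (\<integral>\<theta>. indicator {0<..A} \<theta> * g \<theta> \<partial>lborel)) at_top"
    by (rule Lim_transform_eventually)
  then show ?thesis unfolding w_def .
qed

end

section \<open>Convergence of the Laplace functionals\<close>

context poissonised_occupancy
begin

lemma test_function_clamp_continuous:
  "f \<in> test_functions \<Longrightarrow> continuous_on UNIV (\<lambda>x. f (max 0 x))"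
  by (auto simp: test_functions_def intro!: continuous_on_compose2[of "{0..}" f] continuous_intros)

lemma scaled_record_integral_limit:
  assumes \<omega>: "\<omega> \<in> space M" and r: "1 \<le> r" and t0: "0 \<le> t0" and h: "0 < time_scale M P X r t0"
    and f: "f \<in> test_functions"
  shows "(\<lambda>n. \<Sum>j<n. if t0 < rec r j \<omega> then f (max 0 ((rec r j \<omega> - t0) / time_scale M P X r t0)) else 0)
    \<longlonglongrightarrow> (\<integral>x. f x \<partial>record_points r t0 \<omega>)"
proof -
  obtain A where A: "\<And>x. x > A \<Longrightarrow> f x = 0" using f by (auto simp: test_functions_def)
  obtain J where J: "\<And>n. J \<le> n \<Longrightarrow> (\<integral>x. f x \<partial>record_points r t0 \<omega>)
      = (\<Sum>j<n. if t0 < rec r j \<omega> then f ((rec r j \<omega> - t0) / time_scale M P X r t0) else 0)"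
    using scaled_record_process(2)[OF \<omega> r t0 h f A] by blast
  have "(\<Sum>j<n. if t0 < rec r j \<omega> then f (max 0 ((rec r j \<omega> - t0) / time_scale M P X r t0)) else 0)
    = (\<integral>x. f x \<partial>record_points r t0 \<omega>)" if "J \<le> n" for n
    unfolding J[OF that] using h by (intro sum.cong) (auto simp: max_def not_le zero_le_divide_iff)
  then show ?thesis
    by (intro tendsto_eventually) (auto simp: eventually_sequentially)
qed

lemma scaled_record_integral_meas:
  assumes r: "1 \<le> r" and t0: "0 \<le> t0" and h: "0 < time_scale M P X r t0" and f: "f \<in> test_functions"
  shows "(\<lambda>\<omega>. \<integral>x. f x \<partial>record_points r t0 \<omega>) \<in> borel_measurable M"
proof (rule borel_measurable_LIMSEQ_real[OF scaled_record_integral_limit[OF _ r t0 h f]])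
  have "continuous_on UNIV (\<lambda>x. f (max 0 x))"
    by (rule test_function_clamp_continuous[OF f])
  then have [measurable]: "(\<lambda>x. f (max 0 x)) \<in> borel_measurable borel"
    by (rule borel_measurable_continuous_onI)
  show "(\<lambda>\<omega>. \<Sum>j<n. if t0 < rec r j \<omega> then f (max 0 ((rec r j \<omega> - t0) / time_scale M P X r t0)) else 0) \<in> borel_measurable M" for n
    by measurable
qed

text \<open>The estimate behind the limit, at a fixed time \<open>t0\<close>. The rounded record times are independent, so their
  Laplace functional is a product close to \<open>exp (- Q)\<close>, where \<open>Q\<close> is the total mean of \<open>1 - exp (- f)\<close> and \<open>\<eta>\<close>
  bounds the share of any single box; \<open>D\<close> bounds the mean effect of rounding.\<close>

lemma record_Laplace_bounds:
  assumes r: "1 \<le> r" and t0: "2 \<le> t0" and Phi: "1 \<le> Phi M P X r t0" and A: "0 \<le> A"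
    and hd: "h = time_scale M P X r t0" and h1: "1 \<le> h" and hA: "h * A + 1 \<le> t0"
    and f: "f \<in> test_functions" "\<And>x. 0 \<le> x \<Longrightarrow> 0 \<le> f x" "\<And>x. x > A \<Longrightarrow> f x = 0"
    and \<epsilon>: "0 < \<epsilon>" "\<epsilon> \<le> 1"
    and unif: "\<And>x y. 0 \<le> x \<Longrightarrow> 0 \<le> y \<Longrightarrow> \<bar>x - y\<bar> \<le> 1 / h \<Longrightarrow> \<bar>exp (- f x) - exp (- f y)\<bar> \<le> \<epsilon>"
    and \<eta>: "\<eta> = real r / (t0 - 1) * (h * A + 1)" "\<eta> \<le> 1/2"
    and Q: "Q = (\<integral>s. indicator {0<..} s * (real r / s * phi r s) *
        (if t0 < rceil s then 1 - exp (- f (max 0 ((rceil s - t0) / h))) else 0) \<partial>lborel)"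
    and D: "D = 2 ^ (r + 3) * (2 / h + \<epsilon> * (A + 2))"
    and L: "L = expectation (\<lambda>\<omega>. exp (- (\<integral>x. f x \<partial>record_points r t0 \<omega>)))"
  shows "exp (- (1 + 2 * \<eta>) * Q) - D \<le> L" "L \<le> exp (- Q) + D"
proof -
  define e where "e j \<omega> = rceil (rec r j \<omega>)" for j \<omega>
  define \<phi> where "\<phi> x = (if t0 < x then exp (- f (max 0 ((x - t0) / h))) else 1)" for x
  define \<psi>1 where "\<psi>1 x = (if t0 < x then 1 - exp (- f (max 0 ((x - t0) / h))) else 0)" for x
  define \<psi>2 where "\<psi>2 x = (if t0 < x \<and> x < t0 + 1 then 1 else if t0 < x \<and> x \<le> t0 + h * A + 1 then \<epsilon> else 0)" for x
  have "continuous_on UNIV (\<lambda>x. f (max 0 x))"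
    by (rule test_function_clamp_continuous[OF f(1)])
  then have [measurable]: "(\<lambda>x. f (max 0 x)) \<in> borel_measurable borel"
    by (rule borel_measurable_continuous_onI)
  have \<phi>_meas[measurable]: "\<phi> \<in> borel_measurable borel" and \<psi>1_meas[measurable]: "\<psi>1 \<in> borel_measurable borel"
    and \<psi>2_meas[measurable]: "\<psi>2 \<in> borel_measurable borel"
    unfolding \<phi>_def \<psi>1_def \<psi>2_def by measurable
  have e_meas[measurable]: "e j \<in> borel_measurable M" for j unfolding e_def by measurable
  have \<phi>01: "0 \<le> \<phi> x" "\<phi> x \<le> 1" for x using f(2) by (auto simp: \<phi>_def)
  have \<psi>1: "\<psi>1 x = 1 - \<phi> x" for x by (simp add: \<psi>1_def \<phi>_def)
  have \<psi>101: "0 \<le> \<psi>1 x" "\<psi>1 x \<le> 1" for x using \<phi>01[of x] by (auto simp: \<psi>1)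
  have \<psi>201: "0 \<le> \<psi>2 x" "\<psi>2 x \<le> 1" for x using \<epsilon> by (auto simp: \<psi>2_def)
  have \<psi>1_supp: "\<psi>1 x = 0" if "t0 + h * A < x" for x
  proof -
    have "A < (x - t0) / h" using that h1 by (simp add: less_divide_eq mult.commute)
    then show ?thesis using f(3) A by (simp add: \<psi>1_def max_def)
  qed
  define q where "q j = expectation (\<lambda>\<omega>. \<psi>1 (e j \<omega>))" for j
  have int\<phi>: "integrable M (\<lambda>\<omega>. \<phi> (U \<omega>))" if "U \<in> borel_measurable M" for U
    using \<phi>01 that by (intro integrable_const_bound[of _ 1]) auto
  have q_sums: "q sums Q"
    unfolding q_def e_def Q \<psi>1_def[symmetric]
    by (rule record_intensity(2)[OF r \<psi>1_meas \<psi>101 \<psi>1_supp])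
  have q0: "0 \<le> q j" for j unfolding q_def using \<psi>101 by (intro integral_nonneg_AE) auto
  have q\<eta>: "q j \<le> \<eta>" for j
  proof -
    have "q j \<le> real r / (t0 - 1) * ((t0 + h * A) - (t0 - 1))"
      unfolding q_def e_def
    proof (rule ceiling_record_expectation_le[OF r \<psi>1_meas \<psi>101])
      fix s :: real assume nz: "\<psi>1 (rceil s) \<noteq> 0"
      then have "t0 < rceil s" by (auto simp: \<psi>1_def split: if_splits)
      moreover have "rceil s \<le> t0 + h * A" using \<psi>1_supp nz by (meson not_less)
      ultimately show "t0 - 1 < s \<and> s \<le> t0 + h * A" by linarith
    next
      have "0 \<le> h * A" using h1 A by simp
      then show "t0 - 1 \<le> t0 + h * A" by simp
    qed (use t0 in auto)
    then show ?thesis by (simp add: \<eta>(1) add.commute)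
  qed
  have prod_e: "expectation (\<lambda>\<omega>. \<Prod>j<n. \<phi> (e j \<omega>)) = (\<Prod>j<n. 1 - q j)" for n
  proof -
    have "indep_vars (\<lambda>_. borel) e {..<n}"
      using indep_vars_subset[OF indep_ceiling_records[OF r, of n], of "{..<n}"] unfolding e_def by auto
    then have "indep_vars (\<lambda>_. borel) (\<lambda>j \<omega>. \<phi> (e j \<omega>)) {..<n}"
      by (rule indep_vars_compose2) auto
    then have "expectation (\<lambda>\<omega>. \<Prod>j<n. \<phi> (e j \<omega>)) = (\<Prod>j<n. expectation (\<lambda>\<omega>. \<phi> (e j \<omega>)))"
      using int\<phi>[OF e_meas] by (intro indep_vars_lebesgue_integral) auto
    also have "\<dots> = (\<Prod>j<n. 1 - q j)"
      using int\<phi>[OF e_meas] by (intro prod.cong refl) (simp add: q_def \<psi>1 prob_space)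
    finally show ?thesis .
  qed
  \<comment> \<open>Rounding a record time up moves its rescaled position by at most \<open>1 / h\<close>; it changes the factor by
    at most \<open>\<epsilon>\<close>, unless it carries the point across \<open>t0\<close>.\<close>
  have round: "\<bar>\<phi> b - \<phi> (rceil b)\<bar> \<le> \<psi>2 (rceil b)" for b
  proof -
    define x where "x = rceil b"
    have bx: "b \<le> x" "x < b + 1" unfolding x_def by linarith+
    have "\<bar>\<phi> b - \<phi> x\<bar> \<le> \<psi>2 x"
    proof (cases "t0 < b")
      case False
      show ?thesis
      proof (cases "t0 < x")
        case True
        then have "\<psi>2 x = 1" using False bx by (simp add: \<psi>2_def)
        then show ?thesis using \<phi>01[of b] \<phi>01[of x] by (simp add: abs_le_iff)
      qed (use False \<psi>201 in \<open>simp add: \<phi>_def\<close>)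
    next
      case True
      then have tx: "t0 < x" using bx by simp
      define u v where "u = (b - t0) / h" and "v = (x - t0) / h"
      have uv: "0 \<le> u" "0 \<le> v" "\<bar>u - v\<bar> \<le> 1 / h"
        using True tx bx h1 by (auto simp: u_def v_def diff_divide_distrib[symmetric] abs_divide intro!: divide_right_mono)
      have eq: "\<phi> b = exp (- f u)" "\<phi> x = exp (- f v)"
        using True tx uv by (simp_all add: \<phi>_def u_def v_def)
      show ?thesis
      proof (cases "x \<le> t0 + h * A + 1")
        case True
        then have "\<epsilon> \<le> \<psi>2 x" using tx \<epsilon> by (simp add: \<psi>2_def)
        then show ?thesis using unif[OF uv] by (simp add: eq)
      next
        case False
        then have "A < u" "A < v" using bx h1 by (auto simp: u_def v_def less_divide_eq mult.commute)
        then show ?thesis using f(3) \<psi>201 by (simp add: eq)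
      qed
    qed
    then show ?thesis by (simp add: x_def)
  qed
  have D_bound: "(\<Sum>j<n. expectation (\<lambda>\<omega>. \<psi>2 (e j \<omega>))) \<le> D" for n
  proof -
    let ?I = "\<lambda>s. indicator {0<..} s * (real r / s * phi r s) * \<psi>2 (rceil s)"
    let ?K = "2 ^ (r + 3) / h"
    let ?g = "\<lambda>s. ?K * indicator {t0 - 1..t0 + 1} s + ?K * \<epsilon> * indicator {t0 - 1..t0 + h * A + 1} s"
    have hA0: "0 \<le> h * A" using h1 A by simp
    have supp: "\<psi>2 x = 0" if "t0 + h * A + 1 < x" for x using that hA0 by (simp add: \<psi>2_def)
    have int: "integrable lborel ?I" "(\<lambda>j. expectation (\<lambda>\<omega>. \<psi>2 (rceil (rec r j \<omega>)))) sums (\<integral>s. ?I s \<partial>lborel)"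
      by (rule record_intensity[OF r \<psi>2_meas \<psi>201], erule supp)+
    have "(\<Sum>j<n. expectation (\<lambda>\<omega>. \<psi>2 (e j \<omega>))) \<le> (\<integral>s. ?I s \<partial>lborel)"
      unfolding sums_unique[OF int(2)] e_def
      using \<psi>201 by (intro sum_le_suminf sums_summable[OF int(2)]) (auto intro!: integral_nonneg_AE)
    also have "\<dots> \<le> (\<integral>s. ?g s \<partial>lborel)"
    proof (rule integral_mono[OF int(1)])
      show "integrable lborel ?g"
        using hA0 by (intro Bochner_Integration.integrable_add integrable_mult_right integrable_real_indicator) auto
      fix s :: real
      show "?I s \<le> ?g s"
      proof (cases "\<psi>2 (rceil s) = 0")
        case True
        then show ?thesis using h1 \<epsilon> by simp
      next
        case False
        then have c: "t0 < rceil s" "rceil s \<le> t0 + h * A + 1"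
          using hA0 by (auto simp: \<psi>2_def split: if_splits)
        then have s: "t0 - 1 < s" "s \<le> t0 + h * A + 1" by linarith+
        have "h * (real r / s * phi r s) \<le> 2 ^ (r + 3)"
          unfolding hd by (rule record_density_bound[OF r t0 Phi]) (use s hA hd in auto)
        then have K: "real r / s * phi r s \<le> ?K" using h1 by (simp add: le_divide_eq mult.commute)
        have "?I s \<le> ?K * \<psi>2 (rceil s)"
        proof -
          have "indicator {0<..} s = (1 :: real)" using s t0 by simp
          then show ?thesis using mult_right_mono[OF K \<psi>201(1)] by simp
        qed
        also have "\<dots> \<le> ?g s"
        proof (cases "rceil s < t0 + 1")
          case True
          then have "s \<le> t0 + 1" by linarith
          then show ?thesis using c True s h1 \<epsilon> by (simp add: \<psi>2_def)
        next
          case False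
          then show ?thesis using c s h1 \<epsilon> by (simp add: \<psi>2_def)
        qed
        finally show ?thesis .
      qed
    qed
    also have "\<dots> = ?K * 2 + ?K * \<epsilon> * (h * A + 2)"
      using hA0 by (subst Bochner_Integration.integral_add) (auto intro!: integrable_mult_right integrable_real_indicator)
    also have "\<dots> \<le> D"
    proof -
      have "h * A + 2 \<le> h * (A + 2)" using h1 by (simp add: algebra_simps)
      then have "?K * \<epsilon> * (h * A + 2) \<le> ?K * \<epsilon> * (h * (A + 2))"
        using h1 \<epsilon> by (intro mult_left_mono) auto
      also have "\<dots> = 2 ^ (r + 3) * (\<epsilon> * (A + 2))" using h1 by simp
      finally show ?thesis by (simp add: D distrib_left)
    qed
    finally show ?thesis .
  qed
  have approx: "\<bar>expectation (\<lambda>\<omega>. \<Prod>j<n. \<phi> (rec r j \<omega>)) - (\<Prod>j<n. 1 - q j)\<bar> \<le> D" for n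
  proof -
    have intp: "integrable M (\<lambda>\<omega>. \<Prod>j<n. \<phi> (U j \<omega>))" if "\<And>j. U j \<in> borel_measurable M" for U
      using \<phi>01 that by (intro integrable_const_bound[of _ 1]) (auto simp: abs_prod intro!: AE_I2 prod_le_1)
    have int2: "integrable M (\<lambda>\<omega>. \<psi>2 (e j \<omega>))" for j
      using \<psi>201 by (intro integrable_const_bound[of _ 1]) auto
    have "\<bar>expectation (\<lambda>\<omega>. \<Prod>j<n. \<phi> (rec r j \<omega>)) - expectation (\<lambda>\<omega>. \<Prod>j<n. \<phi> (e j \<omega>))\<bar>
      = \<bar>expectation (\<lambda>\<omega>. (\<Prod>j<n. \<phi> (rec r j \<omega>)) - (\<Prod>j<n. \<phi> (e j \<omega>)))\<bar>"
      using intp[OF rec_meas] intp[OF e_meas] by simp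
    also have "\<dots> \<le> expectation (\<lambda>\<omega>. \<Sum>j<n. \<psi>2 (e j \<omega>))"
    proof (intro integral_abs_bound[THEN order_trans] integral_mono)
      fix \<omega>
      have "\<bar>(\<Prod>j<n. \<phi> (rec r j \<omega>)) - (\<Prod>j<n. \<phi> (e j \<omega>))\<bar> \<le> (\<Sum>j<n. \<bar>\<phi> (rec r j \<omega>) - \<phi> (e j \<omega>)\<bar>)"
        using norm_prod_diff[of "{..<n}" "\<lambda>j. \<phi> (rec r j \<omega>)" "\<lambda>j. \<phi> (e j \<omega>)"] \<phi>01 by simp
      also have "\<dots> \<le> (\<Sum>j<n. \<psi>2 (e j \<omega>))" unfolding e_def by (intro sum_mono round)
      finally show "\<bar>(\<Prod>j<n. \<phi> (rec r j \<omega>)) - (\<Prod>j<n. \<phi> (e j \<omega>))\<bar> \<le> (\<Sum>j<n. \<psi>2 (e j \<omega>))" .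
    qed (use intp[OF rec_meas] intp[OF e_meas] int2 in auto)
    also have "\<dots> = (\<Sum>j<n. expectation (\<lambda>\<omega>. \<psi>2 (e j \<omega>)))" using int2 by simp
    also have "\<dots> \<le> D" by (rule D_bound)
    finally show ?thesis unfolding prod_e .
  qed
  have hpos: "0 < time_scale M P X r t0" using h1 hd by simp
  have t00: "0 \<le> t0" using t0 by simp
  have lim: "(\<lambda>n. expectation (\<lambda>\<omega>. \<Prod>j<n. \<phi> (rec r j \<omega>))) \<longlonglongrightarrow> L"
    unfolding L
  proof (rule integral_dominated_convergence[where w = "\<lambda>_. 1"])
    show "(\<lambda>\<omega>. exp (- (\<integral>x. f x \<partial>record_points r t0 \<omega>))) \<in> borel_measurable M"
      using scaled_record_integral_meas[OF r t00 hpos f(1)] by measurable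
    show "AE \<omega> in M. (\<lambda>n. \<Prod>j<n. \<phi> (rec r j \<omega>)) \<longlonglongrightarrow> exp (- (\<integral>x. f x \<partial>record_points r t0 \<omega>))"
    proof (rule AE_I2)
      fix \<omega> assume "\<omega> \<in> space M"
      from tendsto_exp[OF tendsto_minus[OF scaled_record_integral_limit[OF this r t00 hpos f(1)]]]
      have "(\<lambda>n. exp (- (\<Sum>j<n. if t0 < rec r j \<omega> then f (max 0 ((rec r j \<omega> - t0) / h)) else 0)))
        \<longlonglongrightarrow> exp (- (\<integral>x. f x \<partial>record_points r t0 \<omega>))"
        unfolding hd .
      moreover have "exp (- (\<Sum>j<n. if t0 < rec r j \<omega> then f (max 0 ((rec r j \<omega> - t0) / h)) else 0)) = (\<Prod>j<n. \<phi> (rec r j \<omega>))" for n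
        unfolding sum_negf[symmetric] exp_sum[OF finite_lessThan] by (intro prod.cong refl) (simp add: \<phi>_def)
      ultimately show "(\<lambda>n. \<Prod>j<n. \<phi> (rec r j \<omega>)) \<longlonglongrightarrow> exp (- (\<integral>x. f x \<partial>record_points r t0 \<omega>))"
        by simp
    qed
    show "AE \<omega> in M. norm (\<Prod>j<n. \<phi> (rec r j \<omega>)) \<le> 1" for n
      using \<phi>01 by (intro AE_I2) (auto simp: abs_prod intro!: prod_le_1)
  qed auto
  have Qn: "(\<lambda>n. \<Sum>j<n. q j) \<longlonglongrightarrow> Q" using q_sums by (simp add: sums_def)
  have bounds: "exp (- (1 + 2 * \<eta>) * (\<Sum>j<n. q j)) \<le> (\<Prod>j<n. 1 - q j)" "(\<Prod>j<n. 1 - q j) \<le> exp (- (\<Sum>j<n. q j))" for n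
    by (rule prod_one_minus_bounds[of q \<eta>], rule q0, rule q\<eta>, rule \<eta>(2))+
  have "(\<lambda>n. exp (- (1 + 2 * \<eta>) * (\<Sum>j<n. q j)) - D) \<longlonglongrightarrow> exp (- (1 + 2 * \<eta>) * Q) - D"
    by (intro tendsto_intros Qn)
  moreover have "exp (- (1 + 2 * \<eta>) * (\<Sum>j<n. q j)) - D \<le> expectation (\<lambda>\<omega>. \<Prod>j<n. \<phi> (rec r j \<omega>))" for n
    using approx[of n] bounds(1)[of n] unfolding abs_le_iff by linarith
  ultimately show "exp (- (1 + 2 * \<eta>) * Q) - D \<le> L"
    using lim by (intro LIMSEQ_le) auto
  have "(\<lambda>n. exp (- (\<Sum>j<n. q j)) + D) \<longlonglongrightarrow> exp (- Q) + D"
    by (intro tendsto_intros Qn)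
  moreover have "expectation (\<lambda>\<omega>. \<Prod>j<n. \<phi> (rec r j \<omega>)) \<le> exp (- (\<Sum>j<n. q j)) + D" for n
    using approx[of n] bounds(2)[of n] unfolding abs_le_iff by linarith
  ultimately show "L \<le> exp (- Q) + D"
    using lim by (intro LIMSEQ_le[OF lim]) auto
qed

lemma test_function_uniform:
  assumes f: "f \<in> test_functions" and \<epsilon>: "0 < \<epsilon>"
  obtains \<delta> where "0 < \<delta>" "\<And>x y. 0 \<le> x \<Longrightarrow> 0 \<le> y \<Longrightarrow> \<bar>x - y\<bar> < \<delta> \<Longrightarrow> \<bar>exp (- f x) - exp (- f y)\<bar> \<le> \<epsilon>"
proof -
  obtain a C where a: "0 \<le> a" "\<And>x. x > a \<Longrightarrow> f x = 0" "\<And>x. 0 \<le> x \<Longrightarrow> \<bar>f x\<bar> \<le> C"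
    using test_function_bounded[OF f] by blast
  have "continuous_on {0..a + 1} (\<lambda>x. exp (- f x))"
    using f by (auto simp: test_functions_def intro!: continuous_intros intro: continuous_on_subset)
  then have "uniformly_continuous_on {0..a + 1} (\<lambda>x. exp (- f x))"
    by (intro compact_uniformly_continuous) auto
  then obtain \<delta> where \<delta>: "0 < \<delta>" "\<And>x y. x \<in> {0..a + 1} \<Longrightarrow> y \<in> {0..a + 1} \<Longrightarrow> dist y x < \<delta> \<Longrightarrow> dist (exp (- f y)) (exp (- f x)) < \<epsilon>"
    unfolding uniformly_continuous_on_def using \<epsilon> by metis
  have clamp: "f (min (a + 1) x) = f x" if "0 \<le> x" for x
    using a by (cases "x \<le> a + 1") auto
  show ?thesis
  proof (rule that[OF \<delta>(1)])
    fix x y :: real assume xy: "0 \<le> x" "0 \<le> y" "\<bar>x - y\<bar> < \<delta>"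
    have "dist (exp (- f (min (a + 1) x))) (exp (- f (min (a + 1) y))) < \<epsilon>"
      by (rule \<delta>(2)) (use xy a in \<open>auto simp: dist_real_def min_def\<close>)
    then show "\<bar>exp (- f x) - exp (- f y)\<bar> \<le> \<epsilon>"
      using xy by (simp add: clamp dist_real_def)
  qed
qed

lemma record_Laplace_limit:
  assumes r: "1 \<le> r" and Phi: "filterlim (Phi M P X r) at_top at_top"
    and ratio: "\<And>\<theta>. 0 < \<theta> \<Longrightarrow> ((\<lambda>t. Phi M P X r (t + time_scale M P X r t * \<theta>) / Phi M P X r t) \<longlongrightarrow> 1) at_top"
    and f: "f \<in> test_functions" "\<And>x. 0 \<le> x \<Longrightarrow> 0 \<le> f x" "\<And>x. x > A \<Longrightarrow> f x = 0" and A: "0 \<le> A"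
  shows "((\<lambda>t0. expectation (\<lambda>\<omega>. exp (- (\<integral>x. f x \<partial>record_points r t0 \<omega>))))
    \<longlongrightarrow> exp (- (\<integral>x. indicator {0<..A} x * (1 - exp (- f x)) \<partial>lborel))) at_top"
proof -
  let ?h = "\<lambda>t. time_scale M P X r t"
  define g where "g x = 1 - exp (- f (max 0 x))" for x
  define Q where "Q t = (\<integral>s. indicator {0<..} s * (real r / s * phi r s) *
        (if t < rceil s then 1 - exp (- f (max 0 ((rceil s - t) / ?h t))) else 0) \<partial>lborel)" for t
  define \<Lambda> where "\<Lambda> = (\<integral>x. indicator {0<..A} x * (1 - exp (- f x)) \<partial>lborel)"
  define \<eta> where "\<eta> t = real r / (t - 1) * (?h t * A + 1)" for t
  define L where "L t0 = expectation (\<lambda>\<omega>. exp (- (\<integral>x. f x \<partial>record_points r t0 \<omega>)))" for t0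
  have "continuous_on UNIV (\<lambda>x. f (max 0 x))"
    by (rule test_function_clamp_continuous[OF f(1)])
  then have gc: "continuous_on UNIV g" unfolding g_def by (intro continuous_intros)
  have "((\<lambda>t. \<integral>s. indicator {0<..} s * (real r / s * phi r s) *
        (if t < rceil s then g ((rceil s - t) / ?h t) else 0) \<partial>lborel)
      \<longlongrightarrow> (\<integral>x. indicator {0<..A} x * g x \<partial>lborel)) at_top"
    by (rule record_intensity_limit[OF r Phi ratio gc _ _ _ A]) (use f A in \<open>auto simp: g_def max_def\<close>)
  moreover have "(\<integral>x. indicator {0<..A} x * g x \<partial>lborel) = \<Lambda>"
    unfolding \<Lambda>_def by (intro Bochner_Integration.integral_cong refl) (auto simp: g_def indicator_def)
  ultimately have Q_lim: "(Q \<longlongrightarrow> \<Lambda>) at_top" unfolding Q_def g_def by simp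
  have invh: "((\<lambda>t. inverse (?h t)) \<longlongrightarrow> 0) at_top" by (rule tendsto_inverse_0_at_top[OF time_scale_at_top[OF r Phi]])
  have ht: "((\<lambda>t. ?h t / t) \<longlongrightarrow> 0) at_top" by (rule time_scale_over_time[OF r Phi])
  have invt: "((\<lambda>t::real. inverse t) \<longlongrightarrow> 0) at_top" by (rule tendsto_inverse_0_at_top[OF filterlim_ident])
  have \<eta>_lim: "(\<eta> \<longlongrightarrow> 0) at_top"
  proof -
    have "((\<lambda>t. real r / (1 - inverse t) * (?h t / t * A + inverse t)) \<longlongrightarrow> real r / (1 - 0) * (0 * A + 0)) at_top"
      by (intro tendsto_intros ht invt) auto
    moreover have "\<forall>\<^sub>F t in at_top. real r / (1 - inverse t) * (?h t / t * A + inverse t) = \<eta> t"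
      using eventually_gt_at_top[of 1]
    proof eventually_elim
      case (elim t)
      have "t * (1 - inverse t) = t - 1" "t * (?h t / t * A + inverse t) = ?h t * A + 1"
        using elim by (simp_all add: algebra_simps)
      then have "\<eta> t = real r / (t * (1 - inverse t)) * (t * (?h t / t * A + inverse t))"
        unfolding \<eta>_def by simp
      then show ?case using elim by simp
    qed
    ultimately show ?thesis by (simp add: Lim_transform_eventually)
  qed
  have "(L \<longlongrightarrow> exp (- \<Lambda>)) at_top"
  proof (rule tendstoI)
    fix \<kappa> :: real assume \<kappa>: "0 < \<kappa>"
    \<comment> \<open>Small enough for the part of the rounding error that comes from the modulus of continuity of \<open>f\<close>;
      the other part vanishes with \<open>1 / h\<close>.\<close>
    define \<epsilon> where "\<epsilon> = min 1 (\<kappa> / (4 * 2 ^ (r + 3) * (A + 2)))"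
    have \<epsilon>: "0 < \<epsilon>" "\<epsilon> \<le> 1" using \<kappa> A by (auto simp: \<epsilon>_def)
    have \<epsilon>A: "2 ^ (r + 3) * (\<epsilon> * (A + 2)) \<le> \<kappa> / 4"
    proof -
      have "\<epsilon> * (A + 2) \<le> \<kappa> / (4 * 2 ^ (r + 3) * (A + 2)) * (A + 2)"
        using A by (intro mult_right_mono) (auto simp: \<epsilon>_def)
      also have "\<dots> = \<kappa> / 4 / 2 ^ (r + 3)" using A by simp
      finally show ?thesis by (simp add: le_divide_eq mult.commute)
    qed
    obtain \<delta> where \<delta>: "0 < \<delta>" "\<And>x y. 0 \<le> x \<Longrightarrow> 0 \<le> y \<Longrightarrow> \<bar>x - y\<bar> < \<delta> \<Longrightarrow> \<bar>exp (- f x) - exp (- f y)\<bar> \<le> \<epsilon>"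
      using test_function_uniform[OF f(1) \<epsilon>(1)] by blast
    have "((\<lambda>t. exp (- (1 + 2 * \<eta> t) * Q t)) \<longlongrightarrow> exp (- (1 + 2 * 0) * \<Lambda>)) at_top"
      by (intro tendsto_intros \<eta>_lim Q_lim)
    then have "\<forall>\<^sub>F t in at_top. exp (- \<Lambda>) - \<kappa> / 4 < exp (- (1 + 2 * \<eta> t) * Q t)"
      using \<kappa> by (intro order_tendstoD) auto
    moreover have "((\<lambda>t. exp (- Q t)) \<longlongrightarrow> exp (- \<Lambda>)) at_top" by (intro tendsto_intros Q_lim)
    then have "\<forall>\<^sub>F t in at_top. exp (- Q t) < exp (- \<Lambda>) + \<kappa> / 4"
      using \<kappa> by (intro order_tendstoD) auto
    moreover have "((\<lambda>t. 2 ^ (r + 3) * (2 * inverse (?h t))) \<longlongrightarrow> 2 ^ (r + 3) * (2 * 0)) at_top"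
      by (intro tendsto_intros invh)
    then have "\<forall>\<^sub>F t in at_top. 2 ^ (r + 3) * (2 * inverse (?h t)) < \<kappa> / 4"
      using \<kappa> by (intro order_tendstoD) auto
    moreover have "\<forall>\<^sub>F t in at_top. inverse (?h t) < \<delta>" using invh \<delta>(1) by (rule order_tendstoD)
    moreover have "\<forall>\<^sub>F t in at_top. 1 < ?h t"
      using filterlim_at_top_dense[THEN iffD1, OF time_scale_at_top[OF r Phi], rule_format, of 1] .
    moreover have "\<forall>\<^sub>F t in at_top. 1 < Phi M P X r t"
      using filterlim_at_top_dense[THEN iffD1, OF Phi, rule_format, of 1] .
    moreover have "((\<lambda>t. ?h t / t * A + inverse t) \<longlongrightarrow> 0 * A + 0) at_top" by (intro tendsto_intros ht invt)
    then have "\<forall>\<^sub>F t in at_top. ?h t / t * A + inverse t < 1" by (rule order_tendstoD) simp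
    moreover have "\<forall>\<^sub>F t in at_top. \<eta> t < 1/2" using \<eta>_lim by (rule order_tendstoD) simp
    ultimately show "\<forall>\<^sub>F t in at_top. dist (L t) (exp (- \<Lambda>)) < \<kappa>"
      using eventually_ge_at_top[of 2]
    proof eventually_elim
      case (elim t)
      have hA: "?h t * A + 1 \<le> t"
      proof -
        have "t * (?h t / t * A + inverse t) \<le> t * 1" using elim by (intro mult_left_mono) auto
        then show ?thesis using elim by (simp add: distrib_left)
      qed
      define D where "D = 2 ^ (r + 3) * (2 / ?h t + \<epsilon> * (A + 2))"
      have "D = 2 ^ (r + 3) * (2 * inverse (?h t)) + 2 ^ (r + 3) * (\<epsilon> * (A + 2))"
        by (simp add: D_def distrib_left divide_inverse)
      then have D: "D < \<kappa> / 2" using elim \<epsilon>A by linarith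
      have unif: "\<bar>exp (- f x) - exp (- f y)\<bar> \<le> \<epsilon>" if "0 \<le> x" "0 \<le> y" "\<bar>x - y\<bar> \<le> 1 / ?h t" for x y
      proof (rule \<delta>(2)[OF that(1,2)])
        have "1 / ?h t < \<delta>" unfolding divide_inverse mult_1_left by (rule elim)
        with that(3) show "\<bar>x - y\<bar> < \<delta>" by linarith
      qed
      have hyp: "2 \<le> t" "1 \<le> Phi M P X r t" "1 \<le> ?h t" "\<eta> t \<le> 1/2" by (rule elim less_imp_le[OF elim(5)] less_imp_le[OF elim(6)] less_imp_le[OF elim(8)])+
      note b = record_Laplace_bounds[OF r hyp(1,2) A refl hyp(3) hA f \<epsilon> unif \<eta>_def hyp(4) Q_def D_def L_def]
      then have "exp (- (1 + 2 * \<eta> t) * Q t) - D \<le> L t" "L t \<le> exp (- Q t) + D" by auto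
      then show ?case using elim D unfolding dist_real_def abs_less_iff by linarith
    qed
  qed
  then show ?thesis unfolding L_def \<Lambda>_def .
qed

end

theorem theorem1:
  fixes M :: "'a measure" and M' :: "'b measure"
    and p :: "nat \<Rightarrow> real"
    and P :: "real \<Rightarrow> 'a \<Rightarrow> nat" and X :: "nat \<Rightarrow> 'a \<Rightarrow> nat"
    and N :: "real \<Rightarrow> 'b \<Rightarrow> nat"
    and r :: nat
  assumes "occupancy_scheme M p P X"
    and "r \<ge> 1"
    and "filterlim (Phi M P X r) at_top at_top"
    and "(\<forall>\<theta>>0. ((\<lambda>t0. Phi M P X r (t0 + time_scale M P X r t0 * \<theta>) / Phi M P X r t0) \<longlongrightarrow> 1) at_top) \<or>
         ((\<lambda>t. Phi M P X (r + 1) t / (Phi M P X r t)\<^sup>2) \<longlongrightarrow> 0) at_top"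
    and "poisson_process M' 1 N"
  shows "converges_in_distribution vague_topology at_top
           M (\<lambda>t0 \<omega>. measure_of_counting (\<lambda>\<theta>. scaled_record_count M P X r t0 \<theta> \<omega>))
           M' (\<lambda>\<omega>. measure_of_counting (\<lambda>\<theta>. real (N \<theta> \<omega>)))"
proof -
  interpret poissonised_occupancy M p P X
    using assms(1) by (simp add: poissonised_occupancy_def poissonised_occupancy_axioms_def occupancy_scheme_def)
  have M': "prob_space M'" using assms(5) by (simp add: poisson_process_def)
  have ratio: "((\<lambda>t. Phi M P X r (t + time_scale M P X r t * \<theta>) / Phi M P X r t) \<longlongrightarrow> 1) at_top" if "0 < \<theta>" for \<theta>
    using assms(4) that Phi_ratio_of_next_small[OF assms(2,3) _ that] by blast
  have supp: "\<exists>A::nat. \<forall>x>real A. f x = 0" if f: "f \<in> test_functions" for f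
  proof -
    obtain a where a: "\<And>x. x > a \<Longrightarrow> f x = 0" using f by (auto simp: test_functions_def)
    obtain A :: nat where "a \<le> real A" using real_arch_simple by blast
    then show ?thesis using a by (intro exI[of _ A]) auto
  qed
  have hpos: "\<forall>\<^sub>F t in at_top. 0 < time_scale M P X r t"
    using filterlim_at_top_dense[THEN iffD1, OF time_scale_at_top[OF assms(2,3)], rule_format, of 0] .
  show ?thesis
  proof (rule converges_in_distribution_Laplace[OF prob_space_axioms M'])
    show "\<forall>\<^sub>F t in at_top. (\<forall>\<omega>\<in>space M. measure_of_counting (\<lambda>\<theta>. scaled_record_count M P X r t \<theta> \<omega>) \<in> point_measures) \<and>
      (\<forall>f\<in>test_functions. (\<forall>x\<ge>0. 0 \<le> f x) \<longrightarrow>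
        (\<lambda>\<omega>. \<integral>x. f x \<partial>measure_of_counting (\<lambda>\<theta>. scaled_record_count M P X r t \<theta> \<omega>)) \<in> borel_measurable M)"
      using hpos eventually_ge_at_top[of 0]
    proof eventually_elim
      case (elim t)
      show ?case
        by (intro conjI ballI impI scaled_record_process(1) scaled_record_integral_meas elim assms(2))
    qed
    show "measure_of_counting (\<lambda>\<theta>. real (N \<theta> \<omega>)) \<in> point_measures" if "\<omega> \<in> space M'" for \<omega>
      using assms(5) that by (intro measure_of_counting_nat(1)) (auto simp: poisson_process_def)
    fix f assume f: "f \<in> test_functions" "\<And>x. 0 \<le> x \<Longrightarrow> 0 \<le> f x"
    obtain A :: nat where A: "\<And>x. x > real A \<Longrightarrow> f x = 0" using supp[OF f(1)] by blast
    show "(\<lambda>\<omega>. \<integral>x. f x \<partial>measure_of_counting (\<lambda>\<theta>. real (N \<theta> \<omega>))) \<in> borel_measurable M'"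
      by (rule poisson_process_Laplace(1)[OF assms(5) f A])
    have poisson: "(\<integral>\<omega>. exp (- (\<integral>x. f x \<partial>measure_of_counting (\<lambda>\<theta>. real (N \<theta> \<omega>)))) \<partial>M')
      = exp (- (\<integral>x. indicator {0<..real A} x * (1 - exp (- f x)) \<partial>lborel))"
      by (rule poisson_process_Laplace(2)[OF assms(5) f A])
    show "((\<lambda>t. \<integral>\<omega>. exp (- (\<integral>x. f x \<partial>measure_of_counting (\<lambda>\<theta>. scaled_record_count M P X r t \<theta> \<omega>))) \<partial>M)
      \<longlongrightarrow> (\<integral>\<omega>. exp (- (\<integral>x. f x \<partial>measure_of_counting (\<lambda>\<theta>. real (N \<theta> \<omega>)))) \<partial>M')) at_top"
      unfolding poisson
      by (rule record_Laplace_limit[OF assms(2,3) ratio f A]; simp)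
  qed
qed

end
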